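(* Let $\lambda^*$ denote the infimum of the set of all $\lambda>0$ for which there exists a multi-twisted paper Moebius band of aspect ratio $\lambda$, i.e. a smooth isometric embedding $I: M_\lambda \to \mathbb{R}^3$ of the flat Moebius band $M_\lambda$ such that the image $I(\partial M_\lambda)$ of the boundary is a non-trivial knot in $\mathbb{R}^3$. Then $\lambda^* \leq 3$.
   Context: For $\lambda>0$, the flat Moebius band of aspect ratio $\lambda$ is $M_\lambda = ([0,\lambda]\times[0,1])/\sim$, where $(0,y)\sim(\lambda,1-y)$ for all $y\in[0,1]$, with the flat metric induced from the Euclidean metric on the rectangle $[0,\lambda]\times[0,1]$; it is a smooth flat surface whose boundary $\partial M_\lambda$ is a single closed loop of length $2\lambda$. A (smooth embedded) paper Moebius band of aspect ratio $\lambda$ is an infinitely differentiable (up to and including the boundary) isometric embedding $I: M_\lambda\to\mathbb{R}^3$, where isometric means that $I$ preserves the Riemannian metric (equivalently, the lengths of smooth curves) and embedding means that $I$ is an injective immersion. We often identify the paper Moebius band with its image. A paper Moebius band is called multi-twisted if its boundary loop $I(\partial M_\lambda)\subset\mathbb{R}^3$ is a non-trivial knot, i.e. is not ambient isotopic in $\mathbb{R}^3$ to a round circle. The infimum of the empty set is taken to be $+\infty$, so the assertion includes that multi-twisted paper Moebius bands exist. *)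

theory Defs
  imports "HOL-Analysis.Analysis"
begin

section \<open>The flat Moebius band\<close>

definition moebius_rect :: "real \<Rightarrow> (real \<times> real) set" where
  "moebius_rect l = {0..l} \<times> {0..1}"

definition moebius_rel :: "real \<Rightarrow> ((real \<times> real) \<times> (real \<times> real)) set" where
  "moebius_rel l = {(p, q). p \<in> moebius_rect l \<and> q \<in> moebius_rect l \<and>
     (p = q \<or> (\<exists>y. (p = (0, y) \<and> q = (l, 1 - y)) \<or> (p = (l, 1 - y) \<and> q = (0, y))))}"

lemma equiv_moebius_rel:
  assumes "l > 0"
  shows "equiv (moebius_rect l) (moebius_rel l)"
  using assms
  by (intro equivI refl_onI symI transI) (auto simp: moebius_rel_def)

definition moebius_band :: "real \<Rightarrow> (real \<times> real) set set" where
  "moebius_band l = moebius_rect l // moebius_rel l"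

definition moebius_boundary :: "real \<Rightarrow> (real \<times> real) set set" where
  "moebius_boundary l = (\<lambda>p. moebius_rel l `` {p}) ` ({0..l} \<times> {0, 1})"

text \<open>
  The flat smooth structure on \<open>M\<^sub>l\<close> is the one for which the projection \<open>moebius_cover l\<close> of the
  infinite strip \<open>\<real> \<times> [0,1]\<close> onto \<open>M\<^sub>l\<close> is a local isometry; its restriction to small relatively
  open subsets of the strip gives isometric charts, including across the glued edge.  The deck
  group is generated by \<open>(x, y) \<mapsto> (x + l, 1 - y)\<close>, and \<open>moebius_cover l\<close> first moves a point
  into \<open>[0,l) \<times> [0,1]\<close> by a deck transformation.
\<close>

definition moebius_strip :: "(real \<times> real) set" where
  "moebius_strip = UNIV \<times> {0..1}"

definition moebius_cover :: "real \<Rightarrow> real \<times> real \<Rightarrow> (real \<times> real) set" where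
  "moebius_cover l = (\<lambda>(x, y).
     moebius_rel l `` {(x - of_int \<lfloor>x / l\<rfloor> * l, if even \<lfloor>x / l\<rfloor> then y else 1 - y)})"

lemma moebius_cover_deck:
  assumes "l > 0"
  shows "moebius_cover l (x + l, 1 - y) = moebius_cover l (x, y)"
proof -
  have "(x + l) / l = x / l + 1"
    using assms by (simp add: field_simps)
  then have "\<lfloor>(x + l) / l\<rfloor> = \<lfloor>x / l\<rfloor> + 1"
    by simp
  then show ?thesis
    by (simp add: moebius_cover_def algebra_simps)
qed

lemma moebius_cover_rect:
  assumes "l > 0" and "p \<in> moebius_rect l"
  shows "moebius_cover l p = moebius_rel l `` {p}"
proof (cases "fst p = l")
  case False
  then have "0 \<le> fst p / l" "fst p / l < 1"
    using assms by (auto simp: moebius_rect_def)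
  then have "\<lfloor>fst p / l\<rfloor> = 0"
    by linarith
  then show ?thesis
    by (simp add: moebius_cover_def case_prod_beta)
next
  case True
  have "((0, 1 - snd p), p) \<in> moebius_rel l"
    using assms True by (auto simp: moebius_rel_def moebius_rect_def prod_eq_iff)
  then have "moebius_rel l `` {(0, 1 - snd p)} = moebius_rel l `` {p}"
    using equiv_class_eq[OF equiv_moebius_rel] assms(1) by blast
  then show ?thesis
    using assms True by (simp add: moebius_cover_def case_prod_beta)
qed

section \<open>Smooth isometric embeddings\<close>

text \<open>
  Derivatives are taken within \<open>S\<close>, so that for the closed strip smoothness includes the
  boundary.  They are meaningful for sets such as the strip, on which they are unique.
\<close>

primrec Ck_on ::
  "nat \<Rightarrow> 'a::real_normed_vector set \<Rightarrow> ('a \<Rightarrow> 'b::real_normed_vector) \<Rightarrow> bool" where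
  "Ck_on 0 S f \<longleftrightarrow> continuous_on S f"
| "Ck_on (Suc k) S f \<longleftrightarrow> f differentiable_on S \<and>
     (\<forall>v. Ck_on k S (\<lambda>p. frechet_derivative f (at p within S) v))"

definition smooth_on ::
  "'a::real_normed_vector set \<Rightarrow> ('a \<Rightarrow> 'b::real_normed_vector) \<Rightarrow> bool" where
  "smooth_on S f \<longleftrightarrow> (\<forall>k. Ck_on k S f)"

definition paper_moebius_band ::
  "real \<Rightarrow> ((real \<times> real) set \<Rightarrow> real ^ 3) \<Rightarrow> bool" where
  "paper_moebius_band l I \<longleftrightarrow>
     (let F = I \<circ> moebius_cover l;
          D = (\<lambda>p. frechet_derivative F (at p within moebius_strip))
      in smooth_on moebius_strip F \<and>
         (\<forall>p\<in>moebius_strip. \<forall>v w. D p v \<bullet> D p w = v \<bullet> w) \<and>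
         (\<forall>p\<in>moebius_strip. inj (D p)) \<and>
         inj_on I (moebius_band l))"

section \<open>Knots\<close>

definition ambient_isotopic :: "'a::topological_space set \<Rightarrow> 'a set \<Rightarrow> bool" where
  "ambient_isotopic K L \<longleftrightarrow>
     (\<exists>h :: real \<Rightarrow> 'a \<Rightarrow> 'a.
        continuous_on ({0..1} \<times> UNIV) (\<lambda>(t, x). h t x) \<and>
        (\<forall>t\<in>{0..1}. \<exists>g. homeomorphism UNIV UNIV (h t) g) \<and>
        h 0 = id \<and> h 1 ` K = L)"

definition round_circle :: "(real ^ 3) set \<Rightarrow> bool" where
  "round_circle C \<longleftrightarrow>
     (\<exists>c n r. r > 0 \<and> n \<noteq> 0 \<and> C = {x. dist c x = r \<and> n \<bullet> (x - c) = 0})"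

definition knot :: "(real ^ 3) set \<Rightarrow> bool" where
  "knot K \<longleftrightarrow> (\<exists>g. simple_path g \<and> pathfinish g = pathstart g \<and> path_image g = K)"

definition nontrivial_knot :: "(real ^ 3) set \<Rightarrow> bool" where
  "nontrivial_knot K \<longleftrightarrow> knot K \<and> \<not> (\<exists>C. round_circle C \<and> ambient_isotopic K C)"

definition multi_twisted ::
  "real \<Rightarrow> ((real \<times> real) set \<Rightarrow> real ^ 3) \<Rightarrow> bool" where
  "multi_twisted l I \<longleftrightarrow> paper_moebius_band l I \<and> nontrivial_knot (I ` moebius_boundary l)"

text \<open>Taken in the extended reals, where the infimum of the empty set is \<open>\<infinity>\<close>.\<close>

definition lambda_star :: ereal where
  "lambda_star = Inf {ereal l | l. l > 0 \<and> (\<exists>I. multi_twisted l I)}"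

end

theory Submission
  imports Defs
begin

text \<open>
  A strip of length slightly more than 3 is folded into a flat figure, and the folds are rounded by
  thin U-turns; this gives paper Moebius bands of aspect ratio arbitrarily close to 3.  Around a
  suitable axis the boundary of such a band is a closed 2-braid with three half-twists, a trefoil.

  To see that it is knotted, the complement of the boundary is mapped to the set of \<open>(a, b)\<close> with
  \<open>b\<^sup>2 \<noteq> a ^ 3\<close>: if the braid meets a half-plane bounded by the axis in \<open>m \<plusminus> d\<close>, a point \<open>q\<close> of this half-plane goes to
  \<open>(d ^ (2/3), q - m)\<close>, and the three half-twists are what makes \<open>d ^ (2/3)\<close> single-valued around the axis.  The
  covering of the target by the roots of \<open>x ^ 3 - 3 a x - 2 b\<close> detects two loops that do not commute up to homotopy.

  In the complement of a round circle all loops commute: they can be pushed off the axis of the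
  circle, and the complement of circle and axis is a product of two punctured planes, on which
  multiplication is an H-space structure.
\<close>

section \<open>Loops in the complement of a round circle\<close>

text \<open>The value 3 comes from the flat limit: half of the strip spends length 1/2 up to the
  first fold and length 1 on the square with the diagonal fold; the other terms of \<open>L\<close>
  are of order \<open>\<delta>\<close>.

  The fundamental group of the complement is never computed. Commutativity of loops, stated by
  homotopies of paths, is transported by homeomorphisms and is refuted by pushing two loops forward
  and lifting them to a covering. The set \<open>b^2 = a^3\<close> is a cone over the trefoil, and
  the marked roots form a three-sheeted covering of its complement whose monodromy is the symmetric
  group on three letters.

  The geometric half is shaped by the fact that most of the band is horizontal, so that
  \<open>z\<close> is no height function for a braid: a small perturbation of \<open>z\<close> must
  be monotone on every strand and still leave control over the sides of the axis. The half-turn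
  symmetry halves these checks. Rounded folds that are exactly straight before and after the turn
  let neighbouring pieces agree on open overlaps, which gives smoothness.\<close>

definition loops_commute :: "'a::real_normed_vector set \<Rightarrow> 'a \<Rightarrow> bool" where
  "loops_commute S p \<longleftrightarrow> (\<forall>\<alpha> \<beta>. path \<alpha> \<and> path_image \<alpha> \<subseteq> S \<and> pathstart \<alpha> = p \<and> pathfinish \<alpha> = p \<and>
     path \<beta> \<and> path_image \<beta> \<subseteq> S \<and> pathstart \<beta> = p \<and> pathfinish \<beta> = p \<longrightarrow>
     homotopic_paths S (\<alpha> +++ \<beta>) (\<beta> +++ \<alpha>))"

lemma homotopic_paths_Pair:
  assumes "homotopic_paths S a a'" "homotopic_paths T b b'"
  shows "homotopic_paths (S \<times> T) (\<lambda>t. (a t, b t)) (\<lambda>t. (a' t, b' t))"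
proof -
  obtain h where h: "continuous_on ({0..1} \<times> {0..1}) h" "h \<in> ({0..1} \<times> {0..1}) \<rightarrow> S"
    "\<forall>x \<in> {0..1}. h(0,x) = a x" "\<forall>x \<in> {0..1}. h(1,x) = a' x"
    "\<forall>t \<in> {0..1::real}. pathstart(h \<circ> Pair t) = pathstart a \<and> pathfinish(h \<circ> Pair t) = pathfinish a"
    using assms(1) unfolding homotopic_paths by auto
  obtain k where k: "continuous_on ({0..1} \<times> {0..1}) k" "k \<in> ({0..1} \<times> {0..1}) \<rightarrow> T"
    "\<forall>x \<in> {0..1}. k(0,x) = b x" "\<forall>x \<in> {0..1}. k(1,x) = b' x"
    "\<forall>t \<in> {0..1::real}. pathstart(k \<circ> Pair t) = pathstart b \<and> pathfinish(k \<circ> Pair t) = pathfinish b"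
    using assms(2) unfolding homotopic_paths by auto
  show ?thesis
    unfolding homotopic_paths
    using h k by (intro exI[of _ "\<lambda>z. (h z, k z)"])
      (auto intro!: continuous_intros simp: pathstart_def pathfinish_def Pi_iff)
qed

text \<open>Eckmann-Hilton: with the constant loop \<open>?c\<close> at the unit,
  \<open>\<alpha> +++ \<beta>\<close> is the pointwise product of \<open>\<alpha> +++ ?c\<close> and
  \<open>?c +++ \<beta>\<close>, hence homotopic to the pointwise product of \<open>\<alpha>\<close>
  and \<open>\<beta>\<close>; so is \<open>\<beta> +++ \<alpha>\<close>.\<close>

lemma loops_commute_H_space:
  fixes m :: "'a::real_normed_vector \<times> 'a \<Rightarrow> 'a"
  assumes m: "continuous_on (S \<times> S) m" "m \<in> S \<times> S \<rightarrow> S"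
    and unit: "\<And>x. x \<in> S \<Longrightarrow> m (x, p) = x" "\<And>x. x \<in> S \<Longrightarrow> m (p, x) = x"
  shows "loops_commute S p"
  unfolding loops_commute_def
proof clarify
  fix \<alpha> \<beta> assume a: "path \<alpha>" "path_image \<alpha> \<subseteq> S" "p = pathstart \<alpha>" "pathfinish \<alpha> = pathstart \<alpha>"
    and b: "path \<beta>" "path_image \<beta> \<subseteq> S" "pathstart \<beta> = pathstart \<alpha>" "pathfinish \<beta> = pathstart \<alpha>"
  let ?c = "linepath p p"
  have pS: "p \<in> S" using a by auto
  have ra: "homotopic_paths S (\<alpha> +++ ?c) \<alpha>" "homotopic_paths S (?c +++ \<alpha>) \<alpha>"
    using a by (auto intro: homotopic_paths_rid' homotopic_paths_lid')
  have rb: "homotopic_paths S (\<beta> +++ ?c) \<beta>" "homotopic_paths S (?c +++ \<beta>) \<beta>"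
    using a b by (auto intro: homotopic_paths_rid' homotopic_paths_lid')
  have in_a: "\<And>t. t \<in> {0..1} \<Longrightarrow> \<alpha> t \<in> S" and in_b: "\<And>t. t \<in> {0..1} \<Longrightarrow> \<beta> t \<in> S"
    using a b by (auto simp: path_image_def)
  have 1: "homotopic_paths S (m \<circ> (\<lambda>t. ((\<alpha> +++ ?c) t, (?c +++ \<beta>) t))) (m \<circ> (\<lambda>t. (\<alpha> t, \<beta> t)))"
    by (rule homotopic_paths_continuous_image[OF homotopic_paths_Pair[OF ra(1) rb(2)] m])
  have 2: "homotopic_paths S (m \<circ> (\<lambda>t. ((?c +++ \<alpha>) t, (\<beta> +++ ?c) t))) (m \<circ> (\<lambda>t. (\<alpha> t, \<beta> t)))"
    by (rule homotopic_paths_continuous_image[OF homotopic_paths_Pair[OF ra(2) rb(1)] m])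
  have 3: "homotopic_paths S (\<alpha> +++ \<beta>) (m \<circ> (\<lambda>t. ((\<alpha> +++ ?c) t, (?c +++ \<beta>) t)))"
    proof (rule homotopic_paths_eq)
    show "path (\<alpha> +++ \<beta>)" "path_image (\<alpha> +++ \<beta>) \<subseteq> S" using a b by (auto simp: path_image_join)
  qed (use a b in_a in_b unit in \<open>auto simp: joinpaths_def linepath_def algebra_simps\<close>)
  have 4: "homotopic_paths S (\<beta> +++ \<alpha>) (m \<circ> (\<lambda>t. ((?c +++ \<alpha>) t, (\<beta> +++ ?c) t)))"
    proof (rule homotopic_paths_eq)
    show "path (\<beta> +++ \<alpha>)" "path_image (\<beta> +++ \<alpha>) \<subseteq> S" using a b by (auto simp: path_image_join)
  qed (use a b in_a in_b unit in \<open>auto simp: joinpaths_def linepath_def algebra_simps\<close>)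
  show "homotopic_paths S (\<alpha> +++ \<beta>) (\<beta> +++ \<alpha>)"
    using 1 2 3 4 by (meson homotopic_paths_sym homotopic_paths_trans)
qed

text \<open>Dividing the product by the base point turns the base point into the unit.\<close>

lemma loops_commute_punctured_planes:
  assumes "w \<noteq> 0" "\<omega> \<noteq> 0"
  shows "loops_commute ((-{0}) \<times> (-{0::complex})) (w::complex, \<omega>)"
  using assms
  by (intro loops_commute_H_space
        [where m = "\<lambda>((x, \<xi>), (y, \<upsilon>)). (x * y / w, \<xi> * \<upsilon> / \<omega>)"])
     (auto simp: case_prod_beta' intro!: continuous_intros)

definition circle_compl :: "(complex \<times> real) set" where
  "circle_compl = {(w, t). \<not> (norm w = 1 \<and> t = 0)}"

lemma open_circle_compl: "open circle_compl"
proof -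
  have "closed {z :: complex \<times> real. norm (fst z) = 1 \<and> snd z = 0}"
    by (intro closed_Collect_conj closed_Collect_eq continuous_intros)
  moreover have "circle_compl = - {z :: complex \<times> real. norm (fst z) = 1 \<and> snd z = 0}"
    by (auto simp: circle_compl_def)
  ultimately show ?thesis by (metis open_Compl)
qed

text \<open>The complement of circle and axis is the product of a circle (the argument of \<open>w\<close>) with the
  plane punctured at the circle's position, coordinatised by \<open>ln \<bar>w\<bar> + \<i> t\<close>.\<close>

lemma off_axis_loops_commute:
  assumes a: "path \<alpha>" "path_image \<alpha> \<subseteq> circle_compl" "pathstart \<alpha> = p" "pathfinish \<alpha> = p"
    and b: "path \<beta>" "path_image \<beta> \<subseteq> circle_compl" "pathstart \<beta> = p" "pathfinish \<beta> = p"
    and off: "\<And>t. t \<in> {0..1} \<Longrightarrow> fst (\<alpha> t) \<noteq> 0" "\<And>t. t \<in> {0..1} \<Longrightarrow> fst (\<beta> t) \<noteq> 0"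
  shows "homotopic_paths circle_compl (\<alpha> +++ \<beta>) (\<beta> +++ \<alpha>)"
proof -
  let ?Y = "{z \<in> circle_compl. fst z \<noteq> 0}"
  \<comment> \<open>The first factor keeps \<open>w\<close> itself, a point of a punctured plane,
    rather than its direction alone. Thus \<open>f\<close> embeds the off-axis complement as a
    retract, with left inverse \<open>g\<close>. The second component vanishes exactly on the
    circle.\<close>
  define f where "f = (\<lambda>z::complex \<times> real. (fst z, Complex (ln (norm (fst z))) (snd z)))"
  define g where "g = (\<lambda>(w::complex, \<omega>). (sgn w * of_real (exp (Re \<omega>)), Im \<omega>))"
  have cf: "continuous_on ?Y f"
    unfolding f_def Complex_eq by (intro continuous_intros) auto
  have cg: "continuous_on ((-{0}) \<times> (-{0})) g"
    unfolding g_def case_prod_beta' sgn_div_norm by (intro continuous_intros) auto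
  have fY: "f ` ?Y \<subseteq> (-{0}) \<times> (-{0})"
    by (auto simp: f_def circle_compl_def complex_eq_iff)
  have gY: "g \<in> (-{0}) \<times> (-{0}) \<rightarrow> circle_compl"
    by (auto simp: g_def circle_compl_def norm_mult norm_sgn complex_eq_iff)
  have gf: "g (f z) = z" if "z \<in> ?Y" for z
    using that by (auto simp: f_def g_def sgn_div_norm scaleR_conv_of_real field_simps prod_eq_iff)
  have aY: "path_image \<alpha> \<subseteq> ?Y" and bY: "path_image \<beta> \<subseteq> ?Y"
    using a b off by (auto simp: path_image_def)
  have pY: "p \<in> ?Y" using aY a by (metis pathstart_in_path_image subsetD)
  have pf: "path (f \<circ> \<alpha>)" "path (f \<circ> \<beta>)"
    using a b aY bY cf by (auto intro!: path_continuous_image intro: continuous_on_subset)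
  have "f p \<in> (-{0}) \<times> (-{0})" using fY pY by blast
  then have comm: "loops_commute ((-{0}) \<times> (-{0})) (f p)"
    by (metis SigmaE loops_commute_punctured_planes ComplD singletonI)
  have "path_image (f \<circ> \<alpha>) \<subseteq> (-{0}) \<times> (-{0})" "path_image (f \<circ> \<beta>) \<subseteq> (-{0}) \<times> (-{0})"
    using aY bY fY unfolding path_image_compose by (meson image_mono order_trans)+
  with pf a b have "homotopic_paths ((-{0}) \<times> (-{0})) ((f \<circ> \<alpha>) +++ (f \<circ> \<beta>)) ((f \<circ> \<beta>) +++ (f \<circ> \<alpha>))"
    by (intro comm[unfolded loops_commute_def, rule_format]) (simp add: pathstart_compose pathfinish_compose)
  then have "homotopic_paths ((-{0}) \<times> (-{0})) (f \<circ> (\<alpha> +++ \<beta>)) (f \<circ> (\<beta> +++ \<alpha>))"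
    by (simp add: path_compose_join)
  from homotopic_paths_continuous_image[OF this cg gY]
  have H: "homotopic_paths circle_compl (g \<circ> (f \<circ> (\<alpha> +++ \<beta>))) (g \<circ> (f \<circ> (\<beta> +++ \<alpha>)))" .
  have e: "homotopic_paths circle_compl \<gamma> (g \<circ> (f \<circ> \<gamma>))"
    if "path \<gamma>" "path_image \<gamma> \<subseteq> ?Y" for \<gamma>
  proof (rule homotopic_paths_eq)
    show "\<gamma> t = (g \<circ> (f \<circ> \<gamma>)) t" if "t \<in> {0..1}" for t
      using that \<open>path_image \<gamma> \<subseteq> ?Y\<close> gf by (auto simp: path_image_def image_subset_iff)
  qed (use that in auto)
  have "homotopic_paths circle_compl (\<alpha> +++ \<beta>) (g \<circ> (f \<circ> (\<alpha> +++ \<beta>)))"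
    "homotopic_paths circle_compl (\<beta> +++ \<alpha>) (g \<circ> (f \<circ> (\<beta> +++ \<alpha>)))"
    using a b by (simp_all only: e[OF path_join_imp subset_path_image_join] aY bY)
  with H show ?thesis by (meson homotopic_paths_sym homotopic_paths_trans)
qed

section \<open>General position with respect to the axis\<close>

text \<open>The axis has codimension two, so a generic small perturbation of a path misses it. A
  polynomial approximation \<open>p\<close> is moved by \<open>t * (1 - t) * v\<close>, which fixes
  the endpoints; the vectors \<open>v\<close> that fail form the image of an interval under a
  differentiable map into the plane, a null set.\<close>

lemma homotopic_path_off_axis:
  assumes "path \<alpha>" "path_image \<alpha> \<subseteq> circle_compl" "fst (pathstart \<alpha>) \<noteq> 0" "fst (pathfinish \<alpha>) \<noteq> 0"
  obtains \<alpha>' where "homotopic_paths circle_compl \<alpha> \<alpha>'" "\<And>t. t \<in> {0..1} \<Longrightarrow> fst (\<alpha>' t) \<noteq> 0"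
proof -
  obtain e where "e > 0" and e: "\<And>h. \<lbrakk>path h; pathstart h = pathstart \<alpha>; pathfinish h = pathfinish \<alpha>;
      \<And>t. t \<in> {0..1} \<Longrightarrow> norm (h t - \<alpha> t) < e\<rbrakk> \<Longrightarrow> homotopic_paths circle_compl \<alpha> h"
    using homotopic_nearby_paths[OF assms(1) open_circle_compl assms(2)] by metis
  obtain p where p: "polynomial_function p" "pathstart p = pathstart \<alpha>" "pathfinish p = pathfinish \<alpha>"
      "\<And>t. t \<in> {0..1} \<Longrightarrow> norm (p t - \<alpha> t) < e / 2"
    using path_approx_polynomial_function[OF assms(1), of "e/2"] \<open>e > 0\<close> by auto
  let ?bad = "(\<lambda>t. - fst (p t) / of_real (t * (1 - t))) ` {0<..<1}"
  have "(\<lambda>t. fst (p t)) differentiable at t within {0<..<1}" for t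
  proof -
    have "p differentiable at t within {0<..<1}"
      by (meson differentiable_at_polynomial_function differentiable_at_withinI p(1))
    then obtain D where "(p has_derivative D) (at t within {0<..<1})"
      by (auto simp: differentiable_def)
    from has_derivative_fst[OF this] show ?thesis by (auto simp: differentiable_def)
  qed
  moreover have "(\<lambda>t. of_real (t * (1 - t)) :: complex) differentiable at t within {0<..<1}" for t
    unfolding differentiable_def
    by (rule exI, rule bounded_linear.has_derivative[OF bounded_linear_of_real], (rule derivative_intros)+)
  ultimately have "(\<lambda>t. - fst (p t) / of_real (t * (1 - t))) differentiable_on {0<..<1}"
    unfolding differentiable_on_def
    by (intro ballI differentiable_divide differentiable_minus) auto
  then have "negligible ?bad"
    by (intro negligible_differentiable_image_lowdim) auto
  moreover have "\<not> negligible (ball (0::complex) (e/2))"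
    using \<open>e > 0\<close> by (simp add: open_not_negligible)
  ultimately have "\<not> ball 0 (e/2) \<subseteq> ?bad"
    using negligible_subset by blast
  then obtain v where "v \<in> ball 0 (e/2)" and v': "v \<notin> ?bad"
    by (auto simp only: subset_eq)
  then have v: "norm v < e / 2" "v \<notin> ?bad" by simp_all
  define h where "h = (\<lambda>t. p t + (of_real (t * (1 - t)) * v, 0))"
  have "continuous_on {0..1} p"
    using continuous_on_polymonial_function p(1) by blast
  then have ph: "path h"
    unfolding path_def h_def by (intro continuous_intros)
  have h0: "pathstart h = pathstart \<alpha>" "pathfinish h = pathfinish \<alpha>"
    using p by (simp_all add: h_def pathstart_def pathfinish_def flip: zero_prod_def)
  have hn: "norm (h t - \<alpha> t) < e" if t: "t \<in> {0..1}" for t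
  proof -
    have "norm (of_real (t * (1 - t)) * v) \<le> 1 * norm v"
      unfolding norm_mult norm_of_real using t by (intro mult_right_mono) (auto simp: abs_mult mult_le_one)
    then have "norm ((of_real (t * (1 - t)) * v, 0::real)) < e / 2"
      using v by (simp add: norm_Pair)
    with p(4)[OF t] show ?thesis
      unfolding h_def using norm_triangle_ineq[of "p t - \<alpha> t" "(of_real (t * (1 - t)) * v, 0)"]
      by (simp add: algebra_simps)
  qed
  have hz: "fst (h t) \<noteq> 0" if t: "t \<in> {0..1}" for t
  proof (cases "t \<in> {0<..<1}")
    case True
    then have ne: "complex_of_real (t * (1 - t)) \<noteq> 0" by simp
    show ?thesis
    proof
      assume "fst (h t) = 0"
      then have "v * of_real (t * (1 - t)) = - fst (p t)"
        by (simp add: h_def add_eq_0_iff2 mult.commute)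
      with ne have "v = - fst (p t) / of_real (t * (1 - t))"
        by (metis nonzero_mult_div_cancel_right)
      with v True show False by blast
    qed
  next
    case False
    then have "t = 0 \<or> t = 1" using t by auto
    then show ?thesis using h0 assms by (auto simp: pathstart_def pathfinish_def)
  qed
  show ?thesis using that e[OF ph h0 hn] hz by blast
qed

text \<open>Conjugation with \<open>\<delta>\<close> carries loops at \<open>p\<close> to loops at
  \<open>q\<close>; the relation found there is carried back by conjugating the two products once
  more.\<close>

lemma loops_commute_change_base:
  assumes S: "loops_commute S q" and \<delta>: "path \<delta>" "path_image \<delta> \<subseteq> S" "pathstart \<delta> = p" "pathfinish \<delta> = q"
  shows "loops_commute S p"
  unfolding loops_commute_def
proof clarify
  fix \<alpha> \<beta> assume a: "path \<alpha>" "path_image \<alpha> \<subseteq> S" "p = pathstart \<alpha>" "pathfinish \<alpha> = pathstart \<alpha>"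
    and b: "path \<beta>" "path_image \<beta> \<subseteq> S" "pathstart \<beta> = pathstart \<alpha>" "pathfinish \<beta> = pathstart \<alpha>"
  note [simp] = a b \<delta>
  have pd: "pathstart \<delta> = pathstart \<alpha>" using a by simp
  let ?r = "reversepath \<delta>"
  have conj: "homotopic_paths S (\<delta> +++ ((?r +++ (x +++ \<delta>)) +++ (?r +++ (y +++ \<delta>))) +++ ?r) (x +++ y)"
    if x: "path x" "path_image x \<subseteq> S" "pathstart x = p" "pathfinish x = p"
      and y: "path y" "path_image y \<subseteq> S" "pathstart y = p" "pathfinish y = p" for x y
  proof -
    have [simp]: "path_image ?r \<subseteq> S" "path ?r" by simp_all
    have d1: "homotopic_paths S (\<delta> +++ ?r) (linepath p p)"
      using homotopic_paths_rinv[of \<delta> S] by simp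
    have L: "homotopic_paths S (\<delta> +++ (?r +++ z)) z"
      if "path z" "path_image z \<subseteq> S" "pathstart z = p" for z
    proof -
      have "homotopic_paths S (\<delta> +++ (?r +++ z)) ((\<delta> +++ ?r) +++ z)"
        using that by (intro homotopic_paths_assoc) auto
      moreover have "homotopic_paths S ((\<delta> +++ ?r) +++ z) (linepath p p +++ z)"
        by (rule homotopic_paths_join; insert that d1; auto)
      moreover have "homotopic_paths S (linepath p p +++ z) z"
        using that by (intro homotopic_paths_lid') auto
      ultimately show ?thesis by (meson homotopic_paths_trans)
    qed
    have s1: "homotopic_paths S ((?r +++ (x +++ \<delta>)) +++ (?r +++ (y +++ \<delta>))) (?r +++ (x +++ (y +++ \<delta>)))"
    proof -
      have "homotopic_paths S ((?r +++ (x +++ \<delta>)) +++ (?r +++ (y +++ \<delta>))) (?r +++ ((x +++ \<delta>) +++ (?r +++ (y +++ \<delta>))))"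
        using x y by (intro homotopic_paths_sym[OF homotopic_paths_assoc]) (auto simp: path_image_join)
      moreover have "homotopic_paths S ((x +++ \<delta>) +++ (?r +++ (y +++ \<delta>))) (x +++ (\<delta> +++ (?r +++ (y +++ \<delta>))))"
        using x y by (intro homotopic_paths_sym[OF homotopic_paths_assoc]) (auto simp: path_image_join)
      moreover have "homotopic_paths S (x +++ (\<delta> +++ (?r +++ (y +++ \<delta>)))) (x +++ (y +++ \<delta>))"
        using x y by (intro homotopic_paths_join L) (auto simp: path_image_join)
      ultimately have *: "homotopic_paths S ((?r +++ (x +++ \<delta>)) +++ (?r +++ (y +++ \<delta>))) (?r +++ ((x +++ \<delta>) +++ (?r +++ (y +++ \<delta>))))"
        "homotopic_paths S ((x +++ \<delta>) +++ (?r +++ (y +++ \<delta>))) (x +++ (y +++ \<delta>))"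
        by (meson homotopic_paths_trans)+
      have "homotopic_paths S (?r +++ ((x +++ \<delta>) +++ (?r +++ (y +++ \<delta>)))) (?r +++ (x +++ (y +++ \<delta>)))"
        by (rule homotopic_paths_join; insert x y *; auto simp: path_image_join)
      with * show ?thesis by (meson homotopic_paths_trans)
    qed
    have "homotopic_paths S (\<delta> +++ ((?r +++ (x +++ \<delta>)) +++ (?r +++ (y +++ \<delta>))) +++ ?r)
       (\<delta> +++ (?r +++ (x +++ (y +++ \<delta>))) +++ ?r)"
      by (intro homotopic_paths_join[OF _ homotopic_paths_join[OF s1]]) (use x y in \<open>auto simp: path_image_join\<close>)
    also have "homotopic_paths S \<dots> ((\<delta> +++ (?r +++ (x +++ (y +++ \<delta>)))) +++ ?r)"
      using x y by (intro homotopic_paths_assoc) (auto simp: path_image_join)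
    also have "homotopic_paths S \<dots> ((x +++ (y +++ \<delta>)) +++ ?r)"
      using x y by (intro homotopic_paths_join L) (auto simp: path_image_join)
    also have "homotopic_paths S \<dots> (((x +++ y) +++ \<delta>) +++ ?r)"
      using x y by (intro homotopic_paths_join homotopic_paths_assoc) (auto simp: path_image_join)
    also have "homotopic_paths S \<dots> ((x +++ y) +++ (\<delta> +++ ?r))"
      using x y by (intro homotopic_paths_sym[OF homotopic_paths_assoc]) (auto simp: path_image_join)
    also have "homotopic_paths S \<dots> ((x +++ y) +++ linepath p p)"
      by (rule homotopic_paths_join; insert x y d1; auto simp: path_image_join)
    also have "homotopic_paths S \<dots> (x +++ y)"
      using x y by (intro homotopic_paths_rid') (auto simp: path_image_join)
    finally show ?thesis .
  qed
  have comm: "homotopic_paths S ((?r +++ (\<alpha> +++ \<delta>)) +++ (?r +++ (\<beta> +++ \<delta>)))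
         ((?r +++ (\<beta> +++ \<delta>)) +++ (?r +++ (\<alpha> +++ \<delta>)))"
    using pd by (intro S[unfolded loops_commute_def, rule_format]) (auto simp: path_image_join)
  have "homotopic_paths S (\<delta> +++ ((?r +++ (\<alpha> +++ \<delta>)) +++ (?r +++ (\<beta> +++ \<delta>))) +++ ?r)
     (\<delta> +++ ((?r +++ (\<beta> +++ \<delta>)) +++ (?r +++ (\<alpha> +++ \<delta>))) +++ ?r)"
    by (intro homotopic_paths_join[OF _ homotopic_paths_join[OF comm]]) (use pd in auto)
  moreover have "homotopic_paths S (\<delta> +++ ((?r +++ (\<alpha> +++ \<delta>)) +++ (?r +++ (\<beta> +++ \<delta>))) +++ ?r) (\<alpha> +++ \<beta>)"
    by (rule conj) (auto simp: a(3))
  moreover have "homotopic_paths S (\<delta> +++ ((?r +++ (\<beta> +++ \<delta>)) +++ (?r +++ (\<alpha> +++ \<delta>))) +++ ?r) (\<beta> +++ \<alpha>)"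
    by (rule conj) (auto simp: a(3))
  ultimately show "homotopic_paths S (\<alpha> +++ \<beta>) (\<beta> +++ \<alpha>)"
    by (meson homotopic_paths_sym homotopic_paths_trans)
qed

text \<open>Off the axis both loops are replaced by homotopic off-axis ones. A base point on the
  axis is joined to a point off it by a short segment inside a ball of the complement.\<close>

lemma loops_commute_circle_compl:
  assumes "p \<in> circle_compl"
  shows "loops_commute circle_compl p"
proof -
  have off: "loops_commute circle_compl q" if "fst q \<noteq> 0" for q
    unfolding loops_commute_def
  proof clarify
    fix \<alpha> \<beta> assume a: "path \<alpha>" "path_image \<alpha> \<subseteq> circle_compl" "q = pathstart \<alpha>" "pathfinish \<alpha> = pathstart \<alpha>"
      and b: "path \<beta>" "path_image \<beta> \<subseteq> circle_compl" "pathstart \<beta> = pathstart \<alpha>" "pathfinish \<beta> = pathstart \<alpha>"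
    obtain \<alpha>' where A: "homotopic_paths circle_compl \<alpha> \<alpha>'" "\<And>t. t \<in> {0..1} \<Longrightarrow> fst (\<alpha>' t) \<noteq> 0"
      using homotopic_path_off_axis[of \<alpha>] a \<open>fst q \<noteq> 0\<close> by metis
    obtain \<beta>' where B: "homotopic_paths circle_compl \<beta> \<beta>'" "\<And>t. t \<in> {0..1} \<Longrightarrow> fst (\<beta>' t) \<noteq> 0"
      using homotopic_path_off_axis[of \<beta>] a b \<open>fst q \<noteq> 0\<close> by metis
    note e = homotopic_paths_imp_pathstart[OF A(1)] homotopic_paths_imp_pathfinish[OF A(1)]
      homotopic_paths_imp_pathstart[OF B(1)] homotopic_paths_imp_pathfinish[OF B(1)]
      homotopic_paths_imp_path[OF A(1)] homotopic_paths_imp_subset[OF A(1)]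
      homotopic_paths_imp_path[OF B(1)] homotopic_paths_imp_subset[OF B(1)]
    have "homotopic_paths circle_compl (\<alpha>' +++ \<beta>') (\<beta>' +++ \<alpha>')"
      using A(2) B(2) a b e by (intro off_axis_loops_commute[where p = q]) auto
    moreover have "homotopic_paths circle_compl (\<alpha> +++ \<beta>) (\<alpha>' +++ \<beta>')"
      "homotopic_paths circle_compl (\<beta> +++ \<alpha>) (\<beta>' +++ \<alpha>')"
      using A B a b by (auto intro!: homotopic_paths_join)
    ultimately show "homotopic_paths circle_compl (\<alpha> +++ \<beta>) (\<beta> +++ \<alpha>)"
      by (meson homotopic_paths_sym homotopic_paths_trans)
  qed
  show ?thesis
  proof (cases "fst p = 0")
    case True
    obtain e where e: "e > 0" "ball p e \<subseteq> circle_compl"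
      using open_circle_compl assms by (metis open_contains_ball)
    define q where "q = p + (of_real (e/2), 0)"
    have q: "q \<in> ball p e" using e by (simp add: q_def dist_norm norm_Pair)
    have "closed_segment p q \<subseteq> ball p e"
      using q e by (intro closed_segment_subset) auto
    then have "path_image (linepath p q) \<subseteq> circle_compl"
      using e by (simp add: subset_trans)
    moreover have "loops_commute circle_compl q"
      using e True by (intro off) (simp add: q_def)
    ultimately show ?thesis
      using loops_commute_change_base[of _ q "linepath p q"] by simp
  next
    case False
    then show ?thesis by (rule off)
  qed
qed

section \<open>From an unknotted curve to the standard circle\<close>

lemma loops_commute_homeomorphism:
  assumes hom: "homeomorphism S T f g" and T: "loops_commute T (f p)" and p: "p \<in> S"
  shows "loops_commute S p"
  unfolding loops_commute_def
proof clarify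
  fix \<alpha> \<beta> assume a: "path \<alpha>" "path_image \<alpha> \<subseteq> S" "p = pathstart \<alpha>" "pathfinish \<alpha> = pathstart \<alpha>"
    and b: "path \<beta>" "path_image \<beta> \<subseteq> S" "pathstart \<beta> = pathstart \<alpha>" "pathfinish \<beta> = pathstart \<alpha>"
  have cf: "continuous_on S f" "f ` S = T" and cg: "continuous_on T g" "g ` T = S"
    and gf: "\<And>x. x \<in> S \<Longrightarrow> g (f x) = x"
    using hom by (auto simp: homeomorphism_def)
  have "homotopic_paths T ((f \<circ> \<alpha>) +++ (f \<circ> \<beta>)) ((f \<circ> \<beta>) +++ (f \<circ> \<alpha>))"
    using a b cf
    by (intro T[unfolded loops_commute_def, rule_format])
       (auto simp: pathstart_compose pathfinish_compose path_image_compose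
             intro!: path_continuous_image intro: continuous_on_subset)
  then have "homotopic_paths T (f \<circ> (\<alpha> +++ \<beta>)) (f \<circ> (\<beta> +++ \<alpha>))"
    by (simp add: path_compose_join)
  from homotopic_paths_continuous_image[OF this cg(1), of S]
  have H: "homotopic_paths S (g \<circ> (f \<circ> (\<alpha> +++ \<beta>))) (g \<circ> (f \<circ> (\<beta> +++ \<alpha>)))"
    using cg by auto
  have e: "homotopic_paths S \<gamma> (g \<circ> (f \<circ> \<gamma>))" if "path \<gamma>" "path_image \<gamma> \<subseteq> S" for \<gamma>
  proof (rule homotopic_paths_eq)
    show "\<gamma> t = (g \<circ> (f \<circ> \<gamma>)) t" if "t \<in> {0..1}" for t
      using that \<open>path_image \<gamma> \<subseteq> S\<close> gf by (auto simp: path_image_def image_subset_iff)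
  qed (use that in auto)
  have "homotopic_paths S (\<alpha> +++ \<beta>) (g \<circ> (f \<circ> (\<alpha> +++ \<beta>)))"
    "homotopic_paths S (\<beta> +++ \<alpha>) (g \<circ> (f \<circ> (\<beta> +++ \<alpha>)))"
    using a b by (auto intro!: e simp: path_image_join)
  with H show "homotopic_paths S (\<alpha> +++ \<beta>) (\<beta> +++ \<alpha>)"
    by (meson homotopic_paths_sym homotopic_paths_trans)
qed

text \<open>The centre is translated to the origin, the normal is rotated to the third axis, and
  lengths are divided by the radius; the first two coordinates are read as a complex number.\<close>

lemma round_circle_chart:
  assumes "round_circle C"
  obtains f g where "homeomorphism UNIV UNIV f g" "f ` (- C) = circle_compl"
proof -
  obtain c n r where r: "r > 0" and n: "n \<noteq> 0" and C: "C = {x. dist c x = r \<and> n \<bullet> (x - c) = 0}"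
    using assms unfolding round_circle_def by blast
  have "norm n = norm (norm n *\<^sub>R axis (3::3) 1 :: real ^ 3)" by simp
  then obtain \<rho> where \<rho>: "orthogonal_transformation \<rho>" "\<rho> n = (norm n *\<^sub>R axis 3 1 :: real ^ 3)"
    by (rule orthogonal_transformation_exists)
  define \<sigma> where "\<sigma> = inv \<rho>"
  have "orthogonal_transformation \<sigma>"
    unfolding \<sigma>_def by (rule orthogonal_transformation_inv[OF \<rho>(1)])
  then have lin: "linear \<rho>" "linear \<sigma>"
    using \<rho>(1) by (auto intro: orthogonal_transformation_linear)
  have inv: "\<rho> (\<sigma> x) = x" "\<sigma> (\<rho> x) = x" for x
    unfolding \<sigma>_def
    by (rule surj_f_inv_f[OF orthogonal_transformation_surj[OF \<rho>(1)]],
        rule inv_f_f[OF orthogonal_transformation_inj[OF \<rho>(1)]])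
  define f where "f = (\<lambda>x. (Complex (\<rho> (x - c) $ 1 / r) (\<rho> (x - c) $ 2 / r), \<rho> (x - c) $ 3 / r))"
  define g where "g = (\<lambda>(w, t). c + \<sigma> (r *\<^sub>R (vector [Re w, Im w, t] :: real ^ 3)))"
  have cont: "continuous_on UNIV (\<lambda>x. \<rho> (h x))" "continuous_on UNIV (\<lambda>x. \<sigma> (h x))"
    if "continuous_on UNIV h" for h :: "'a::topological_space \<Rightarrow> real ^ 3"
    using that lin unfolding linear_conv_bounded_linear
    by (auto intro: bounded_linear.continuous_on)
  have vec: "(vector [a, b, d] :: real ^ 3) = a *\<^sub>R axis 1 1 + b *\<^sub>R axis 2 1 + d *\<^sub>R axis 3 1" for a b d
    by (simp add: vec_eq_iff forall_3 axis_def)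
  have hom: "homeomorphism UNIV UNIV f g"
  proof (rule homeomorphismI)
    show "continuous_on UNIV f"
      unfolding f_def Complex_eq using r by (intro continuous_intros cont) auto
    show "continuous_on UNIV g"
      unfolding g_def vec case_prod_beta' by (intro continuous_intros cont)
    show "g (f x) = x" for x
    proof -
      have "r *\<^sub>R (vector [\<rho> (x - c) $ 1 / r, \<rho> (x - c) $ 2 / r, \<rho> (x - c) $ 3 / r] :: real ^ 3) = \<rho> (x - c)"
        using r by (simp add: vec_eq_iff forall_3)
      then show ?thesis by (simp add: f_def g_def inv)
    qed
    show "f (g z) = z" for z
      using r by (cases z) (simp add: f_def g_def inv)
  qed auto
  have C_iff: "f x \<in> circle_compl \<longleftrightarrow> x \<notin> C" for x
  proof -
    let ?y = "\<rho> (x - c)"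
    have "dist c x = norm ?y"
      by (metis \<rho>(1) dist_commute dist_norm orthogonal_transformation_norm)
    moreover have "n \<bullet> (x - c) = norm n * (?y $ 3)"
    proof -
      have "n \<bullet> (x - c) = \<rho> n \<bullet> ?y"
        using \<rho>(1) by (simp add: orthogonal_transformation_def)
      then show ?thesis by (simp add: \<rho>(2) inner_axis')
    qed
    moreover have "norm ?y = sqrt ((?y $ 1)\<^sup>2 + (?y $ 2)\<^sup>2 + (?y $ 3)\<^sup>2)"
      by (simp add: norm_vec_def L2_set_def sum_3)
    moreover have "cmod (fst (f x)) = sqrt ((?y $ 1)\<^sup>2 + (?y $ 2)\<^sup>2) / r"
      using r by (simp add: f_def cmod_def power_divide real_sqrt_divide flip: add_divide_distrib)
    ultimately show ?thesis
      using r n by (auto simp: C circle_compl_def case_prod_beta f_def)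
  qed
  show ?thesis
  proof (rule that[OF hom])
    have "z \<in> f ` (- C)" if "z \<in> circle_compl" for z
      using that C_iff[of "g z"] homeomorphism_apply2[OF hom UNIV_I]
      by (intro image_eqI[of _ _ "g z"]) simp_all
    then show "f ` (- C) = circle_compl"
      using C_iff by auto
  qed
qed

text \<open>The final homeomorphism of the isotopy carries the complement of \<open>K\<close> onto
  that of \<open>C\<close>, and the chart carries the latter onto
  \<open>circle_compl\<close>.\<close>

lemma trivial_knot_loops_commute:
  assumes C: "round_circle C" and iso: "ambient_isotopic K C" and p: "p \<notin> K"
  shows "loops_commute (- K) p"
proof -
  obtain h h' where h: "homeomorphism UNIV UNIV h h'" "h ` K = C"
    using iso unfolding ambient_isotopic_def by (metis atLeastAtMost_iff order_refl zero_le_one)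
  obtain f f' where f: "homeomorphism UNIV UNIV f f'" "f ` (- C) = circle_compl"
    using round_circle_chart[OF C] .
  have hK: "h ` (- K) = - C"
    using h by (metis bij_image_Compl_eq homeomorphism_def bij_betw_def inj_on_inverseI)
  have hom: "homeomorphism UNIV UNIV (f \<circ> h) (h' \<circ> f')"
    using homeomorphism_compose[OF h(1) f(1)] .
  have im: "(f \<circ> h) ` (- K) = circle_compl"
    by (simp only: image_comp[symmetric] f(2) hK)
  have hom': "homeomorphism (- K) circle_compl (f \<circ> h) (h' \<circ> f')"
    using homeomorphism_of_subsets[OF hom, of "- K" circle_compl] im by simp
  have "loops_commute circle_compl ((f \<circ> h) p)"
    using p im by (intro loops_commute_circle_compl) blast
  from loops_commute_homeomorphism[OF hom' this] show ?thesis
    using p by simp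
qed

section \<open>The covering of the discriminant complement by marked cubics\<close>

text \<open>Cardano: if \<open>t\<close> is a square root of \<open>b^2 - a^3\<close> and
  \<open>y^3 = b + t\<close>, then \<open>y + a / y\<close> is a root; \<open>b + t = 0\<close>
  forces \<open>a = 0\<close>, where a cube root of \<open>2 * b\<close> does. The other two roots
  come from the remaining quadratic.\<close>

lemma cubic_roots:
  fixes a b :: complex
  obtains u v w where "u + v + w = 0" "u * v + u * w + v * w = - 3 * a" "u * v * w = 2 * b"
    "\<And>x. x ^ 3 - 3 * a * x - 2 * b = (x - u) * (x - v) * (x - w)"
proof -
  have cbrt: "\<exists>y. y ^ 3 = s" for s :: complex
  proof (cases "s = 0")
    case False
    then have "exp (Ln s / 3) ^ 3 = s" by (simp flip: exp_of_nat_mult)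
    then show ?thesis ..
  qed auto
  have "\<exists>u. u ^ 3 - 3 * a * u - 2 * b = 0"
  proof -
    define t where "t = csqrt (b\<^sup>2 - a ^ 3)"
    have t: "t\<^sup>2 = b\<^sup>2 - a ^ 3" by (simp add: t_def)
    show ?thesis
    proof (cases "b + t = 0")
      case True
      then have "a ^ 3 = 0" using t by (simp add: eq_neg_iff_add_eq_0[symmetric])
      then have "a = 0" by simp
      with cbrt[of "2 * b"] show ?thesis by auto
    next
      case False
      obtain y where y: "y ^ 3 = b + t" using cbrt by blast
      with False have "y \<noteq> 0" by auto
      have "(y + a / y) ^ 3 - 3 * a * (y + a / y) = y ^ 3 + a ^ 3 / y ^ 3"
        using \<open>y \<noteq> 0\<close> by (simp add: field_simps power3_eq_cube)
      also have "a ^ 3 = (b + t) * (b - t)"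
        using t by (simp add: algebra_simps power2_eq_square)
      also have "y ^ 3 + (b + t) * (b - t) / y ^ 3 = 2 * b"
        using False by (simp add: y)
      finally have "(y + a / y) ^ 3 - 3 * a * (y + a / y) - 2 * b = 0" by simp
      then show ?thesis ..
    qed
  qed
  then obtain u where "u ^ 3 - 3 * a * u - 2 * b = 0" ..
  then have u: "2 * b = u ^ 3 - 3 * a * u" by simp
  define q where "q = csqrt (12 * a - 3 * u\<^sup>2)"
  have q: "q\<^sup>2 = 12 * a - 3 * u\<^sup>2" by (simp add: q_def)
  define v w where "v = (- u + q) / 2" and "w = (- u - q) / 2"
  have vw: "v + w = - u" "v * w = u\<^sup>2 - 3 * a"
    using q by (simp_all add: v_def w_def field_simps power2_eq_square)
  show ?thesis
  proof (rule that[of u v w])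
    have "u + (v + w) = 0" using vw by simp
    then show "u + v + w = 0" by (simp add: add.assoc)
    have "u * (v + w) + v * w = - 3 * a" using vw by (simp add: power2_eq_square)
    then show "u * v + u * w + v * w = - 3 * a" by (simp add: distrib_left)
    have "u * (v * w) = u * (u\<^sup>2 - 3 * a)" by (simp only: vw)
    also have "\<dots> = 2 * b" unfolding u by (simp add: power2_eq_square power3_eq_cube algebra_simps)
    finally have "u * (v * w) = 2 * b" .
    then show "u * v * w = 2 * b" by (simp add: mult.assoc)
    show "x ^ 3 - 3 * a * x - 2 * b = (x - u) * (x - v) * (x - w)" for x
    proof -
      have "(x - v) * (x - w) = x\<^sup>2 - x * (v + w) + v * w"
        by (simp add: algebra_simps power2_eq_square)
      then have "(x - u) * ((x - v) * (x - w)) = (x - u) * (x\<^sup>2 + x * u + (u\<^sup>2 - 3 * a))"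
        using vw by simp
      also have "\<dots> = x ^ 3 - 3 * a * x - (u ^ 3 - 3 * a * u)"
        by (simp add: algebra_simps power2_eq_square power3_eq_cube)
      finally show ?thesis using u by (simp add: mult.assoc)
    qed
  qed
qed

text \<open>The value at \<open>x\<close> is the product of the differences from \<open>x\<close> to
  the three roots, so one factor has modulus below \<open>\<epsilon>\<close>. This is the
  quantitative continuity of roots behind the covering.\<close>

lemma cubic_root_near:
  fixes a b x :: complex
  assumes "\<epsilon> > 0" "cmod (x ^ 3 - 3 * a * x - 2 * b) < \<epsilon> ^ 3"
  obtains w where "w ^ 3 - 3 * a * w - 2 * b = 0" "cmod (w - x) < \<epsilon>"
proof -
  obtain u v w where f: "\<And>x. x ^ 3 - 3 * a * x - 2 * b = (x - u) * (x - v) * (x - w)"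
    using cubic_roots by metis
  have "\<not> (cmod (x - u) \<ge> \<epsilon> \<and> cmod (x - v) \<ge> \<epsilon> \<and> cmod (x - w) \<ge> \<epsilon>)"
  proof
    assume "cmod (x - u) \<ge> \<epsilon> \<and> cmod (x - v) \<ge> \<epsilon> \<and> cmod (x - w) \<ge> \<epsilon>"
    then have "\<epsilon> * \<epsilon> * \<epsilon> \<le> cmod (x - u) * cmod (x - v) * cmod (x - w)"
      using assms(1) by (intro mult_mono) auto
    moreover have "cmod (x - u) * cmod (x - v) * cmod (x - w) < \<epsilon> * \<epsilon> * \<epsilon>"
      using assms(2) unfolding f norm_mult by (simp add: power3_eq_cube)
    ultimately show False by simp
  qed
  then show ?thesis
    using that[of u] that[of v] that[of w] f by (auto simp: norm_minus_commute not_le)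
qed

text \<open>\<open>(a, b)\<close> stands for the cubic \<open>x ^ 3 - 3 * a * x - 2 * b\<close>, whose discriminant is a multiple of
  \<open>a ^ 3 - b\<^sup>2\<close>; the covering space consists of the cubics with a marked root.\<close>

definition cubic_base :: "(complex \<times> complex) set" where
  "cubic_base = {(a, b). b\<^sup>2 \<noteq> a ^ 3}"

definition cubic_total :: "(complex \<times> complex) set" where
  "cubic_total = {(a, w). w\<^sup>2 \<noteq> a \<and> w\<^sup>2 \<noteq> 4 * a}"

definition cubic_map :: "complex \<times> complex \<Rightarrow> complex \<times> complex" where
  "cubic_map = (\<lambda>(a, w). (a, (w ^ 3 - 3 * a * w) / 2))"

text \<open>\<open>w^2 = a\<close> says that the marked root is itself double,
  \<open>w^2 = 4 * a\<close> that the two other roots coincide; the factorisation of the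
  discriminant shows that there is no further case.\<close>

lemma cubic_map_in_base_iff: "cubic_map z \<in> cubic_base \<longleftrightarrow> z \<in> cubic_total"
proof -
  obtain a w where z: "z = (a, w)" by force
  have "(w ^ 3 - 3 * a * w)\<^sup>2 - 4 * a ^ 3 = (w\<^sup>2 - 4 * a) * (w\<^sup>2 - a)\<^sup>2"
    by (simp add: algebra_simps power2_eq_square power3_eq_cube)
  moreover have "((w ^ 3 - 3 * a * w) / 2)\<^sup>2 = a ^ 3 \<longleftrightarrow> (w ^ 3 - 3 * a * w)\<^sup>2 - 4 * a ^ 3 = 0"
    by (simp add: power_divide mult.commute)
  ultimately have "((w ^ 3 - 3 * a * w) / 2)\<^sup>2 = a ^ 3 \<longleftrightarrow> w\<^sup>2 = 4 * a \<or> w\<^sup>2 = a"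
    by simp
  then show ?thesis
    unfolding z cubic_map_def cubic_base_def cubic_total_def by simp blast
qed

lemma cubic_map_eq_iff: "cubic_map (a, w) = (a', b) \<longleftrightarrow> a = a' \<and> w ^ 3 - 3 * a' * w - 2 * b = 0"
proof -
  have "x / 2 = b \<longleftrightarrow> x - 2 * b = 0" for x :: complex by auto
  then show ?thesis by (auto simp: cubic_map_def)
qed

lemma continuous_on_cubic_map: "continuous_on S cubic_map"
  unfolding cubic_map_def case_prod_beta' by (intro continuous_intros) auto

text \<open>A double root \<open>y\<close> forces the third root \<open>- 2 * y\<close>, hence
  \<open>a = y^2\<close> and \<open>b = - y^3\<close>, a point of the discriminant curve.\<close>

lemma distinct_cubic_roots:
  assumes "(a, b) \<in> cubic_base"
  obtains u v w where "u \<noteq> v" "u \<noteq> w" "v \<noteq> w"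
    "\<And>x. x ^ 3 - 3 * a * x - 2 * b = (x - u) * (x - v) * (x - w)"
proof -
  obtain u v w where r: "u + v + w = 0" "u * v + u * w + v * w = - 3 * a" "u * v * w = 2 * b"
    and f: "\<And>x. x ^ 3 - 3 * a * x - 2 * b = (x - u) * (x - v) * (x - w)"
    using cubic_roots by metis
  have double: False if "y + y + z = 0" "y * y + y * z + y * z = - 3 * a" "y * y * z = 2 * b" for y z
  proof -
    have z: "z = - 2 * y" using that(1) by (simp add: eq_neg_iff_add_eq_0 add.commute)
    have "a = y\<^sup>2" "b = - (y ^ 3)"
      using that(2,3) unfolding z by (simp_all add: algebra_simps power2_eq_square power3_eq_cube)
    then show False using assms by (simp add: cubic_base_def flip: power_mult)
  qed
  show ?thesis
  proof (rule that[OF _ _ _ f])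
    show "u \<noteq> v" using double[of u w] r by (auto simp: algebra_simps)
    show "u \<noteq> w" using double[of u v] r by (auto simp: algebra_simps)
    show "v \<noteq> w" using double[of v u] r by (auto simp: algebra_simps)
  qed
qed

text \<open>Near a cubic with roots \<open>u\<close>, \<open>v\<close>, \<open>w\<close> the evenly
  covered set \<open>T\<close> consists of the cubics that are small at all three points. Each of
  three disjoint balls then contains a root, and three roots fill three balls exactly once; the
  sheet \<open>V x\<close> collects the marked roots in the ball around \<open>x\<close>.\<close>

proposition covering_space_cubic_map: "covering_space cubic_total cubic_map cubic_base"
proof
  show "continuous_on cubic_total cubic_map" by (rule continuous_on_cubic_map)
  show "cubic_map ` cubic_total = cubic_base"
  proof safe
    fix a b assume ab: "(a, b) \<in> cubic_base"
    obtain w where "w ^ 3 - 3 * a * w - 2 * b = 0"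
      using cubic_roots[of a b] by (metis diff_self mult_zero_left)
    then have "cubic_map (a, w) = (a, b)" by (simp add: cubic_map_eq_iff)
    with ab show "(a, b) \<in> cubic_map ` cubic_total"
      by (metis cubic_map_in_base_iff imageI)
  qed (simp add: cubic_map_in_base_iff)
next
  fix z assume z: "z \<in> cubic_base"
  obtain a0 b0 where z_eq: "z = (a0, b0)" by force
  obtain u v w where ne: "u \<noteq> v" "u \<noteq> w" "v \<noteq> w"
    and f: "\<And>x. x ^ 3 - 3 * a0 * x - 2 * b0 = (x - u) * (x - v) * (x - w)"
    using distinct_cubic_roots z z_eq by metis
  define r where "r = Min {cmod (u - v), cmod (u - w), cmod (v - w)} / 2"
  have r: "r > 0" using ne by (auto simp: r_def)
  have "r \<le> cmod (u - v) / 2" "r \<le> cmod (u - w) / 2" "r \<le> cmod (v - w) / 2"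
    by (auto simp: r_def)
  then have disj: "disjnt (ball u r) (ball v r)" "disjnt (ball u r) (ball w r)" "disjnt (ball v r) (ball w r)"
    by (auto simp: disjnt_def disjoint_ballI dist_norm)
  define P where "P = (\<lambda>x (a, b). x ^ 3 - 3 * a * x - 2 * b :: complex)"
  define T where "T = {z \<in> cubic_base. \<forall>x \<in> {u, v, w}. cmod (P x z) < r ^ 3}"
  define V where "V = (\<lambda>x. {z \<in> cubic_total. cubic_map z \<in> T \<and> snd z \<in> ball x r})"
  have cP: "continuous_on S (P x)" for S x
    unfolding P_def case_prod_beta' by (intro continuous_intros)
  have "open {z. cmod (P x z) < r ^ 3}" for x
    by (intro open_Collect_less continuous_intros cP)
  then have "open (\<Inter>x\<in>{u, v, w}. {z. cmod (P x z) < r ^ 3})"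
    by (intro open_INT) auto
  moreover have "T = cubic_base \<inter> (\<Inter>x\<in>{u, v, w}. {z. cmod (P x z) < r ^ 3})"
    by (auto simp: T_def)
  ultimately have openT: "openin (top_of_set cubic_base) T" by auto
  have zT: "z \<in> T" using z r f by (simp add: T_def z_eq P_def)
  have ex_root: "\<exists>y\<in>ball x r. P y t = 0" if t: "t \<in> T" and x: "x \<in> {u, v, w}" for x t
  proof -
    obtain a b where [simp]: "t = (a, b)" by force
    have "cmod (x ^ 3 - 3 * a * x - 2 * b) < r ^ 3"
      using t x by (auto simp: T_def P_def)
    then obtain y where "y ^ 3 - 3 * a * y - 2 * b = 0" "cmod (y - x) < r"
      using cubic_root_near[OF r] by metis
    then show ?thesis by (auto simp: P_def dist_norm norm_minus_commute)
  qed
  have roots: "\<exists>yu yv yw. yu \<in> ball u r \<and> yv \<in> ball v r \<and> yw \<in> ball w r \<and> (\<forall>y. P y t = 0 \<longleftrightarrow> y \<in> {yu, yv, yw})"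
    if t: "t \<in> T" for t
  proof -
    obtain a b where [simp]: "t = (a, b)" by force
    obtain yu yv yw where y: "yu \<in> ball u r" "P yu t = 0" "yv \<in> ball v r" "P yv t = 0" "yw \<in> ball w r" "P yw t = 0"
      using ex_root[OF t] by (metis insertCI)
    have dist: "yu \<noteq> yv" "yu \<noteq> yw" "yv \<noteq> yw" using y disj by (auto simp: disjnt_iff)
    obtain p q s where "\<And>x. x ^ 3 - 3 * a * x - 2 * b = (x - p) * (x - q) * (x - s)"
      using cubic_roots[of a b] by metis
    then have "\<And>x. P x t = (x - p) * (x - q) * (x - s)"
      by (simp add: P_def)
    then have pqs: "P y t = 0 \<longleftrightarrow> y = p \<or> y = q \<or> y = s" for y
      by simp
    then have "P y t = 0 \<longleftrightarrow> y \<in> {yu, yv, yw}" for y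
      using y(2,4,6) dist unfolding insert_iff empty_iff by (smt (verit))
    with y show ?thesis by blast
  qed
  have uniq: "y = y'" if "t \<in> T" "x \<in> {u, v, w}" "y \<in> ball x r" "y' \<in> ball x r" "P y t = 0" "P y' t = 0" for t x y y'
  proof -
    obtain yu yv yw where r: "yu \<in> ball u r" "yv \<in> ball v r" "yw \<in> ball w r"
      "P y t = 0 \<longleftrightarrow> y \<in> {yu, yv, yw}" "P y' t = 0 \<longleftrightarrow> y' \<in> {yu, yv, yw}"
      using roots[OF \<open>t \<in> T\<close>] by blast
    with that(5,6) have "y \<in> {yu, yv, yw}" "y' \<in> {yu, yv, yw}" by simp_all
    with r(1-3) that(2-4) disj show ?thesis
      unfolding disjnt_iff insert_iff empty_iff by (elim disjE) (metis (no_types))+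
  qed
  have map_P: "cubic_map (a, y) = t \<longleftrightarrow> a = fst t \<and> P y t = 0" for a y t
    by (cases t) (simp add: cubic_map_eq_iff P_def)
  define \<omega> where "\<omega> = (\<lambda>x t. SOME y. y \<in> ball x r \<and> P y t = 0)"
  have \<omega>: "\<omega> x t \<in> ball x r" "P (\<omega> x t) t = 0" if "t \<in> T" "x \<in> {u, v, w}" for x t
    using ex_root[OF that] unfolding \<omega>_def by (metis (mono_tags, lifting) someI_ex)+
  have cont_\<omega>: "continuous_on T (\<omega> x)" if x: "x \<in> {u, v, w}" for x
    unfolding continuous_on_iff
  proof (intro ballI allI impI)
    fix t and e :: real assume t: "t \<in> T" and "e > 0"
    obtain e' where e': "e' > 0" "ball (\<omega> x t) e' \<subseteq> ball x r"
      using \<omega>(1)[OF t x] by (metis open_ball open_contains_ball)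
    define \<epsilon> where "\<epsilon> = min e e'"
    have \<epsilon>: "\<epsilon> > 0" using \<open>e > 0\<close> e' by (simp add: \<epsilon>_def)
    have "\<exists>d>0. \<forall>t'\<in>T. dist t' t < d \<longrightarrow> dist (P (\<omega> x t) t') (P (\<omega> x t) t) < \<epsilon> ^ 3"
      using cP[of T "\<omega> x t"] t \<epsilon> unfolding continuous_on_iff by (metis zero_less_power)
    then obtain d where d: "d > 0" "\<And>t'. t' \<in> T \<Longrightarrow> dist t' t < d \<Longrightarrow> cmod (P (\<omega> x t) t') < \<epsilon> ^ 3"
      using \<omega>(2)[OF t x] by auto
    have "dist (\<omega> x t') (\<omega> x t) < e" if t': "t' \<in> T" "dist t' t < d" for t'
    proof -
      obtain a b where [simp]: "t' = (a, b)" by force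
      \<comment> \<open>The branch value at \<open>t\<close> is almost a root at \<open>t'\<close>,
        so a true root lies within \<open>\<epsilon>\<close>; uniqueness in the ball identifies it
        with the branch value at \<open>t'\<close>.\<close>
      obtain y where y: "P y t' = 0" "cmod (y - \<omega> x t) < \<epsilon>"
        using cubic_root_near[OF \<epsilon>, of "\<omega> x t" a b] d(2)[OF t'] by (auto simp: P_def)
      then have "y \<in> ball x r"
        using e' by (auto simp: \<epsilon>_def dist_norm norm_minus_commute subset_eq)
      with y t' \<omega>[OF t'(1) x] have "\<omega> x t' = y" using uniq[OF t'(1) x] by blast
      then show ?thesis using y by (simp add: dist_norm \<epsilon>_def)
    qed
    with d show "\<exists>d>0. \<forall>t'\<in>T. dist t' t < d \<longrightarrow> dist (\<omega> x t') (\<omega> x t) < e" by blast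
  qed
  have Tbase: "T \<subseteq> cubic_base" by (auto simp: T_def)
  have hom: "homeomorphism (V x) T cubic_map (\<lambda>t. (fst t, \<omega> x t))" if x: "x \<in> {u, v, w}" for x
  proof (rule homeomorphismI)
    show "continuous_on (V x) cubic_map" by (rule continuous_on_cubic_map)
    show "continuous_on T (\<lambda>t. (fst t, \<omega> x t))" by (intro continuous_intros cont_\<omega> x)
    show "cubic_map ` V x \<subseteq> T" by (auto simp: V_def)
    have eq: "cubic_map (fst t, \<omega> x t) = t" if "t \<in> T" for t
      using \<omega>(2)[OF that x] by (simp add: map_P)
    then show "cubic_map (fst t, \<omega> x t) = t" if "t \<in> T" for t using that by blast
    show "(\<lambda>t. (fst t, \<omega> x t)) ` T \<subseteq> V x"
      using eq \<omega>(1)[OF _ x] Tbase by (auto simp: V_def) (metis cubic_map_in_base_iff fst_conv subsetD)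
    show "(fst (cubic_map y), \<omega> x (cubic_map y)) = y" if "y \<in> V x" for y
    proof -
      obtain a c where y: "y = (a, c)" by force
      have "cubic_map (a, c) \<in> T" "c \<in> ball x r" using that by (auto simp: V_def y)
      moreover have "P c (cubic_map (a, c)) = 0" using map_P by blast
      ultimately have "\<omega> x (cubic_map (a, c)) = c"
        using uniq[OF _ x] \<omega>[OF _ x] by blast
      then show ?thesis by (simp add: y) (simp add: cubic_map_def)
    qed
  qed
  have openV: "openin (top_of_set cubic_total) (V x)" for x
  proof -
    have "openin (top_of_set cubic_total) (cubic_total \<inter> cubic_map -` T)"
      using openT continuous_on_cubic_map cubic_map_in_base_iff
      by (intro continuous_openin_preimage) auto
    moreover have "open (snd -` ball x r)" by (intro open_vimage_snd) auto
    then have "openin (top_of_set cubic_total) (cubic_total \<inter> snd -` ball x r)" by auto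
    ultimately have "openin (top_of_set cubic_total) ((cubic_total \<inter> cubic_map -` T) \<inter> (cubic_total \<inter> snd -` ball x r))"
      by (rule openin_Int)
    moreover have "V x = (cubic_total \<inter> cubic_map -` T) \<inter> (cubic_total \<inter> snd -` ball x r)"
      by (auto simp: V_def)
    ultimately show ?thesis by simp
  qed
  have disjV: "disjnt (V x) (V y)" if "disjnt (ball x r) (ball y r)" for x y
    using that by (auto simp: V_def disjnt_iff)
  have UV: "\<Union> {V u, V v, V w} = cubic_total \<inter> cubic_map -` T"
  proof
    show "cubic_total \<inter> cubic_map -` T \<subseteq> \<Union> {V u, V v, V w}"
    proof
      fix p assume p: "p \<in> cubic_total \<inter> cubic_map -` T"
      obtain a y where [simp]: "p = (a, y)" by force
      have "P y (cubic_map (a, y)) = 0" using map_P by blast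
      moreover have t: "cubic_map (a, y) \<in> T" using p by simp
      ultimately have "y \<in> ball u r \<or> y \<in> ball v r \<or> y \<in> ball w r"
        using roots[OF t] by (smt (verit) empty_iff insert_iff)
      then show "p \<in> \<Union> {V u, V v, V w}"
        using p by (simp add: V_def)
    qed
  qed (auto simp: V_def)
  show "\<exists>T. z \<in> T \<and> openin (top_of_set cubic_base) T \<and>
         (\<exists>v. \<Union> v = cubic_total \<inter> cubic_map -` T \<and>
              (\<forall>u\<in>v. openin (top_of_set cubic_total) u) \<and>
              pairwise disjnt v \<and> (\<forall>u\<in>v. \<exists>q. homeomorphism u T cubic_map q))"
  proof (intro exI[of _ T] exI[of _ "{V u, V v, V w}"] conjI)
    show "\<Union> {V u, V v, V w} = cubic_total \<inter> cubic_map -` T" by (rule UV)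
    show "pairwise disjnt {V u, V v, V w}"
      using disjV disj by (auto simp: pairwise_insert disjnt_sym)
    show "\<forall>u\<in>{V u, V v, V w}. \<exists>q. homeomorphism u T cubic_map q"
      using hom by blast
    show "\<forall>u\<in>{V u, V v, V w}. openin (top_of_set cubic_total) u"
      using openV by blast
  qed (rule zT openT)+
qed

section \<open>Two transpositions in the monodromy\<close>

text \<open>Over fixed \<open>a\<close> the substitution \<open>x = s * w\<close> normalises the
  cubic to \<open>w^3 - 3 * w = 2 * b / d\<close>, with critical values \<open>b = d\<close> and
  \<open>b = - d\<close>. A loop around \<open>d\<close> exchanges the normalised roots
  \<open>0\<close> and \<open>- sqrt 3\<close> and fixes \<open>sqrt 3\<close>; the loop around
  \<open>- d\<close> exchanges \<open>0\<close> and \<open>sqrt 3\<close> and fixes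
  \<open>- sqrt 3\<close>. Closeness to \<open>[0, 1]\<close> allows both loops to be drawn near a
  segment between two strands.\<close>

lemma cubic_loops_noncommuting:
  fixes a d :: complex and e :: real
  assumes ad: "a ^ 3 = d\<^sup>2" "d \<noteq> 0" and e: "e > 0"
  obtains \<gamma> :: "real \<Rightarrow> complex" where
    "path \<gamma>" "\<gamma> 0 = 0" "\<gamma> 1 = 0"
    "\<And>t. t \<in> {0..1} \<Longrightarrow> (\<gamma> t)\<^sup>2 \<noteq> 1"
    "\<And>t. t \<in> {0..1} \<Longrightarrow> \<exists>x\<in>{0..1}. cmod (\<gamma> t - of_real x) < e"
    "\<not> homotopic_paths cubic_base ((\<lambda>t. (a, d * \<gamma> t)) +++ (\<lambda>t. (a, - d * \<gamma> t)))
       ((\<lambda>t. (a, - d * \<gamma> t)) +++ (\<lambda>t. (a, d * \<gamma> t)))"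
proof -
  define \<epsilon> where "\<epsilon> = min 1 (e / 3)"
  have \<epsilon>: "0 < \<epsilon>" "\<epsilon> \<le> 1" "3 * \<epsilon> \<le> e" using e by (auto simp: \<epsilon>_def)
  define s where "s = d / a"
  have a0: "a \<noteq> 0" using ad by auto
  have s2: "s\<^sup>2 = a"
    unfolding s_def power_divide ad(1)[symmetric] using a0 by (simp add: power2_eq_square power3_eq_cube)
  have s3: "s ^ 3 = d"
    unfolding s_def power_divide ad(1) using ad(2) by (simp add: power2_eq_square power3_eq_cube)
  \<comment> \<open>\<open>W\<close> runs from the root \<open>0\<close> to the root
    \<open>- sqrt 3\<close> and passes above the critical point \<open>- 1\<close> of
    \<open>f\<close>, so \<open>\<gamma>\<close> goes along \<open>[0, 1]\<close>, around
    \<open>1\<close> and back.\<close>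
  define W where "W = (\<lambda>t::real. Complex (- sqrt 3 * t) (\<epsilon> * (t * (1 - t))))"
  \<comment> \<open>Another root over the same loop, from \<open>w'^2 + w' * w + w^2 = 3\<close>.
    The radicand keeps positive real part, so the principal square root is continuous, and this lift
    starts and ends at \<open>sqrt 3\<close>.\<close>
  define W' where "W' = (\<lambda>t. (- W t + csqrt (12 - 3 * (W t)\<^sup>2)) / 2)"
  define f where "f = (\<lambda>w::complex. (w ^ 3 - 3 * w) / 2)"
  define \<gamma> where "\<gamma> = (\<lambda>t. f (W t))"
  have cW: "continuous_on {0..1} W"
    unfolding W_def Complex_eq by (intro continuous_intros)
  have xy: "0 \<le> sqrt 3 * t" "sqrt 3 * t \<le> sqrt 3" "0 \<le> t * (1 - t)" "t * (1 - t) \<le> 1 / 4" if "t \<in> {0..1}" for t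
  proof -
    have "0 \<le> (t - 1 / 2)\<^sup>2" by simp
    then show "t * (1 - t) \<le> 1 / 4" by (simp add: power2_eq_square algebra_simps)
  qed (use that in \<open>auto simp: mult_left_le\<close>)
  have ReW: "(sqrt 3 * t)\<^sup>2 \<le> 3" if "t \<in> {0..1}" for t
    using power_mono[OF xy(2)[OF that] xy(1)[OF that], of 2] by simp
  have nonneg: "12 - 3 * (W t)\<^sup>2 \<notin> \<real>\<^sub>\<le>\<^sub>0" if "t \<in> {0..1}" for t
  proof -
    have "Re (12 - 3 * (W t)\<^sup>2) = 12 - 3 * (sqrt 3 * t)\<^sup>2 + 3 * (\<epsilon> * (t * (1 - t)))\<^sup>2"
      by (simp add: W_def Re_power2)
    then have "Re (12 - 3 * (W t)\<^sup>2) > 0"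
      using ReW[OF that] by (smt (verit) zero_le_power2)
    then show ?thesis by (auto simp: complex_nonpos_Reals_iff)
  qed
  have cW': "continuous_on {0..1} W'"
    unfolding W'_def by (intro continuous_intros continuous_on_compose2[OF continuous_on_csqrt] cW)
      (use nonneg in auto)
  have W01: "W 0 = 0" "W 1 = - of_real (sqrt 3)"
    by (simp_all add: W_def complex_eq_iff)
  have sq3: "(of_real (sqrt 3) :: complex)\<^sup>2 = 3"
    by (simp flip: of_real_power)
  have W'01: "W' 0 = of_real (sqrt 3)" "W' 1 = of_real (sqrt 3)"
  proof -
    have "sqrt 12 = sqrt (4 * 3)" by simp
    then have "sqrt 12 = 2 * sqrt 3" unfolding real_sqrt_mult by simp
    moreover have "csqrt 12 = of_real (sqrt 12)" "csqrt 3 = of_real (sqrt 3)"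
      using csqrt_of_real_nonneg[of 12] csqrt_of_real_nonneg[of 3] by simp_all
    ultimately show "W' 0 = of_real (sqrt 3)" "W' 1 = of_real (sqrt 3)"
      by (simp_all add: W'_def W01 sq3)
  qed
  have fW': "f (W' t) = f (W t)" for t
  proof -
    have "2 * W' t + W t = csqrt (12 - 3 * (W t)\<^sup>2)" by (simp add: W'_def field_simps)
    then have "(2 * W' t + W t)\<^sup>2 = 12 - 3 * (W t)\<^sup>2" by simp
    then have "4 * ((W' t)\<^sup>2 + W' t * W t + (W t)\<^sup>2 - 3) = 0"
      by (simp add: algebra_simps power2_eq_square)
    then have "(W' t)\<^sup>2 + W' t * W t + (W t)\<^sup>2 - 3 = 0"
      by (metis mult_eq_0_iff zero_neq_numeral)
    moreover have "f (W' t) - f (W t) = (W' t - W t) * ((W' t)\<^sup>2 + W' t * W t + (W t)\<^sup>2 - 3) / 2"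
      by (simp add: f_def field_simps power2_eq_square power3_eq_cube)
    ultimately show ?thesis by simp
  qed
  have f3: "f (of_real (sqrt 3)) = 0" and f_minus: "f (- w) = - f w" for w
  proof -
    have "f w = w * (w\<^sup>2 - 3) / 2" for w :: complex
      by (simp add: f_def power2_eq_square power3_eq_cube algebra_simps)
    then show "f (of_real (sqrt 3)) = 0" by (simp only: sq3) simp
    show "f (- w) = - f w" by (simp add: f_def power3_eq_cube field_simps)
  qed
  have p\<gamma>: "path \<gamma>"
    unfolding \<gamma>_def f_def path_def by (intro continuous_intros cW) auto
  have \<gamma>01: "\<gamma> 0 = 0" "\<gamma> 1 = 0"
    using f3 f_minus[of "of_real (sqrt 3)"] by (simp_all add: \<gamma>_def W01) (simp add: f_def)
  have \<gamma>1: "(\<gamma> t)\<^sup>2 \<noteq> 1" if t: "t \<in> {0..1}" for t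
  proof
    assume "(\<gamma> t)\<^sup>2 = 1"
    moreover have "4 * (\<gamma> t)\<^sup>2 - 4 = ((W t)\<^sup>2 - 4) * ((W t)\<^sup>2 - 1)\<^sup>2"
    proof -
      have "4 * (\<gamma> t)\<^sup>2 = (W t ^ 3 - 3 * W t)\<^sup>2" by (simp add: \<gamma>_def f_def power_divide)
      also have "\<dots> = ((W t)\<^sup>2 - 4) * ((W t)\<^sup>2 - 1)\<^sup>2 + 4"
        by (simp add: algebra_simps power2_eq_square power3_eq_cube)
      finally show ?thesis by simp
    qed
    ultimately have "((W t)\<^sup>2 - 4) * ((W t)\<^sup>2 - 1)\<^sup>2 = 0" by simp
    then have w4: "(W t)\<^sup>2 = 4 \<or> (W t)\<^sup>2 = 1" by simp
    then have "(W t)\<^sup>2 = 2\<^sup>2 \<or> (W t)\<^sup>2 = 1\<^sup>2" by simp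
    then have w: "W t = 2 \<or> W t = - 2 \<or> W t = 1 \<or> W t = - 1"
      unfolding power2_eq_iff by blast
    then have "Im (W t) = 0" by auto
    then have "t = 0 \<or> t = 1" using \<epsilon> by (simp add: W_def)
    then have "(W t)\<^sup>2 = 0 \<or> (W t)\<^sup>2 = 3"
      by (elim disjE) (simp_all add: W01 sq3)
    with w4 show False by (elim disjE) simp_all
  qed
  have near: "\<exists>x\<in>{0..1}. cmod (\<gamma> t - of_real x) < e" if t: "t \<in> {0..1}" for t
  proof -
    define x where "x = - (sqrt 3 * t)"
    have x: "- sqrt 3 \<le> x" "x \<le> 0" "x\<^sup>2 \<le> 3"
      using xy[OF t] ReW[OF t] by (auto simp: x_def)
    have d: "W t - of_real x = \<i> * of_real (\<epsilon> * (t * (1 - t)))"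
      by (simp add: W_def x_def complex_eq_iff)
    have y: "0 \<le> \<epsilon> * (t * (1 - t))" "\<epsilon> * (t * (1 - t)) \<le> \<epsilon> / 4"
      using xy[OF t] \<epsilon> mult_left_mono[of "t * (1 - t)" "1/4" \<epsilon>] by simp_all
    have dn: "cmod (W t - of_real x) \<le> \<epsilon> / 4"
      unfolding d norm_mult norm_ii norm_of_real using y by simp
    have "sqrt 3 \<le> sqrt 4" by (subst real_sqrt_le_iff) simp
    then have s32: "sqrt 3 \<le> 2" by simp
    have nx: "cmod (of_real x) \<le> 2" using x s32 by simp
    have "cmod (W t) \<le> cmod (of_real x) + cmod (W t - of_real x)"
      using norm_triangle_sub by blast
    moreover have "cmod (of_real x) = \<bar>x\<bar>" by simp
    ultimately have nW: "cmod (W t) \<le> 9 / 4" using dn x s32 \<epsilon> by linarith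
    have "f (W t) - f (of_real x) = (W t - of_real x) * ((W t)\<^sup>2 + W t * of_real x + (of_real x)\<^sup>2 - 3) / 2"
      by (simp add: f_def field_simps power2_eq_square power3_eq_cube)
    then have "cmod (f (W t) - f (of_real x)) = cmod (W t - of_real x) * cmod ((W t)\<^sup>2 + W t * of_real x + (of_real x)\<^sup>2 - 3) / 2"
      by (simp only: norm_mult norm_divide norm_numeral)
    also have "\<dots> \<le> \<epsilon> / 4 * (((9/4)\<^sup>2 + 9/4 * 2 + 2\<^sup>2) + 3) / 2"
    proof -
      have "cmod ((W t)\<^sup>2 + W t * of_real x + (of_real x)\<^sup>2 - 3) \<le> cmod ((W t)\<^sup>2 + W t * of_real x + (of_real x)\<^sup>2) + cmod 3"
        by (rule norm_triangle_ineq4)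
      also have "cmod ((W t)\<^sup>2 + W t * of_real x + (of_real x)\<^sup>2) \<le> cmod (W t) ^ 2 + cmod (W t) * cmod (of_real x) + cmod (of_real x) ^ 2"
        unfolding norm_power[symmetric] norm_mult[symmetric]
        by (intro norm_triangle_le add_mono) auto
      also have "\<dots> \<le> (9/4)\<^sup>2 + 9/4 * 2 + 2\<^sup>2"
        using nW nx by (intro add_mono power_mono mult_mono) auto
      finally show ?thesis
        using dn \<epsilon> by (intro divide_right_mono mult_mono) auto
    qed
    also have "\<dots> < 2 * \<epsilon> + \<epsilon> / 2" using \<epsilon> by (simp add: power2_eq_square)
    finally have "cmod (\<gamma> t - f (of_real x)) < 5 / 2 * \<epsilon>" by (simp add: \<gamma>_def)
    moreover have "f (of_real x) = of_real ((x ^ 3 - 3 * x) / 2)" by (simp add: f_def)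
    \<comment> \<open>On \<open>[- sqrt 3, 0]\<close> the function \<open>f\<close> vanishes at both
      ends and has its maximum 1 at the critical point \<open>- 1\<close>; hence the square in the
      factorisation of \<open>1 - f\<close>.\<close>
    moreover have "(x ^ 3 - 3 * x) / 2 \<in> {0..1}"
    proof -
      have "(x ^ 3 - 3 * x) / 2 = - x * (3 - x\<^sup>2) / 2" by (simp add: power2_eq_square power3_eq_cube algebra_simps)
      moreover have "0 \<le> - x * (3 - x\<^sup>2)" using x by (intro mult_nonneg_nonneg) auto
      moreover have "1 - (x ^ 3 - 3 * x) / 2 = (x + 1)\<^sup>2 * (2 - x) / 2"
        by (simp add: power2_eq_square power3_eq_cube field_simps)
      moreover have "0 \<le> (x + 1)\<^sup>2 * (2 - x)" using x by (intro mult_nonneg_nonneg) auto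
      ultimately show ?thesis by simp
    qed
    ultimately show ?thesis using \<epsilon> by (intro bexI[of _ "(x ^ 3 - 3 * x) / 2"]) auto
  qed
  let ?A = "\<lambda>t. (a, d * \<gamma> t)" and ?B = "\<lambda>t. (a, - d * \<gamma> t)"
  define L where "L = (\<lambda>V (t::real). (a, s * V t) :: complex \<times> complex)"
  have map: "cubic_map (a, s * w) = (a, d * f w)" for w
  proof -
    have "(s * w) ^ 3 - 3 * a * (s * w) = s ^ 3 * (w ^ 3 - 3 * w)"
      by (simp add: algebra_simps power2_eq_square power3_eq_cube flip: s2)
    then show ?thesis by (simp add: cubic_map_def f_def s3)
  qed
  have base: "?A t \<in> cubic_base" "?B t \<in> cubic_base" if "t \<in> {0..1}" for t
    using \<gamma>1[OF that] ad by (auto simp: cubic_base_def power_mult_distrib)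
  have pAB: "path ?A" "path ?B"
    using p\<gamma> unfolding path_def by (auto intro!: continuous_intros)
  have iAB: "path_image ?A \<subseteq> cubic_base" "path_image ?B \<subseteq> cubic_base"
    using base by (auto simp: path_image_def)
  have Lp: "path (L V)" if "continuous_on {0..1} V" for V
    unfolding path_def L_def by (intro continuous_intros that)
  have Li: "path_image (L V) \<subseteq> cubic_total" if V: "\<And>t. f (V t) = \<gamma> t \<or> f (V t) = - \<gamma> t" for V
  proof -
    have "L V t \<in> cubic_total" if t: "t \<in> {0..1}" for t
      using base[OF t] V[of t] unfolding cubic_map_in_base_iff[symmetric] L_def map by auto
    then show ?thesis by (auto simp: path_image_def)
  qed
  let ?W = "\<lambda>t. - W t" and ?W' = "\<lambda>t. - W' t"
  have cn: "continuous_on {0..1} ?W" "continuous_on {0..1} ?W'"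
    using cW cW' by (auto intro: continuous_intros)
  have fv: "f (W t) = \<gamma> t" "f (W' t) = \<gamma> t" "f (- W t) = - \<gamma> t" "f (- W' t) = - \<gamma> t" for t
    by (simp_all add: fW' f_minus \<gamma>_def)
  have "\<not> homotopic_paths cubic_base (?A +++ ?B) (?B +++ ?A)"
  proof
    assume H: "homotopic_paths cubic_base (?A +++ ?B) (?B +++ ?A)"
    have j: "pathfinish ?A = pathstart ?B" "pathfinish ?B = pathstart ?A"
      using \<gamma>01 by (auto simp: pathfinish_def pathstart_def)
    have e: "W 1 = - W' 0" "- W 1 = W' 0" by (simp_all add: W01 W'01)
    have l1: "path (L W +++ L ?W')" "path_image (L W +++ L ?W') \<subseteq> cubic_total"
      and l2: "path (L ?W +++ L W')" "path_image (L ?W +++ L W') \<subseteq> cubic_total"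
      by (intro path_join_imp Lp cW cn cW' subset_path_image_join Li;
          simp only: fv simp_thms L_def pathfinish_def pathstart_def e minus_minus)+
    have m1: "cubic_map ((L W +++ L ?W') t) = (?A +++ ?B) t" for t
      unfolding joinpaths_def L_def
      by (cases "t \<le> 1 / 2") (simp_all only: if_True if_False map fv simp_thms, simp_all)
    have m2: "cubic_map ((L ?W +++ L W') t) = (?B +++ ?A) t" for t
      unfolding joinpaths_def L_def
      by (cases "t \<le> 1 / 2") (simp_all only: if_True if_False map fv simp_thms, simp_all)
    \<comment> \<open>Both concatenations are lifted from the root \<open>0\<close>. A homotopy
      would force equal endpoints, but one lift ends at \<open>- sqrt 3\<close> and the other at
      \<open>sqrt 3\<close>, up to the factor \<open>s\<close>.\<close>
    have "pathfinish (L W +++ L ?W') = pathfinish (L ?W +++ L W')"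
    proof (rule covering_space_monodromy[where ?p = cubic_map and ?h1.0 = "L W +++ L ?W'" and
          ?h2.0 = "L ?W +++ L W'" and ?g1.0 = "?A +++ ?B" and ?g2.0 = "?B +++ ?A"])
      show "covering_space cubic_total cubic_map cubic_base" by (rule covering_space_cubic_map)
      show "homotopic_paths cubic_base (?A +++ ?B) (?B +++ ?A)" by (rule H)
      show "path (L W +++ L ?W')" "path_image (L W +++ L ?W') \<subseteq> cubic_total"
        "\<And>t. t \<in> {0..1} \<Longrightarrow> cubic_map ((L W +++ L ?W') t) = (?A +++ ?B) t"
        by (rule l1 m1)+
      show "path (L ?W +++ L W')" "path_image (L ?W +++ L W') \<subseteq> cubic_total"
        "\<And>t. t \<in> {0..1} \<Longrightarrow> cubic_map ((L ?W +++ L W') t) = (?B +++ ?A) t"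
        by (rule l2 m2)+
      show "path (?A +++ ?B)" "path (?B +++ ?A)" using pAB j by auto
      show "path_image (?A +++ ?B) \<subseteq> cubic_base" "path_image (?B +++ ?A) \<subseteq> cubic_base"
        using subset_path_image_join iAB by metis+
      show "pathstart (L W +++ L ?W') = pathstart (L ?W +++ L W')"
        by (simp add: L_def pathstart_def W01 joinpaths_def)
    qed
    then have "s * - of_real (sqrt 3) = s * of_real (sqrt 3)"
      by (simp add: L_def pathfinish_def W'01 joinpaths_def)
    then show False using s3 ad by (auto simp: power3_eq_cube)
  qed
  with that[of \<gamma>] p\<gamma> \<gamma>01 \<gamma>1 near show ?thesis by blast
qed

section \<open>Closed 2-braids with three half-twists\<close>

text \<open>The sum norm is chosen because each half of its unit circle is parametrised by the
  second coordinate, the height of which the strands are functions; there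
  \<open>|fst z| = 1 - |snd z|\<close>, the quantity in \<open>Im_ge\<close>.\<close>

definition diamond_norm :: "real \<times> real \<Rightarrow> real" where
  "diamond_norm z = \<bar>fst z\<bar> + \<bar>snd z\<bar>"

lemma diamond_norm_eq_0_iff: "diamond_norm z = 0 \<longleftrightarrow> z = 0"
  by (cases z) (auto simp: diamond_norm_def zero_prod_def)

lemma diamond_norm_nonneg: "0 \<le> diamond_norm z"
  by (simp add: diamond_norm_def)

lemma continuous_on_diamond_norm [continuous_intros]:
  "continuous_on S f \<Longrightarrow> continuous_on S (\<lambda>x. diamond_norm (f x))"
  unfolding diamond_norm_def by (intro continuous_intros)

definition diamond :: "(real \<times> real) set" where
  "diamond = {z. diamond_norm z = 1}"

definition diamond_dir :: "real \<times> real \<Rightarrow> real \<times> real" where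
  "diamond_dir z = (1 / diamond_norm z) *\<^sub>R z"

lemma diamond_dir_in_diamond: "z \<noteq> 0 \<Longrightarrow> diamond_dir z \<in> diamond"
proof -
  assume "z \<noteq> 0"
  then have "0 < diamond_norm z"
    using diamond_norm_nonneg[of z] diamond_norm_eq_0_iff[of z] by simp
  moreover have "diamond_norm (r *\<^sub>R z) = \<bar>r\<bar> * diamond_norm z" for r
    by (simp add: diamond_norm_def abs_mult distrib_left)
  ultimately show ?thesis by (simp add: diamond_def diamond_dir_def)
qed

lemma compact_diamond: "compact diamond"
proof -
  have "closed diamond"
    unfolding diamond_def by (intro closed_Collect_eq continuous_intros)
  moreover have "diamond \<subseteq> {-1..1} \<times> {-1..1}"
    by (auto simp: diamond_def diamond_norm_def)
  moreover have "compact ({-1..1::real} \<times> {-1..1::real})"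
    by (intro compact_Times) auto
  ultimately show ?thesis
    using closed_Int_compact[of diamond "{-1..1} \<times> {-1..1}"] by (simp add: Int_absorb2)
qed

text \<open>At the origin the direction is undefined, but the values of \<open>g\<close> are bounded
  on the compact diamond and are multiplied by a norm tending to 0.\<close>

lemma continuous_on_radial_extension:
  fixes g :: "real \<times> real \<Rightarrow> complex"
  assumes g: "continuous_on diamond g"
  shows "continuous_on UNIV (\<lambda>z. diamond_norm z *\<^sub>R g (diamond_dir z))"
proof -
  let ?f = "\<lambda>z. diamond_norm z *\<^sub>R g (diamond_dir z)"
  have "continuous_on (- {0}) diamond_dir"
    unfolding diamond_dir_def by (intro continuous_intros) (auto simp: diamond_norm_eq_0_iff)
  then have "continuous_on (- {0}) ?f"
    by (intro continuous_intros continuous_on_compose2[OF g]) (use diamond_dir_in_diamond in blast)+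
  then have away: "isCont ?f z" if "z \<noteq> 0" for z
    using that by (simp add: continuous_on_eq_continuous_at open_Compl)
  have "bounded (g ` diamond)"
    using compact_continuous_image[OF g compact_diamond] by (rule compact_imp_bounded)
  then obtain B where B: "\<And>z. z \<in> diamond \<Longrightarrow> norm (g z) \<le> B"
    by (auto simp: bounded_iff)
  have d0: "diamond_norm 0 = 0" by (simp add: diamond_norm_def)
  have "(?f \<longlongrightarrow> 0) (at 0)"
  proof (rule Lim_null_comparison)
    show "eventually (\<lambda>z. norm (?f z) \<le> B * diamond_norm z) (at 0)"
      unfolding eventually_at_filter
    proof (intro always_eventually allI impI)
      fix z :: "real \<times> real" assume "z \<noteq> 0"
      then have "diamond_norm z * norm (g (diamond_dir z)) \<le> diamond_norm z * B"
        by (intro mult_left_mono B diamond_dir_in_diamond diamond_norm_nonneg)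
      then show "norm (?f z) \<le> B * diamond_norm z"
        using diamond_norm_nonneg[of z] by (simp add: mult.commute)
    qed
    have "isCont (\<lambda>z. B * diamond_norm z) 0"
      unfolding diamond_norm_def by (intro continuous_intros)
    then show "((\<lambda>z. B * diamond_norm z) \<longlongrightarrow> 0) (at 0)"
      unfolding isCont_def by (simp add: d0)
  qed
  then have "isCont ?f 0"
    by (simp add: isCont_def d0)
  with away show ?thesis
    by (metis continuous_at_imp_continuous_on)
qed

lemma continuous_on_diamond_cases:
  fixes f g :: "real \<Rightarrow> 'b::topological_space"
  assumes f: "continuous_on {-1..1} f" and g: "continuous_on {-1..1} g"
    and "f 1 = g 1" "f (-1) = g (-1)"
  shows "continuous_on diamond (\<lambda>z. if 0 \<le> fst z then f (snd z) else g (snd z))"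
proof -
  let ?h = "\<lambda>z::real \<times> real. if 0 \<le> fst z then f (snd z) else g (snd z)"
  have cl: "closed diamond" using compact_diamond compact_imp_closed by blast
  have *: "snd z \<in> {-1..1}" if "z \<in> diamond" for z
    using that by (auto simp: diamond_def diamond_norm_def)
  have "continuous_on (diamond \<inter> {z. 0 \<le> fst z} \<union> diamond \<inter> {z. fst z \<le> 0}) ?h"
  proof (rule continuous_on_cases)
    show "closed (diamond \<inter> {z. 0 \<le> fst z})" "closed (diamond \<inter> {z. fst z \<le> 0})"
      by (intro closed_Int cl closed_Collect_le continuous_intros)+
    show "continuous_on (diamond \<inter> {z. 0 \<le> fst z}) (\<lambda>z. f (snd z))"
      "continuous_on (diamond \<inter> {z. fst z \<le> 0}) (\<lambda>z. g (snd z))"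
      by (rule continuous_on_compose2[OF f] continuous_on_compose2[OF g];
          use * in \<open>auto intro!: continuous_intros\<close>)+
    show "\<forall>z. z \<in> diamond \<inter> {z. 0 \<le> fst z} \<and> \<not> 0 \<le> fst z \<or> z \<in> diamond \<inter> {z. fst z \<le> 0} \<and> 0 \<le> fst z \<longrightarrow>
        f (snd z) = g (snd z)"
    proof (intro allI impI)
      fix z assume "z \<in> diamond \<inter> {z. 0 \<le> fst z} \<and> \<not> 0 \<le> fst z \<or> z \<in> diamond \<inter> {z. fst z \<le> 0} \<and> 0 \<le> fst z"
      then have "snd z = 1 \<or> snd z = - 1" by (auto simp: diamond_def diamond_norm_def)
      then show "f (snd z) = g (snd z)" using assms by auto
    qed
  qed
  moreover have "diamond \<inter> {z. 0 \<le> fst z} \<union> diamond \<inter> {z. fst z \<le> 0} = diamond" by auto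
  ultimately show ?thesis by simp
qed

text \<open>Hypotheses describing a closed 2-braid around an axis: \<open>\<zeta>\<close> is a height, \<open>(u, v)\<close> are coordinates
  on its levels, and at height \<open>t\<close> the braid consists of the points \<open>P t\<close>, \<open>Q t\<close> with \<open>v \<ge> 0\<close> and
  \<open>R0 t\<close>, \<open>R1 t\<close> with \<open>v \<le> 0\<close> (all recorded as \<open>u + \<i> \<bar>v\<bar>\<close>).  The conditions on directions say that
  going once around the axis turns \<open>Q - P\<close>, continued by \<open>R1 - R0\<close>, by three half-turns.\<close>

locale three_half_twists =
  fixes K :: "'a::real_normed_vector set" and \<zeta> u v :: "'a \<Rightarrow> real" and c :: real
    and P Q R0 R1 :: "real \<Rightarrow> complex"
    and D :: "complex set" and \<sigma> :: "complex \<Rightarrow> 'a"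
  assumes cont: "continuous_on UNIV \<zeta>" "continuous_on UNIV u" "continuous_on UNIV v"
    and c_pos: "c > 0"
    and contPQ: "continuous_on {-1..1} P" "continuous_on {-1..1} Q"
    and contR: "continuous_on {-1..1} R0" "continuous_on {-1..1} R1"
    and top: "P 1 = R1 1" "Q 1 = R0 1" "Im (R0 1) = 0" "Im (R1 1) = 0" "Re (R0 1) < Re (R1 1)"
    and bottom: "P (-1) = R0 (-1)" "Q (-1) = R1 (-1)" "Im (R0 (-1)) = 0" "Im (R1 (-1)) = 0"
      "Re (R1 (-1)) < Re (R0 (-1))"
    and Im_ge: "\<And>t. t \<in> {-1..1} \<Longrightarrow> c * (1 - \<bar>t\<bar>) \<le> Im (P t)"
      "\<And>t. t \<in> {-1..1} \<Longrightarrow> c * (1 - \<bar>t\<bar>) \<le> Im (Q t)"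
      "\<And>t. t \<in> {-1..1} \<Longrightarrow> c * (1 - \<bar>t\<bar>) \<le> Im (R0 t)"
      "\<And>t. t \<in> {-1..1} \<Longrightarrow> c * (1 - \<bar>t\<bar>) \<le> Im (R1 t)"
    and K_pos: "\<And>p. \<lbrakk>\<bar>\<zeta> p\<bar> \<le> 1; 0 \<le> v p; Complex (u p) (v p) \<in> {P (\<zeta> p), Q (\<zeta> p)}\<rbrakk> \<Longrightarrow> p \<in> K"
    and K_neg: "\<And>p. \<lbrakk>\<bar>\<zeta> p\<bar> \<le> 1; v p \<le> 0; Complex (u p) (- v p) \<in> {R0 (\<zeta> p), R1 (\<zeta> p)}\<rbrakk> \<Longrightarrow> p \<in> K"
    and K_level: "\<And>p. \<lbrakk>p \<in> K; \<zeta> p = 0; 0 < v p\<rbrakk> \<Longrightarrow> Complex (u p) (v p) \<in> {P 0, Q 0}"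
    and dir_pos: "\<And>t. t \<in> {0..1} \<Longrightarrow> \<i> * (Q t - P t) \<notin> \<real>\<^sub>\<le>\<^sub>0"
    and dir_neg: "\<And>t. t \<in> {-1..0} \<Longrightarrow> - \<i> * (Q t - P t) \<notin> \<real>\<^sub>\<le>\<^sub>0"
    and dir_0: "0 < Re (Q 0 - P 0)"
    and dir_R: "\<And>t. t \<in> {-1..1} \<Longrightarrow> \<i> * (R1 t - R0 t) \<notin> \<real>\<^sub>\<le>\<^sub>0"
    and D: "open D" "closed_segment (P 0) (Q 0) \<subseteq> D" "\<And>q. q \<in> D \<Longrightarrow> c < Im q"
    and \<sigma>: "continuous_on D \<sigma>" "\<And>q. q \<in> D \<Longrightarrow> \<zeta> (\<sigma> q) = 0" "\<And>q. q \<in> D \<Longrightarrow> u (\<sigma> q) = Re q"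
      "\<And>q. q \<in> D \<Longrightarrow> v (\<sigma> q) = Im q"
begin

section \<open>The map from the braid complement to the discriminant complement\<close>

definition mid :: "real \<times> real \<Rightarrow> complex" where
  "mid z = (if 0 \<le> fst z then (P (snd z) + Q (snd z)) / 2 else (R0 (snd z) + R1 (snd z)) / 2)"

definition half :: "real \<times> real \<Rightarrow> complex" where
  "half z = (if 0 \<le> fst z then (Q (snd z) - P (snd z)) / 2 else (R1 (snd z) - R0 (snd z)) / 2)"

text \<open>On the braid, \<open>kap\<close> is a continuous branch of \<open>half ^ (2/3)\<close>.  It exists around the whole axis since the
  argument of \<open>half\<close> grows by three half-turns, that of \<open>half ^ (2/3)\<close> hence by \<open>2 * pi\<close>.\<close>

definition kap_pos :: "real \<Rightarrow> complex" where
  "kap_pos t = (if 0 \<le> t then exp (2 / 3 * Ln (\<i> * ((Q t - P t) / 2)) - \<i> * pi / 3)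
                else exp (2 / 3 * Ln (- \<i> * ((Q t - P t) / 2)) + \<i> * pi / 3))"

text \<open>The minus sign selects the cube root that matches \<open>kap_pos\<close> at both joints
  \<open>t = 1\<close> and \<open>t = - 1\<close>.\<close>

definition kap_neg :: "real \<Rightarrow> complex" where
  "kap_neg t = - exp (2 / 3 * Ln (\<i> * ((R1 t - R0 t) / 2)))"

definition kap :: "real \<times> real \<Rightarrow> complex" where
  "kap z = (if 0 \<le> fst z then kap_pos (snd z) else kap_neg (snd z))"

lemma half_notin:
  "x \<notin> \<real>\<^sub>\<le>\<^sub>0 \<Longrightarrow> x / 2 \<notin> \<real>\<^sub>\<le>\<^sub>0" for x :: complex
  by (auto simp: complex_nonpos_Reals_iff)

lemma ne_pos: "t \<in> {0..1} \<Longrightarrow> \<i> * ((Q t - P t) / 2) \<notin> \<real>\<^sub>\<le>\<^sub>0"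
  using half_notin[OF dir_pos] by simp

lemma ne_neg: "t \<in> {-1..0} \<Longrightarrow> - \<i> * ((Q t - P t) / 2) \<notin> \<real>\<^sub>\<le>\<^sub>0"
  using half_notin[OF dir_neg] by simp

lemma ne_R: "t \<in> {-1..1} \<Longrightarrow> \<i> * ((R1 t - R0 t) / 2) \<notin> \<real>\<^sub>\<le>\<^sub>0"
  using half_notin[OF dir_R] by simp

lemma exp_23_cube: "x \<noteq> 0 \<Longrightarrow> exp (2 / 3 * Ln x) ^ 3 = x\<^sup>2" for x :: complex
proof -
  assume "x \<noteq> 0"
  have "exp (2 / 3 * Ln x) ^ 3 = exp (2 * Ln x)" by (simp flip: exp_of_nat_mult)
  also have "\<dots> = (exp (Ln x))\<^sup>2" by (simp add: exp_double)
  finally show ?thesis using \<open>x \<noteq> 0\<close> by simp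
qed

text \<open>The correction factors \<open>exp (\<i> * pi / 3)\<close> and its inverse have cube
  \<open>- 1\<close>, which cancels the square of the factor \<open>\<i>\<close> or
  \<open>- \<i>\<close> inserted before taking logarithms.\<close>

lemma kap_cube:
  assumes "z \<in> diamond"
  shows "kap z ^ 3 = (half z)\<^sup>2"
proof -
  have t: "snd z \<in> {-1..1}" using assms by (auto simp: diamond_def diamond_norm_def)
  have e: "exp (- (\<i> * pi / 3)) ^ 3 = -1" "exp (\<i> * pi / 3) ^ 3 = -1"
    by (simp_all flip: exp_of_nat_mult) (simp add: exp_minus)
  let ?d = "(Q (snd z) - P (snd z)) / 2" and ?r = "(R1 (snd z) - R0 (snd z)) / 2"
  have 1: "kap_pos (snd z) ^ 3 = ?d\<^sup>2"
  proof (cases "0 \<le> snd z")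
    case True
    then have "kap_pos (snd z) ^ 3 = exp (2 / 3 * Ln (\<i> * ?d)) ^ 3 * exp (- (\<i> * pi / 3)) ^ 3"
      unfolding kap_pos_def by (simp only: if_True diff_conv_add_uminus exp_add power_mult_distrib)
    moreover have "exp (2 / 3 * Ln (\<i> * ?d)) ^ 3 = (\<i> * ?d)\<^sup>2"
      using ne_pos[of "snd z"] True t by (intro exp_23_cube) auto
    ultimately have "kap_pos (snd z) ^ 3 = (\<i> * ?d)\<^sup>2 * - 1" by (simp only: e)
    then show ?thesis by (simp add: power_mult_distrib power_divide)
  next
    case False
    then have "kap_pos (snd z) ^ 3 = exp (2 / 3 * Ln (- \<i> * ?d)) ^ 3 * exp (\<i> * pi / 3) ^ 3"
      unfolding kap_pos_def by (simp only: if_False exp_add power_mult_distrib)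
    moreover have "exp (2 / 3 * Ln (- \<i> * ?d)) ^ 3 = (- \<i> * ?d)\<^sup>2"
      using ne_neg[of "snd z"] False t by (intro exp_23_cube) auto
    ultimately have "kap_pos (snd z) ^ 3 = (- \<i> * ?d)\<^sup>2 * - 1" by (simp only: e)
    then show ?thesis by (simp add: power_mult_distrib power_divide)
  qed
  have "exp (2 / 3 * Ln (\<i> * ?r)) ^ 3 = (\<i> * ?r)\<^sup>2"
    using ne_R[OF t] by (intro exp_23_cube) auto
  moreover have "(- x) ^ 3 = - (x ^ 3)" for x :: complex by simp
  ultimately have "kap_neg (snd z) ^ 3 = - ((\<i> * ?r)\<^sup>2)" unfolding kap_neg_def by metis
  then have 2: "kap_neg (snd z) ^ 3 = ?r\<^sup>2" by (simp add: power_mult_distrib power_divide)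
  show ?thesis using 1 2 by (simp add: kap_def half_def)
qed

text \<open>Where the real part of \<open>d\<close> is positive, \<open>Ln (\<i> * d)\<close> and
  \<open>Ln (- \<i> * d)\<close> differ from \<open>Ln d\<close> by plus and minus
  \<open>\<i> * pi / 2\<close>. Two thirds of this is exactly the correction, so both formulas give
  \<open>exp (2 / 3 * Ln d)\<close>.\<close>

lemma continuous_on_kap_pos: "continuous_on {-1..1} kap_pos"
proof -
  have 0: "exp (2 / 3 * Ln (\<i> * d) - \<i> * pi / 3) = exp (2 / 3 * Ln (- \<i> * d) + \<i> * pi / 3)"
    if "Re d > 0" for d
  proof -
    have "d \<noteq> 0" using that by auto
    then have 1: "Ln (\<i> * d) = Ln d + \<i> * pi / 2" using that Ln_times_ii[of d] by simp
    have "Ln (- (\<i> * d)) = Ln (\<i> * d) - \<i> * pi" using that \<open>d \<noteq> 0\<close> Ln_minus[of "\<i> * d"] by simp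
    with 1 have 2: "Ln (- \<i> * d) = Ln d - \<i> * pi / 2" by simp
    have "2 / 3 * (Ln d + \<i> * pi / 2) - \<i> * pi / 3 = 2 / 3 * (Ln d - \<i> * pi / 2) + \<i> * pi / 3"
      by (simp add: algebra_simps)
    then show ?thesis unfolding 1 2 by (rule arg_cong)
  qed
  have "continuous_on ({0..1} \<union> {-1..0}) kap_pos"
    unfolding kap_pos_def
  proof (rule continuous_on_cases)
    have "continuous_on {0..1} P" "continuous_on {0..1} Q" "continuous_on {-1..0} P" "continuous_on {-1..0} Q"
      using contPQ by (auto intro: continuous_on_subset)
    then show "continuous_on {0..1} (\<lambda>t. exp (2 / 3 * Ln (\<i> * ((Q t - P t) / 2)) - \<i> * pi / 3))"
      "continuous_on {-1..0} (\<lambda>t. exp (2 / 3 * Ln (- \<i> * ((Q t - P t) / 2)) + \<i> * pi / 3))"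
      by (intro continuous_intros; use ne_pos ne_neg in simp)+
    have "Re ((Q 0 - P 0) / 2) > 0" using dir_0 by simp
    from 0[OF this] show "\<forall>t. t \<in> {0..1} \<and> \<not> 0 \<le> t \<or> t \<in> {- 1..0} \<and> 0 \<le> t \<longrightarrow>
      exp (2 / 3 * Ln (\<i> * ((Q t - P t) / 2)) - \<i> * pi / 3) =
      exp (2 / 3 * Ln (- \<i> * ((Q t - P t) / 2)) + \<i> * pi / 3)" by auto
  qed auto
  moreover have "{0..1} \<union> {-1..0} = {-1..(1::real)}" by auto
  ultimately show ?thesis by simp
qed

text \<open>At the joints the half difference is real, of modulus \<open>m\<close>. Both sides have
  argument \<open>- 2 * pi / 3\<close> at \<open>t = 1\<close> and \<open>2 * pi / 3\<close> at
  \<open>t = - 1\<close>; the strands trade names at one joint only, which accounts for the odd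
  number of half-turns.\<close>

lemma continuous_on_kap: "continuous_on diamond kap"
  unfolding kap_def
proof (rule continuous_on_diamond_cases[OF continuous_on_kap_pos])
  show "continuous_on {-1..1} kap_neg"
    unfolding kap_neg_def by (intro continuous_intros contR; use ne_R in simp)
  have ln: "Ln (\<i> * of_real m) = of_real (ln m) + \<i> * pi / 2" "Ln (\<i> * - of_real m) = of_real (ln m) - \<i> * pi / 2"
    if "m > 0" for m :: real
    using that Ln_times_of_real[of m \<i>] Ln_times_of_real[of m "- \<i>"]
    by (simp_all add: mult.commute Ln_of_real)
  have neg: "- exp x = exp (x - \<i> * pi)" "- exp x = exp (x + \<i> * pi)" for x :: complex
    by (simp_all add: exp_diff exp_add)
  show "kap_pos 1 = kap_neg 1"
  proof -
    define m where "m = (Re (R1 1) - Re (R0 1)) / 2"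
    have m: "m > 0" "(R1 1 - R0 1) / 2 = of_real m" "(Q 1 - P 1) / 2 = - of_real m"
      using top by (auto simp: m_def complex_eq_iff field_simps)
    have "2 / 3 * (of_real (ln m) - \<i> * pi / 2) - \<i> * pi / 3 = 2 / 3 * (of_real (ln m) + \<i> * pi / 2) - \<i> * pi"
      by (simp add: algebra_simps)
    then show ?thesis
      unfolding kap_pos_def kap_neg_def m ln[OF m(1)] neg(1) by simp
  qed
  show "kap_pos (- 1) = kap_neg (- 1)"
  proof -
    define m where "m = (Re (R0 (-1)) - Re (R1 (-1))) / 2"
    have m: "m > 0" "(R1 (-1) - R0 (-1)) / 2 = - of_real m" "(Q (-1) - P (-1)) / 2 = - of_real m"
      using bottom by (auto simp: m_def complex_eq_iff field_simps)
    have "2 / 3 * (of_real (ln m) + \<i> * pi / 2) + \<i> * pi / 3 = 2 / 3 * (of_real (ln m) - \<i> * pi / 2) + \<i> * pi"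
      by (simp add: algebra_simps)
    moreover have "- \<i> * - of_real m = \<i> * of_real m" by simp
    ultimately show ?thesis
      unfolding kap_pos_def kap_neg_def m ln[OF m(1)] neg(2) by (simp add: ln[OF m(1)])
  qed
qed

lemma continuous_on_mid: "continuous_on diamond mid"
  unfolding mid_def using top bottom
  by (intro continuous_on_diamond_cases continuous_intros contPQ contR) (auto simp: add.commute)

text \<open>The axis direction is read off from \<open>(v, \<zeta>)\<close> on the diamond; inside the diamond, which the braid
  avoids, \<open>mid\<close> and \<open>kap\<close> are extended radially.  Then \<open>Phi p = (a, b)\<close> has \<open>b\<^sup>2 = a ^ 3\<close> only if
  \<open>page p\<close> is one of the points \<open>mid \<plusminus> half\<close> of the braid.\<close>

definition disc :: "'a \<Rightarrow> real \<times> real" where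
  "disc p = (let t = max (-1) (min 1 (\<zeta> p)) in (max (\<bar>t\<bar> - 1) (min (1 - \<bar>t\<bar>) (v p / c)), t))"

text \<open>The last summand takes points beyond height 1 in absolute value off the real line, on
  which the strands lie at the joints; such points therefore never seem to hit the braid.\<close>

definition page :: "'a \<Rightarrow> complex" where
  "page p = Complex (u p) (\<bar>v p\<bar> + max 0 (\<bar>\<zeta> p\<bar> - 1))"

text \<open>Towards the axis the two branch points shrink together and their midpoint moves to
  \<open>\<i>\<close>, whereas \<open>page\<close> becomes real at the axis; so they stay
  apart.\<close>

definition Phi :: "'a \<Rightarrow> complex \<times> complex" where
  "Phi p = (let z = disc p; \<rho> = diamond_norm z in
     (\<rho> *\<^sub>R kap (diamond_dir z), page p - (\<rho> *\<^sub>R (mid (diamond_dir z) - \<i>) + \<i>)))"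

lemma continuous_on_Phi: "continuous_on UNIV Phi"
proof -
  have cd: "continuous_on UNIV disc"
    unfolding disc_def Let_def using c_pos by (intro continuous_intros cont) auto
  have cp: "continuous_on UNIV page"
    unfolding page_def Complex_eq by (intro continuous_intros cont)
  have "continuous_on diamond (\<lambda>z. mid z - \<i>)"
    by (intro continuous_intros continuous_on_mid)
  note mid = continuous_on_compose2[OF continuous_on_radial_extension[OF this] cd subset_UNIV]
  note kap = continuous_on_compose2[OF continuous_on_radial_extension[OF continuous_on_kap] cd subset_UNIV]
  show ?thesis
    unfolding Phi_def Let_def
    by (rule continuous_on_Pair[OF kap continuous_on_diff[OF cp continuous_on_add[OF mid continuous_on_const]]])
qed

text \<open>For \<open>|s| \<le> 1\<close> the point is a convex combination of the two strands, so
  it inherits their lower bound.\<close>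

lemma root_Im_ge:
  assumes "z \<in> diamond" "\<bar>s\<bar> \<le> 1"
  shows "c * \<bar>fst z\<bar> \<le> Im (mid z + s *\<^sub>R half z)"
proof -
  have t: "snd z \<in> {-1..1}" and w: "\<bar>fst z\<bar> = 1 - \<bar>snd z\<bar>"
    using assms by (auto simp: diamond_def diamond_norm_def)
  have conv: "m \<le> Im ((x + y) / 2 + s *\<^sub>R ((y - x) / 2))" if "m \<le> Im x" "m \<le> Im y" for x y m
  proof -
    have "Im ((x + y) / 2 + s *\<^sub>R ((y - x) / 2)) = (1 - s) / 2 * Im x + (1 + s) / 2 * Im y"
      by (simp add: field_simps)
    moreover have "(1 - s) / 2 * m + (1 + s) / 2 * m \<le> (1 - s) / 2 * Im x + (1 + s) / 2 * Im y"
      using that assms(2) by (intro add_mono mult_left_mono) auto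
    ultimately show ?thesis by (simp add: field_simps)
  qed
  show ?thesis
    unfolding w mid_def half_def using Im_ge[OF t] conv by auto
qed

text \<open>If \<open>b^2 = a^3\<close>, then \<open>page p\<close> equals
  \<open>\<rho> *\<^sub>R (mid e - \<i>) + \<i>\<close> plus or minus
  \<open>\<rho> * sqrt \<rho>\<close> times \<open>half e\<close>. For \<open>\<rho> < 1\<close>
  this has imaginary part above \<open>|v p|\<close>, that of \<open>page p\<close>, a
  contradiction. For \<open>\<rho> = 1\<close> it is a point of a strand on the side of
  \<open>p\<close>, so \<open>p\<close> lies in \<open>K\<close>.\<close>

lemma Phi_in_base:
  assumes "p \<notin> K"
  shows "Phi p \<in> cubic_base"
proof (rule ccontr)
  define z where "z = disc p"
  define \<rho> where "\<rho> = diamond_norm z"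
  define e where "e = diamond_dir z"
  have z_eq: "z = \<rho> *\<^sub>R e"
    using diamond_norm_eq_0_iff[of z] by (auto simp: e_def diamond_dir_def \<rho>_def)
  have sz: "snd z = max (-1) (min 1 (\<zeta> p))"
    and fz: "fst z = max (\<bar>snd z\<bar> - 1) (min (1 - \<bar>snd z\<bar>) (v p / c))"
    by (simp_all add: z_def disc_def Let_def)
  have \<rho>: "0 \<le> \<rho>" "\<rho> \<le> 1"
    using sz fz unfolding \<rho>_def diamond_norm_def by linarith+
  have unclamped: "v p = c * fst z" "\<bar>\<zeta> p\<bar> \<le> 1" if "\<rho> < 1"
  proof -
    have "v p / c = fst z" "\<bar>\<zeta> p\<bar> \<le> 1"
      using that sz fz unfolding \<rho>_def diamond_norm_def by linarith+
    then show "v p = c * fst z" "\<bar>\<zeta> p\<bar> \<le> 1" using c_pos by (auto simp: field_simps)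
  qed
  assume "Phi p \<notin> cubic_base"
  then have eq: "(page p - (\<rho> *\<^sub>R (mid e - \<i>) + \<i>))\<^sup>2 = (\<rho> *\<^sub>R kap e) ^ 3"
    by (simp add: Phi_def cubic_base_def Let_def z_def \<rho>_def e_def)
  show False
  proof (cases "\<rho> = 0")
    case True
    then have "page p = \<i>" using eq by simp
    moreover have "v p = 0" "\<bar>\<zeta> p\<bar> \<le> 1" using unclamped True z_eq by auto
    ultimately show False by (auto simp: page_def complex_eq_iff)
  next
    case False
    then have e: "e \<in> diamond"
      using diamond_norm_eq_0_iff[of z] unfolding e_def \<rho>_def by (intro diamond_dir_in_diamond) auto
    have "(\<rho> *\<^sub>R kap e) ^ 3 = (\<rho> * sqrt \<rho>)\<^sup>2 *\<^sub>R (half e)\<^sup>2"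
    proof -
      have "(\<rho> * sqrt \<rho>)\<^sup>2 = \<rho> ^ 3"
        using \<rho> by (simp add: power_mult_distrib) (simp add: power2_eq_square power3_eq_cube)
      then show ?thesis by (simp only: scaleR_power kap_cube[OF e])
    qed
    also have "\<dots> = ((\<rho> * sqrt \<rho>) *\<^sub>R half e)\<^sup>2" by (simp only: scaleR_power)
    finally have "page p - (\<rho> *\<^sub>R (mid e - \<i>) + \<i>) = (\<rho> * sqrt \<rho>) *\<^sub>R half e \<or>
        page p - (\<rho> *\<^sub>R (mid e - \<i>) + \<i>) = - ((\<rho> * sqrt \<rho>) *\<^sub>R half e)"
      using eq by (simp only: power2_eq_iff)
    then obtain s where s: "s = 1 \<or> s = - 1"
      and pg: "page p = (\<rho> *\<^sub>R (mid e - \<i>) + \<i>) + s *\<^sub>R (\<rho> * sqrt \<rho>) *\<^sub>R half e"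
      by (metis add.commute diff_eq_eq scaleR_minus1_left scaleR_one)
    show False
    proof (cases "\<rho> < 1")
      case True
      have "c * \<bar>fst e\<bar> \<le> Im (mid e + (s * sqrt \<rho>) *\<^sub>R half e)"
        using s \<rho> by (intro root_Im_ge[OF e]) (auto simp: abs_mult)
      then have "\<rho> * (c * \<bar>fst e\<bar>) \<le> \<rho> * Im (mid e + (s * sqrt \<rho>) *\<^sub>R half e)"
        using \<rho> by (intro mult_left_mono)
      also have "\<dots> = Im (page p) - (1 - \<rho>)"
        by (simp add: pg algebra_simps)
      finally have "\<bar>v p\<bar> < Im (page p)"
        using unclamped(1)[OF True] c_pos \<rho> True by (simp add: z_eq abs_mult mult.left_commute)
      then show False using unclamped(2)[OF True] by (simp add: page_def)
    next
      case False
      with \<rho> have [simp]: "\<rho> = 1" by simp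
      have ze: "z = e" using z_eq by simp
      have pge: "page p = mid e + s *\<^sub>R half e" using pg by simp
      have t: "snd e = max (-1) (min 1 (\<zeta> p))" by (simp add: ze[symmetric] z_def disc_def Let_def)
      have roots: "page p \<in> {P (snd e), Q (snd e)}" if "0 \<le> fst e"
        using s pge that by (auto simp: mid_def half_def field_simps scaleR_conv_of_real)
      have roots': "page p \<in> {R0 (snd e), R1 (snd e)}" if "fst e < 0"
        using s pge that by (auto simp: mid_def half_def field_simps scaleR_conv_of_real)
      have w: "\<bar>fst e\<bar> = 1 - \<bar>snd e\<bar>" using e by (simp add: diamond_def diamond_norm_def)
      have sgn: "0 < v p" if "0 < fst e"
      proof -
        have "fst e \<le> v p / c \<or> fst e \<le> \<bar>snd e\<bar> - 1"
          using fz unfolding ze by linarith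
        with that w have "0 < v p / c" by auto
        with c_pos show ?thesis by (simp add: zero_less_divide_iff)
      qed
      have sgn': "v p < 0" if "fst e < 0"
      proof -
        have "v p / c \<le> fst e \<or> 1 - \<bar>snd e\<bar> \<le> fst e"
          using fz unfolding ze by linarith
        with that w have "v p / c < 0" by auto
        with c_pos show ?thesis by (simp add: divide_less_0_iff)
      qed
      have ends: "Im (page p) = 0" if "fst e = 0"
      proof -
        have "snd e = 1 \<or> snd e = - 1" using w that by auto
        then show ?thesis using roots that top bottom by auto
      qed
      have \<zeta>1: "\<bar>\<zeta> p\<bar> \<le> 1"
      proof (rule ccontr)
        assume *: "\<not> \<bar>\<zeta> p\<bar> \<le> 1"
        then have "\<bar>snd e\<bar> = 1" using t by auto
        then have "Im (page p) = 0" using w ends by simp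
        then show False using * by (simp add: page_def)
      qed
      then have te: "snd e = \<zeta> p" and pp: "page p = Complex (u p) \<bar>v p\<bar>"
        using t by (auto simp: page_def)
      consider "0 < fst e" | "fst e < 0" | "fst e = 0" by linarith
      then show False
      proof cases
        case 1
        then show False using K_pos[OF \<zeta>1] sgn roots assms te pp by auto
      next
        case 2
        then show False using K_neg[OF \<zeta>1] sgn' roots' assms te pp by auto
      next
        case 3
        then show False using K_pos[OF \<zeta>1] ends roots assms te pp by auto
      qed
    qed
  qed
qed

text \<open>At height 0 and beyond \<open>v = c\<close> the point \<open>disc\<close> is constantly
  \<open>(1, 0)\<close>, so along the section \<open>\<sigma>\<close> the map \<open>Phi\<close> is
  the translation \<open>q \<mapsto> (a, q - m)\<close>. The two non-commuting loops over fixed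
  \<open>a\<close> are thus images of loops around the two strands.\<close>

theorem not_loops_commute: "\<exists>x. x \<notin> K \<and> \<not> loops_commute (- K) x"
proof -
  define a where "a = kap (1, 0)"
  define d where "d = half (1, 0)"
  define m where "m = mid (1, 0)"
  have "(1, 0) \<in> diamond" by (simp add: diamond_def diamond_norm_def)
  then have ad: "a ^ 3 = d\<^sup>2" unfolding a_def d_def by (rule kap_cube)
  have d_eq: "d = (Q 0 - P 0) / 2" and m_eq: "m = (P 0 + Q 0) / 2"
    by (simp_all add: d_def m_def half_def mid_def)
  have d0: "d \<noteq> 0" using dir_0 by (auto simp: d_eq)
  have Phi_\<sigma>: "Phi (\<sigma> q) = (a, q - m)" if q: "q \<in> D" for q
  proof -
    have "Im q > c" "Im q / c > 1" using D(3)[OF q] c_pos by auto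
    then have "disc (\<sigma> q) = (1, 0)" using \<sigma>(2-4)[OF q] by (simp add: disc_def)
    moreover have "diamond_norm (1, 0) = 1" "diamond_dir (1, 0) = (1, 0)"
      by (simp_all add: diamond_norm_def diamond_dir_def)
    moreover have "page (\<sigma> q) = q" using \<sigma>(2-4)[OF q] \<open>Im q > c\<close> c_pos by (simp add: page_def complex_eq_iff)
    ultimately show ?thesis by (simp add: Phi_def a_def m_def Let_def)
  qed
  obtain e where e: "e > 0" "\<And>x q. x \<in> closed_segment (P 0) (Q 0) \<Longrightarrow> dist x q < e \<Longrightarrow> q \<in> D"
  proof -
    have "compact (closed_segment (P 0) (Q 0))" by simp
    then obtain e where "e > 0" "(\<Union>x\<in>closed_segment (P 0) (Q 0). ball x e) \<subseteq> D"
      using compact_subset_open_imp_ball_epsilon_subset[OF _ D(1,2)] by blast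
    then show ?thesis using that by (force simp: subset_eq)
  qed
  have "e / cmod d > 0" using e d0 by simp
  from cubic_loops_noncommuting[OF ad d0 this]
  obtain \<gamma> :: "real \<Rightarrow> complex" where p\<gamma>: "path \<gamma>" and \<gamma>01: "\<gamma> 0 = 0" "\<gamma> 1 = 0"
    and \<gamma>1: "\<And>t. t \<in> {0..1} \<Longrightarrow> (\<gamma> t)\<^sup>2 \<noteq> 1"
    and near: "\<And>t. t \<in> {0..1} \<Longrightarrow> \<exists>x\<in>{0..1}. cmod (\<gamma> t - of_real x) < e / cmod d"
    and nh: "\<not> homotopic_paths cubic_base ((\<lambda>t. (a, d * \<gamma> t)) +++ (\<lambda>t. (a, - d * \<gamma> t)))
       ((\<lambda>t. (a, - d * \<gamma> t)) +++ (\<lambda>t. (a, d * \<gamma> t)))"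
    by metis
  have inD: "m + s *\<^sub>R (d * \<gamma> t) \<in> D" if t: "t \<in> {0..1}" and s: "s = 1 \<or> s = - 1" for t s
  proof -
    obtain x where x: "x \<in> {0..1}" "cmod (\<gamma> t - of_real x) < e / cmod d" using near[OF t] by blast
    have "m + s *\<^sub>R (d * of_real x) = (1 - (1 + s * x) / 2) *\<^sub>R P 0 + ((1 + s * x) / 2) *\<^sub>R Q 0"
      by (simp add: m_eq d_eq scaleR_conv_of_real field_simps)
    moreover have "0 \<le> (1 + s * x) / 2" "(1 + s * x) / 2 \<le> 1" using s x by auto
    ultimately have seg: "m + s *\<^sub>R (d * of_real x) \<in> closed_segment (P 0) (Q 0)"
      unfolding in_segment by blast
    have "dist (m + s *\<^sub>R (d * of_real x)) (m + s *\<^sub>R (d * \<gamma> t)) = \<bar>s\<bar> * (cmod d * cmod (\<gamma> t - of_real x))"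
      by (simp add: dist_norm norm_minus_commute[of "\<gamma> t"] flip: scaleR_diff_right right_diff_distrib norm_mult)
    also have "\<dots> < e" using s x d0 by (auto simp: field_simps)
    finally show ?thesis using e seg by blast
  qed
  define A where "A = (\<lambda>s t. \<sigma> (m + s *\<^sub>R (d * \<gamma> t)))"
  have m: "m \<in> D" using inD[of 0 1] \<gamma>01 by simp
  have A: "path (A s)" "path_image (A s) \<subseteq> - K" "pathstart (A s) = \<sigma> m" "pathfinish (A s) = \<sigma> m"
    "\<And>t. t \<in> {0..1} \<Longrightarrow> Phi (A s t) = (a, s *\<^sub>R (d * \<gamma> t))" if s: "s = 1 \<or> s = - 1" for s
  proof -
    show "path (A s)"
      unfolding path_def A_def using p\<gamma> inD[OF _ s]
      by (intro continuous_on_compose2[OF \<sigma>(1)] continuous_intros) (auto simp: path_def)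
    show "pathstart (A s) = \<sigma> m" "pathfinish (A s) = \<sigma> m"
      by (simp_all add: A_def pathstart_def pathfinish_def \<gamma>01)
    show "Phi (A s t) = (a, s *\<^sub>R (d * \<gamma> t))" if "t \<in> {0..1}" for t
      unfolding A_def using Phi_\<sigma>[OF inD[OF that s]] by simp
    have "A s t \<notin> K" if t: "t \<in> {0..1}" for t
    proof
      let ?q = "m + s *\<^sub>R (d * \<gamma> t)"
      note q = inD[OF t s]
      assume "A s t \<in> K"
      moreover have "0 < v (\<sigma> ?q)" using \<sigma>(4)[OF q] D(3)[OF q] c_pos by simp
      ultimately have "Complex (u (\<sigma> ?q)) (v (\<sigma> ?q)) \<in> {P 0, Q 0}"
        using K_level \<sigma>(2)[OF q] by (auto simp: A_def)
      moreover have "Complex (u (\<sigma> ?q)) (v (\<sigma> ?q)) = ?q"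
        unfolding \<sigma>(3,4)[OF q] by (rule complex_surj)
      ultimately have "?q = P 0 \<or> ?q = Q 0" by simp
      moreover have "P 0 = m - d" "Q 0 = m + d" by (simp_all add: m_eq d_eq field_simps)
      ultimately have "s *\<^sub>R (d * \<gamma> t) = - d \<or> s *\<^sub>R (d * \<gamma> t) = d" by auto
      then have "d * (s *\<^sub>R \<gamma> t + 1) = 0 \<or> d * (s *\<^sub>R \<gamma> t - 1) = 0"
        by (auto simp: algebra_simps)
      then have "s *\<^sub>R \<gamma> t = - 1 \<or> s *\<^sub>R \<gamma> t = 1"
        using d0 by (auto simp: eq_neg_iff_add_eq_0)
      then have "\<gamma> t = 1 \<or> \<gamma> t = - 1" using s by (auto simp: minus_equation_iff)
      then show False using \<gamma>1[OF t] by auto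
    qed
    then show "path_image (A s) \<subseteq> - K" by (auto simp: path_image_def)
  qed
  have "\<not> loops_commute (- K) (\<sigma> m)"
  proof
    assume "loops_commute (- K) (\<sigma> m)"
    then have "homotopic_paths (- K) (A 1 +++ A (-1)) (A (-1) +++ A 1)"
      using A[of 1] A[of "-1"] unfolding loops_commute_def by blast
    from homotopic_paths_continuous_image[OF this continuous_on_subset[OF continuous_on_Phi subset_UNIV]]
    have H: "homotopic_paths cubic_base (Phi \<circ> (A 1 +++ A (-1))) (Phi \<circ> (A (-1) +++ A 1))"
      using Phi_in_base by auto
    let ?a = "\<lambda>t. (a, d * \<gamma> t)" and ?b = "\<lambda>t. (a, - d * \<gamma> t)"
    have e: "homotopic_paths cubic_base (Phi \<circ> (A s +++ A s')) (g +++ g')"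
      if "path (Phi \<circ> (A s +++ A s'))" "path_image (Phi \<circ> (A s +++ A s')) \<subseteq> cubic_base"
         "s = 1 \<or> s = - 1" "s' = 1 \<or> s' = - 1" "\<And>t. g t = (a, s *\<^sub>R (d * \<gamma> t))" "\<And>t. g' t = (a, s' *\<^sub>R (d * \<gamma> t))"
      for s s' g g'
      using that A(5) by (intro homotopic_paths_eq) (auto simp: joinpaths_def)
    note Hp = homotopic_paths_imp_path[OF H] homotopic_paths_imp_subset[OF H]
    have "homotopic_paths cubic_base (Phi \<circ> (A 1 +++ A (-1))) (?a +++ ?b)"
      by (rule e) (use Hp in auto)
    moreover have "homotopic_paths cubic_base (Phi \<circ> (A (-1) +++ A 1)) (?b +++ ?a)"
      by (rule e) (use Hp in auto)
    ultimately show False using H nh by (meson homotopic_paths_sym homotopic_paths_trans)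
  qed
  moreover have "\<sigma> m \<notin> K" using A(2,3)[of 1] pathstart_in_path_image[of "A 1"] by auto
  ultimately show ?thesis by blast
qed

end

section \<open>A smooth U-turn\<close>

primrec differentiable_times :: "nat \<Rightarrow> (real \<Rightarrow> real) \<Rightarrow> bool" where
  "differentiable_times 0 f \<longleftrightarrow> True"
| "differentiable_times (Suc n) f \<longleftrightarrow>
     (\<exists>f'. (\<forall>x. (f has_real_derivative f' x) (at x)) \<and> differentiable_times n f')"

lemma differentiable_times_SucI:
  "(\<And>x. (f has_real_derivative f' x) (at x)) \<Longrightarrow> differentiable_times n f' \<Longrightarrow> differentiable_times (Suc n) f"
  by auto

definition smooth_fun :: "(real \<Rightarrow> real) \<Rightarrow> bool" where
  "smooth_fun f \<longleftrightarrow> (\<forall>n. differentiable_times n f)"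

lemma differentiable_times_mono: "differentiable_times (Suc n) f \<Longrightarrow> differentiable_times n f"
  by (induction n arbitrary: f) auto

lemma differentiable_times_const: "differentiable_times n (\<lambda>x. c)"
proof (induction n arbitrary: c)
  case (Suc n)
  then show ?case by (auto intro!: exI[of _ "\<lambda>x. 0"])
qed simp

lemma differentiable_times_ident: "differentiable_times n (\<lambda>x. x)"
proof (cases n)
  case (Suc m)
  then show ?thesis
    using differentiable_times_const[of m 1] by (auto intro!: exI[of _ "\<lambda>x. 1"] derivative_intros)
qed simp

lemma differentiable_times_add:
  "differentiable_times n f \<Longrightarrow> differentiable_times n g \<Longrightarrow> differentiable_times n (\<lambda>x. f x + g x)"
proof (induction n arbitrary: f g)
  case (Suc n)
  obtain f' where f: "\<And>x. (f has_real_derivative f' x) (at x)" "differentiable_times n f'"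
    using Suc.prems by auto
  obtain g' where g: "\<And>x. (g has_real_derivative g' x) (at x)" "differentiable_times n g'"
    using Suc.prems by auto
  have "((\<lambda>x. f x + g x) has_real_derivative f' x + g' x) (at x)" for x
    by (rule DERIV_add[OF f(1) g(1)])
  then show ?case using Suc.IH[OF f(2) g(2)] by (intro differentiable_times_SucI)
qed simp

lemma differentiable_times_mult:
  "differentiable_times n f \<Longrightarrow> differentiable_times n g \<Longrightarrow> differentiable_times n (\<lambda>x. f x * g x)"
proof (induction n arbitrary: f g)
  case (Suc n)
  obtain f' where f: "\<And>x. (f has_real_derivative f' x) (at x)" "differentiable_times n f'"
    using Suc.prems by auto
  obtain g' where g: "\<And>x. (g has_real_derivative g' x) (at x)" "differentiable_times n g'"
    using Suc.prems by auto
  have "((\<lambda>x. f x * g x) has_real_derivative f' x * g x + g' x * f x) (at x)" for x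
    by (rule DERIV_mult[OF f(1) g(1)])
  moreover have "differentiable_times n (\<lambda>x. f' x * g x + g' x * f x)"
    by (intro differentiable_times_add Suc.IH f(2) g(2) Suc.prems[THEN differentiable_times_mono])
  ultimately show ?case by (rule differentiable_times_SucI)
qed simp

lemma differentiable_times_compose:
  "differentiable_times n f \<Longrightarrow> differentiable_times n g \<Longrightarrow> differentiable_times n (\<lambda>x. f (g x))"
proof (induction n arbitrary: f)
  case (Suc n)
  obtain f' where f: "\<And>x. (f has_real_derivative f' x) (at x)" "differentiable_times n f'"
    using Suc.prems by auto
  obtain g' where g: "\<And>x. (g has_real_derivative g' x) (at x)" "differentiable_times n g'"
    using Suc.prems by auto
  have "((\<lambda>x. f (g x)) has_real_derivative f' (g x) * g' x) (at x)" for x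
    by (rule DERIV_chain2[OF f(1) g(1)])
  moreover have "differentiable_times n (\<lambda>x. f' (g x) * g' x)"
    by (rule differentiable_times_mult[OF Suc.IH[OF f(2) Suc.prems(2)[THEN differentiable_times_mono]] g(2)])
  ultimately show ?case by (rule differentiable_times_SucI)
qed simp

lemma differentiable_times_inverse:
  assumes "\<And>x. g x \<noteq> 0"
  shows "differentiable_times n g \<Longrightarrow> differentiable_times n (\<lambda>x. inverse (g x))"
proof (induction n)
  case (Suc n)
  obtain g' where g: "\<And>x. (g has_real_derivative g' x) (at x)" "differentiable_times n g'"
    using Suc.prems by auto
  have "((\<lambda>x. inverse (g x)) has_real_derivative - (inverse (g x) * g' x * inverse (g x))) (at x)" for x
    by (rule DERIV_inverse'[OF g(1) assms])
  then have "((\<lambda>x. inverse (g x)) has_real_derivative (- 1) * (inverse (g x) * g' x * inverse (g x))) (at x)" for x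
    by simp
  moreover have "differentiable_times n (\<lambda>x. (- 1) * (inverse (g x) * g' x * inverse (g x)))"
    by (intro differentiable_times_mult differentiable_times_const Suc.IH g(2) Suc.prems[THEN differentiable_times_mono])
  ultimately show ?case by (rule differentiable_times_SucI)
qed simp

lemma smooth_fun_const: "smooth_fun (\<lambda>x. c)"
  and smooth_fun_ident: "smooth_fun (\<lambda>x. x)"
  and smooth_fun_add: "smooth_fun f \<Longrightarrow> smooth_fun g \<Longrightarrow> smooth_fun (\<lambda>x. f x + g x)"
  and smooth_fun_mult: "smooth_fun f \<Longrightarrow> smooth_fun g \<Longrightarrow> smooth_fun (\<lambda>x. f x * g x)"
  and smooth_fun_compose: "smooth_fun f \<Longrightarrow> smooth_fun g \<Longrightarrow> smooth_fun (\<lambda>x. f (g x))"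
  and smooth_fun_inverse: "(\<And>x. g x \<noteq> 0) \<Longrightarrow> smooth_fun g \<Longrightarrow> smooth_fun (\<lambda>x. inverse (g x))"
  by (simp_all add: smooth_fun_def differentiable_times_const differentiable_times_ident differentiable_times_add
      differentiable_times_mult differentiable_times_compose differentiable_times_inverse)

lemma smooth_fun_antiderivative:
  assumes "\<And>x. (f has_real_derivative f' x) (at x)" "smooth_fun f'"
  shows "smooth_fun f"
  unfolding smooth_fun_def
proof
  show "differentiable_times n f" for n
    using assms by (cases n) (auto simp: smooth_fun_def)
qed

text \<open>The derivative witnessing each order could depend on the order; uniqueness of
  derivatives makes all of them one function.\<close>

lemma smooth_fun_derivative:
  assumes "smooth_fun f"
  obtains f' where "\<And>x. (f has_real_derivative f' x) (at x)" "smooth_fun f'"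
proof -
  have "differentiable_times (Suc n) f" for n
    using assms by (simp add: smooth_fun_def)
  then have ex: "\<exists>f'. (\<forall>x. (f has_real_derivative f' x) (at x)) \<and> differentiable_times n f'" for n
    by simp
  obtain f' where f': "\<And>x. (f has_real_derivative f' x) (at x)" using ex[of 0] by blast
  have "differentiable_times n f'" for n
  proof -
    obtain g where g: "\<And>x. (f has_real_derivative g x) (at x)" "differentiable_times n g"
      using ex by blast
    have "g = f'" using DERIV_unique[OF g(1) f'] by blast
    with g show ?thesis by simp
  qed
  then show ?thesis by (intro that[OF f']) (simp add: smooth_fun_def)
qed

lemma smooth_fun_cos_sin: "smooth_fun cos" "smooth_fun sin"
proof -
  have "differentiable_times n cos \<and> differentiable_times n sin" for n
  proof (induction n)
    case (Suc n)
    have "differentiable_times n (\<lambda>x. - 1 * sin x)"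
      using Suc by (intro differentiable_times_mult differentiable_times_const) simp
    then have "differentiable_times (Suc n) cos"
      by (auto intro!: exI[of _ "\<lambda>x. - sin x"] derivative_eq_intros)
    moreover have "differentiable_times (Suc n) sin"
      using Suc by (auto intro!: exI[of _ cos] derivative_eq_intros)
    ultimately show ?case by blast
  qed simp
  then show "smooth_fun cos" "smooth_fun sin" by (simp_all add: smooth_fun_def)
qed

text \<open>The exponent \<open>n\<close> extends the classical flat function to a family whose
  linear span is closed under differentiation, so that smoothness follows by induction for all
  \<open>n\<close> together.\<close>

definition flat_fun :: "nat \<Rightarrow> real \<Rightarrow> real" where
  "flat_fun n x = (if x \<le> 0 then 0 else (1 / x) ^ n / exp (1 / x))"

lemma flat_fun_has_derivative:
  "(flat_fun n has_real_derivative flat_fun (n + 2) x - n * flat_fun (n + 1) x) (at x)"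
proof -
  consider "x < 0" | "x = 0" | "x > 0" by linarith
  then show ?thesis
  proof cases
    case 1
    have "((\<lambda>x::real. 0) has_real_derivative 0) (at x)" by simp
    moreover have "flat_fun (n + 2) x - n * flat_fun (n + 1) x = 0"
      using 1 by (simp add: flat_fun_def)
    moreover have "eventually (\<lambda>y. y < 0) (nhds x)"
      using 1 by (simp add: eventually_nhds_in_open[of "{..<0}", simplified])
    then have "eventually (\<lambda>y. 0 = flat_fun n y) (nhds x)"
      by eventually_elim (simp add: flat_fun_def)
    ultimately show ?thesis using DERIV_cong_ev[of x x "\<lambda>x. 0" "flat_fun n" 0] by simp
  next
    case 2
    have "((\<lambda>h. flat_fun n h / h) \<longlongrightarrow> 0) (at 0)"
    proof (rule filterlim_split_at)
      have "eventually (\<lambda>h. 0 = flat_fun n h / h) (at_left (0::real))"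
        unfolding eventually_at_filter by (intro always_eventually) (auto simp: flat_fun_def)
      then show "((\<lambda>h. flat_fun n h / h) \<longlongrightarrow> 0) (at_left 0)"
        by (rule Lim_transform_eventually[OF tendsto_const])
      have "((\<lambda>h::real. (1 / h) ^ (n + 1) / exp (1 / h)) \<longlongrightarrow> 0) (at_right 0)"
        by (rule filterlim_compose[OF tendsto_power_div_exp_0])
           (simp add: filterlim_inverse_at_top_right inverse_eq_divide[symmetric])
      moreover have "eventually (\<lambda>h::real. (1 / h) ^ (n + 1) / exp (1 / h) = flat_fun n h / h) (at_right 0)"
        unfolding eventually_at_filter by (intro always_eventually) (auto simp: flat_fun_def)
      ultimately show "((\<lambda>h. flat_fun n h / h) \<longlongrightarrow> 0) (at_right 0)"
        by (rule Lim_transform_eventually)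
    qed
    then show ?thesis
      unfolding 2 has_field_derivative_iff by (simp add: flat_fun_def)
  next
    case 3
    have "((\<lambda>x. (1 / x) ^ n / exp (1 / x)) has_real_derivative
        (1 / x) ^ (n + 2) / exp (1 / x) - n * ((1 / x) ^ (n + 1) / exp (1 / x))) (at x)"
    proof (cases n)
      case 0
      with 3 show ?thesis
        by (auto intro!: derivative_eq_intros simp: field_simps power2_eq_square)
    next
      case (Suc m)
      have "((\<lambda>x. (1 / x) ^ Suc m) has_real_derivative - (real (Suc m) * (1 / x) ^ (m + 2))) (at x)"
      proof -
        have "((\<lambda>x. 1 / x) has_real_derivative - ((1 / x)\<^sup>2)) (at x)"
          using 3 by (auto intro!: derivative_eq_intros simp: power2_eq_square)
        from DERIV_power[OF this, of "Suc m"] show ?thesis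
          by (rule DERIV_cong) (simp add: power2_eq_square)
      qed
      moreover have "((\<lambda>x. exp (1 / x)) has_real_derivative - (exp (1 / x) * (1 / x)\<^sup>2)) (at x)"
        using 3 by (auto intro!: derivative_eq_intros simp: field_simps power2_eq_square)
      ultimately have d: "((\<lambda>x. (1 / x) ^ Suc m / exp (1 / x)) has_real_derivative
          (- (real (Suc m) * (1 / x) ^ (m + 2)) * exp (1 / x) - (1 / x) ^ Suc m * - (exp (1 / x) * (1 / x)\<^sup>2)) /
            (exp (1 / x) * exp (1 / x))) (at x)"
        by (rule DERIV_divide) simp
      show ?thesis
      proof -
        have "(- A * E - B * - (E * C)) / (E * E) = B * C / E - A / E" if "E \<noteq> 0" for A B C E :: real
          using that by (simp add: field_simps)
        note d[unfolded this[OF exp_not_eq_zero]]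
        then show ?thesis
          unfolding Suc by (rule DERIV_cong) (simp add: power2_eq_square)
      qed
    qed
    moreover have "eventually (\<lambda>y. y > 0) (nhds x)"
      using 3 by (simp add: eventually_nhds_in_open[of "{0<..}", simplified])
    then have "eventually (\<lambda>y. (1 / y) ^ n / exp (1 / y) = flat_fun n y) (nhds x)"
      by eventually_elim (simp add: flat_fun_def)
    ultimately show ?thesis
      using 3 DERIV_cong_ev[of x x "\<lambda>x. (1 / x) ^ n / exp (1 / x)" "flat_fun n"] by (simp add: flat_fun_def)
  qed
qed

lemma smooth_fun_flat: "smooth_fun (flat_fun n)"
proof -
  have "differentiable_times m (flat_fun n)" for m n
  proof (induction m arbitrary: n)
    case (Suc m)
    have "differentiable_times m (\<lambda>x. flat_fun (n + 2) x + (- n) * flat_fun (n + 1) x)"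
      by (intro differentiable_times_add differentiable_times_mult differentiable_times_const Suc.IH)
    then show ?case using flat_fun_has_derivative[of n]
      by (auto intro!: exI[of _ "\<lambda>x. flat_fun (n + 2) x - n * flat_fun (n + 1) x"])
  qed simp
  then show ?thesis by (simp add: smooth_fun_def)
qed

text \<open>The standard transition function; its symmetry under \<open>x \<mapsto> 1 - x\<close> is
  what makes the U-turn symmetric.\<close>

definition smooth_step :: "real \<Rightarrow> real" where
  "smooth_step x = flat_fun 0 x * inverse (flat_fun 0 x + flat_fun 0 (1 - x))"

lemma flat_fun_0: "0 \<le> flat_fun 0 x" "0 < flat_fun 0 x \<longleftrightarrow> 0 < x" "x \<le> 0 \<Longrightarrow> flat_fun 0 x = 0"
  by (auto simp: flat_fun_def)

lemma flat_fun_0_strict_mono: "0 \<le> x \<Longrightarrow> x < y \<Longrightarrow> flat_fun 0 x < flat_fun 0 y"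
  by (auto simp: flat_fun_def divide_simps)

lemma smooth_step_denom: "0 < flat_fun 0 x + flat_fun 0 (1 - x)"
  using flat_fun_0(1)[of x] flat_fun_0(1)[of "1 - x"] flat_fun_0(2)[of x] flat_fun_0(2)[of "1 - x"]
  by (cases "0 < x") auto

lemma smooth_fun_step: "smooth_fun smooth_step"
proof -
  have "smooth_fun (\<lambda>x. 1 + (- 1) * x)"
    by (intro smooth_fun_add smooth_fun_mult smooth_fun_const smooth_fun_ident)
  from smooth_fun_compose[OF smooth_fun_flat this]
  have "smooth_fun (\<lambda>x. flat_fun 0 (1 + (- 1) * x))" .
  then have "smooth_fun (\<lambda>x. flat_fun 0 (1 - x))" by simp
  from smooth_fun_add[OF smooth_fun_flat this]
  have "smooth_fun (\<lambda>x. inverse (flat_fun 0 x + flat_fun 0 (1 - x)))"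
    using smooth_step_denom by (intro smooth_fun_inverse) (simp add: less_imp_neq[symmetric])
  from smooth_fun_mult[OF smooth_fun_flat this] show ?thesis by (simp add: smooth_step_def[abs_def])
qed

lemma smooth_step_eq: "x \<le> 0 \<Longrightarrow> smooth_step x = 0" "1 \<le> x \<Longrightarrow> smooth_step x = 1"
proof -
  assume "1 \<le> x"
  then have "flat_fun 0 x \<noteq> 0" "flat_fun 0 (1 - x) = 0"
    using flat_fun_0(2)[of x] flat_fun_0(3)[of "1 - x"] by auto
  then show "smooth_step x = 1" by (simp add: smooth_step_def)
qed (simp add: smooth_step_def flat_fun_0)

lemma smooth_step_symmetric: "smooth_step (1 - x) = 1 - smooth_step x"
  using smooth_step_denom[of x] by (simp add: smooth_step_def field_simps)

lemma smooth_step_strict_mono: "0 \<le> x \<Longrightarrow> x < y \<Longrightarrow> y \<le> 1 \<Longrightarrow> smooth_step x < smooth_step y"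
proof -
  assume xy: "0 \<le> x" "x < y" "y \<le> 1"
  let ?a = "flat_fun 0 x" and ?b = "flat_fun 0 (1 - x)" and ?a' = "flat_fun 0 y" and ?b' = "flat_fun 0 (1 - y)"
  have "?a * ?b' \<le> ?a * ?b"
    using flat_fun_0_strict_mono[of "1 - y" "1 - x"] xy flat_fun_0(1) by (intro mult_left_mono) auto
  also have "\<dots> < ?a' * ?b"
    using flat_fun_0_strict_mono[of x y] flat_fun_0(2)[of "1 - x"] xy by (intro mult_strict_right_mono) auto
  finally show ?thesis
    using smooth_step_denom[of x] smooth_step_denom[of y]
    unfolding smooth_step_def by (simp add: field_simps)
qed

text \<open>A planar curve of unit speed that makes a U-turn of length 1; \<open>\<Theta>\<close> is the angle of its tangent.\<close>

locale uturn =
  fixes \<Theta> X Z :: "real \<Rightarrow> real"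
  assumes smooth: "smooth_fun X" "smooth_fun Z"
    and deriv: "\<And>t. (X has_real_derivative cos (\<Theta> t)) (at t)" "\<And>t. (Z has_real_derivative sin (\<Theta> t)) (at t)"
    and cont_angle: "continuous_on UNIV \<Theta>"
    and angle: "\<And>t. t \<le> 0 \<Longrightarrow> \<Theta> t = 0" "\<And>t. 1 \<le> t \<Longrightarrow> \<Theta> t = pi"
      "\<And>s t. 0 \<le> s \<Longrightarrow> s < t \<Longrightarrow> t \<le> 1 \<Longrightarrow> \<Theta> s < \<Theta> t" "\<And>t. \<Theta> (1 - t) = pi - \<Theta> t"
    and start: "X 0 = 0" "Z 0 = 0"

text \<open>The angle is \<open>pi\<close> times the smooth step, and the curve is obtained by
  integrating its unit tangent.\<close>

lemma uturn_exists: "\<exists>\<Theta> X Z. uturn \<Theta> X Z"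
proof -
  define \<Theta> where "\<Theta> = (\<lambda>t. pi * smooth_step t)"
  have s\<Theta>: "smooth_fun \<Theta>"
    unfolding \<Theta>_def by (intro smooth_fun_mult smooth_fun_const smooth_fun_step)
  obtain \<Theta>' where "\<And>x. (\<Theta> has_real_derivative \<Theta>' x) (at x)"
    using smooth_fun_derivative[OF s\<Theta>] by metis
  then have c\<Theta>: "isCont \<Theta> x" for x using DERIV_isCont by blast
  have anti: "\<exists>F. F 0 = 0 \<and> (\<forall>x. (F has_real_derivative f (\<Theta> x)) (at x))"
    if "\<And>x. isCont f x" for f :: "real \<Rightarrow> real"
  proof -
    have "isCont (\<lambda>x. f (\<Theta> x)) x" for x
      using isCont_o2[OF c\<Theta> that] .
    then obtain F where "\<forall>x. -\<infinity> < ereal x \<longrightarrow> ereal x < \<infinity> \<longrightarrow> (F has_vector_derivative f (\<Theta> x)) (at x)"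
      using einterval_antiderivative[of "-\<infinity>" \<infinity> "\<lambda>x. f (\<Theta> x)"] by auto
    then have "(F has_real_derivative f (\<Theta> x)) (at x)" for x
      by (simp add: has_real_derivative_iff_has_vector_derivative)
    then have "((\<lambda>x. F x - F 0) has_real_derivative f (\<Theta> x)) (at x)" for x
      by (auto intro!: derivative_eq_intros)
    then show ?thesis by (intro exI[of _ "\<lambda>x. F x - F 0"]) simp
  qed
  obtain X where X: "X 0 = 0" "\<And>x. (X has_real_derivative cos (\<Theta> x)) (at x)"
    using anti[of cos] by auto
  obtain Z where Z: "Z 0 = 0" "\<And>x. (Z has_real_derivative sin (\<Theta> x)) (at x)"
    using anti[of sin] by auto
  have "uturn \<Theta> X Z"
  proof
    show "smooth_fun X"
      by (rule smooth_fun_antiderivative[OF X(2)]) (rule smooth_fun_compose[OF smooth_fun_cos_sin(1) s\<Theta>])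
    show "smooth_fun Z"
      by (rule smooth_fun_antiderivative[OF Z(2)]) (rule smooth_fun_compose[OF smooth_fun_cos_sin(2) s\<Theta>])
    show "continuous_on UNIV \<Theta>" using c\<Theta> by (simp add: continuous_at_imp_continuous_on)
    show "\<Theta> (1 - t) = pi - \<Theta> t" for t by (simp add: \<Theta>_def smooth_step_symmetric algebra_simps)
    show "(X has_real_derivative cos (\<Theta> t)) (at t)" "(Z has_real_derivative sin (\<Theta> t)) (at t)" for t
      by (rule X Z)+
  qed (simp_all add: X(1) Z(1) \<Theta>_def smooth_step_eq smooth_step_strict_mono)
  then show ?thesis by blast
qed

section \<open>Symmetry, monotonicity and injectivity of the U-turn\<close>

context uturn
begin

lemma angle_mono: "s \<le> t \<Longrightarrow> \<Theta> s \<le> \<Theta> t"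
proof -
  assume st: "s \<le> t"
  have "0 \<le> \<Theta> x \<and> \<Theta> x \<le> pi" for x
    using angle(1)[of 0] angle(1)[of x] angle(2)[of 1] angle(2)[of x] angle(3)[of 0 x] angle(3)[of x 1]
    by (cases "x \<le> 0"; cases "1 \<le> x"; simp)
  then have r: "0 \<le> \<Theta> x" "\<Theta> x \<le> pi" for x by simp_all
  consider "s \<le> 0" | "1 \<le> t" | "0 \<le> s" "t \<le> 1" "s < t" | "s = t" using st by linarith
  then show ?thesis
    using r angle st by cases (auto intro: less_imp_le)
qed

lemma angle_range: "0 \<le> \<Theta> t" "\<Theta> t \<le> pi"
  using angle_mono[of "min 0 t" t] angle_mono[of t "max 1 t"] angle(1)[of "min 0 t"] angle(2)[of "max 1 t"] by auto

lemma angle_half: "\<Theta> (1 / 2) = pi / 2"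
  using angle(4)[of "1 / 2"] by simp

lemma angle_interior: "0 < t \<Longrightarrow> t < 1 \<Longrightarrow> 0 < \<Theta> t \<and> \<Theta> t < pi"
  using angle(3)[of 0 t] angle(3)[of t 1] angle(1)[of 0] angle(2)[of 1] by simp

lemma X_eq: "t \<le> 0 \<Longrightarrow> X t = t" and Z_eq: "t \<le> 0 \<Longrightarrow> Z t = 0"
proof -
  assume t: "t \<le> 0"
  have "\<exists>c. \<forall>x\<in>{..0}. X x - x = c"
  proof (rule has_field_derivative_zero_constant)
    show "((\<lambda>x. X x - x) has_real_derivative 0) (at x within {..0})" if "x \<in> {..0}" for x
      using that angle(1) by (auto intro!: derivative_eq_intros has_field_derivative_at_within[OF deriv(1)])
  qed auto
  then show "X t = t" using t start by (metis atMost_iff diff_self eq_iff_diff_eq_0 order_refl)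
  have "\<exists>c. \<forall>x\<in>{..0}. Z x = c"
  proof (rule has_field_derivative_zero_constant)
    show "(Z has_real_derivative 0) (at x within {..0})" if "x \<in> {..0}" for x
      using that angle(1) has_field_derivative_at_within[OF deriv(2), of x "{..0}"] by simp
  qed auto
  then show "Z t = 0" using t start by (metis atMost_iff order_refl)
qed

definition height :: real where "height = Z 1"

text \<open>The tangents at \<open>t\<close> and \<open>1 - t\<close> have opposite first
  components, so the difference of the two sides is constant, and it vanishes at
  \<open>1 / 2\<close>. Hence the outgoing ray runs back exactly above the incoming one.\<close>

lemma X_sym: "X (1 - t) = X t"
proof -
  have "\<exists>c. \<forall>x\<in>UNIV. X (1 - x) - X x = c"
  proof (rule has_field_derivative_zero_constant)
    show "((\<lambda>x. X (1 - x) - X x) has_real_derivative 0) (at x within UNIV)" for x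
      by (auto intro!: derivative_eq_intros DERIV_chain2[OF deriv(1)] deriv(1) simp: angle(4))
  qed auto
  then obtain c where c: "\<And>x. X (1 - x) - X x = c" by auto
  show ?thesis using c[of "1 / 2"] c[of t] by simp
qed

lemma Z_sym: "Z (1 - t) = height - Z t"
proof -
  have "\<exists>c. \<forall>x\<in>UNIV. Z (1 - x) + Z x = c"
  proof (rule has_field_derivative_zero_constant)
    show "((\<lambda>x. Z (1 - x) + Z x) has_real_derivative 0) (at x within UNIV)" for x
      by (auto intro!: derivative_eq_intros DERIV_chain2[OF deriv(2)] deriv(2) simp: angle(4))
  qed auto
  then obtain c where c: "\<And>x. Z (1 - x) + Z x = c" by auto
  show ?thesis using c[of 0] c[of t] start by (simp add: height_def)
qed

lemma X_eq': "1 \<le> t \<Longrightarrow> X t = 1 - t" and Z_eq': "1 \<le> t \<Longrightarrow> Z t = height"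
  using X_sym[of t] X_eq[of "1 - t"] Z_sym[of t] Z_eq[of "1 - t"] by auto

lemma Z_mono: "s \<le> t \<Longrightarrow> Z s \<le> Z t"
  by (rule DERIV_nonneg_imp_nondecreasing) (auto intro!: deriv(2) sin_ge_zero angle_range)

lemma continuous_X: "continuous_on S X" and continuous_Z: "continuous_on S Z"
  using DERIV_isCont[OF deriv(1)] DERIV_isCont[OF deriv(2)] by (auto intro: continuous_at_imp_continuous_on)

lemma Z_strict_mono: "0 \<le> s \<Longrightarrow> s < t \<Longrightarrow> t \<le> 1 \<Longrightarrow> Z s < Z t"
proof (rule DERIV_pos_imp_increasing_open[of s t Z])
  fix x assume "0 \<le> s" "t \<le> 1" "s < x" "x < t"
  then have "0 < sin (\<Theta> x)" using angle_interior[of x] by (intro sin_gt_zero) auto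
  with deriv(2)[of x] show "\<exists>y. (Z has_real_derivative y) (at x) \<and> 0 < y" by blast
qed (auto intro: continuous_Z)

lemma height_pos: "0 < height"
  using Z_strict_mono[of 0 1] start by (simp add: height_def)

lemma Z_range: "0 \<le> Z t" "Z t \<le> height"
  using Z_mono[of "min 0 t" t] Z_mono[of t "max 1 t"] Z_eq[of "min 0 t"] Z_eq'[of "max 1 t"] by auto

lemma Z_half: "Z (1 / 2) = height / 2"
  using Z_sym[of "1 / 2"] by simp

lemma X_mono: "s \<le> t \<Longrightarrow> t \<le> 1 / 2 \<Longrightarrow> X s \<le> X t"
proof (rule DERIV_nonneg_imp_nondecreasing[of s t X])
  fix x assume "t \<le> 1 / 2" "x \<le> t"
  then have "\<Theta> x \<le> pi / 2" using angle_mono[of x "1 / 2"] angle_half by simp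
  then have "0 \<le> cos (\<Theta> x)" using angle_range(1)[of x] by (intro cos_ge_zero) auto
  with deriv(1)[of x] show "\<exists>y. (X has_real_derivative y) (at x) \<and> 0 \<le> y" by blast
qed

lemma X_nonneg: "0 \<le> t \<Longrightarrow> t \<le> 1 \<Longrightarrow> 0 \<le> X t"
  using X_mono[of 0 t] X_mono[of 0 "1 - t"] X_sym[of t] start by (cases "t \<le> 1 / 2") auto

text \<open>Since \<open>|X'| \<le> 1\<close>, both \<open>t + X t\<close> and
  \<open>t - X t\<close> are monotone; up to scale and shift these are the two horizontal
  coordinates along an edge of the diagonal fold.\<close>

lemma X_plus_mono: "s \<le> t \<Longrightarrow> s + X s \<le> t + X t"
proof (rule DERIV_nonneg_imp_nondecreasing[of s t "\<lambda>x. x + X x"])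
  fix x
  have "((\<lambda>x. x + X x) has_real_derivative 1 + cos (\<Theta> x)) (at x)"
    by (rule DERIV_add[OF DERIV_ident deriv(1)])
  moreover have "0 \<le> 1 + cos (\<Theta> x)" using cos_ge_minus_one[of "\<Theta> x"] by linarith
  ultimately show "\<exists>y. ((\<lambda>x. x + X x) has_real_derivative y) (at x) \<and> 0 \<le> y" by blast
qed

lemma X_minus_mono: "s \<le> t \<Longrightarrow> s - X s \<le> t - X t"
proof (rule DERIV_nonneg_imp_nondecreasing[of s t "\<lambda>x. x - X x"])
  fix x
  have "((\<lambda>x. x - X x) has_real_derivative 1 - cos (\<Theta> x)) (at x)"
    by (rule DERIV_diff[OF DERIV_ident deriv(1)])
  moreover have "0 \<le> 1 - cos (\<Theta> x)" using cos_le_one[of "\<Theta> x"] by linarith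
  ultimately show "\<exists>y. ((\<lambda>x. x - X x) has_real_derivative y) (at x) \<and> 0 \<le> y" by blast
qed

text \<open>\<open>Z\<close> increases strictly during the turn, so equal heights put both points on
  the same straight ray, where \<open>X\<close> is injective.\<close>

lemma uturn_inj:
  assumes "X s = X t" "Z s = Z t"
  shows "s = t"
proof -
  have False if "X s = X t" "Z s = Z t" "s < t" for s t
  proof -
    have "t \<le> 0 \<or> 1 \<le> s"
    proof (rule ccontr)
      assume "\<not> (t \<le> 0 \<or> 1 \<le> s)"
      then have "Z (max s 0) < Z (min t 1)" using \<open>s < t\<close> by (intro Z_strict_mono) auto
      moreover have "Z s \<le> Z (max s 0)" "Z (min t 1) \<le> Z t" by (auto intro: Z_mono)
      ultimately show False using \<open>Z s = Z t\<close> by simp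
    qed
    then show False using X_eq[of s] X_eq[of t] X_eq'[of s] X_eq'[of t] that by auto
  qed
  from this[of s t] this[of t s] assms show ?thesis by (metis linorder_neqE_linordered_idom)
qed

end

section \<open>Isometric maps of the strip\<close>

text \<open>With a coinductive notion the smoothness of a family of maps is shown by exhibiting a
  class closed under directional derivatives.\<close>

coinductive smooth_map :: "('a::real_normed_vector \<Rightarrow> 'b::real_normed_vector) \<Rightarrow> bool" where
  smooth_mapI: "(\<And>p. (f has_derivative f' p) (at p)) \<Longrightarrow> (\<And>v. smooth_map (\<lambda>p. f' p v)) \<Longrightarrow> smooth_map f"

lemma smooth_map_derivative:
  "smooth_map f \<Longrightarrow> \<exists>f'. (\<forall>p. (f has_derivative f' p) (at p)) \<and> (\<forall>v. smooth_map (\<lambda>p. f' p v))"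
  by (erule smooth_map.cases) blast

lemma smooth_map_affine:
  assumes f: "smooth_map f" and S: "bounded_linear S" and G: "bounded_linear G"
  shows "smooth_map (\<lambda>p. S (f (G p + c)))"
proof (rule smooth_map.coinduct[where X = "\<lambda>F. \<exists>f. smooth_map f \<and> F = (\<lambda>p. S (f (G p + c)))"])
  show "\<exists>g. smooth_map g \<and> (\<lambda>p. S (f (G p + c))) = (\<lambda>p. S (g (G p + c)))"
    using f by blast
next
  fix F assume "\<exists>f. smooth_map f \<and> F = (\<lambda>p. S (f (G p + c)))"
  then obtain f where f: "smooth_map f" and F: "F = (\<lambda>p. S (f (G p + c)))" by blast
  obtain f' where f': "\<And>p. (f has_derivative f' p) (at p)" "\<And>v. smooth_map (\<lambda>p. f' p v)"
    using smooth_map_derivative[OF f] by metis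
  have "(F has_derivative (\<lambda>v. S (f' (G p + c) (G v)))) (at p)" for p
    unfolding F
  proof (rule bounded_linear.has_derivative[OF S])
    have "((\<lambda>p. G p + c) has_derivative G) (at p)"
      by (intro has_derivative_add_const bounded_linear_imp_has_derivative G)
    from has_derivative_compose[OF this f'(1)]
    show "((\<lambda>p. f (G p + c)) has_derivative (\<lambda>v. f' (G p + c) (G v))) (at p)" .
  qed
  then show "\<exists>f f'. F = f \<and> (\<forall>p. (f has_derivative f' p) (at p)) \<and>
     (\<forall>v. (\<exists>f. smooth_map f \<and> (\<lambda>p. f' p v) = (\<lambda>p. S (f (G p + c)))) \<or> smooth_map (\<lambda>p. f' p v))"
    using f'(2) by (intro exI[of _ F] exI[of _ "\<lambda>p v. S (f' (G p + c) (G v))"]) blast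
qed

lemma cylinder_has_derivative:
  assumes "bounded_linear L" "bounded_linear l"
    and "\<And>x. (\<phi> has_real_derivative \<phi>' x) (at x)" "\<And>x. (\<psi> has_real_derivative \<psi>' x) (at x)"
  shows "((\<lambda>p. a + L p + \<phi> (l p) *\<^sub>R M + \<psi> (l p) *\<^sub>R N) has_derivative
    (\<lambda>v. L v + (\<phi>' (l p) * l v) *\<^sub>R M + (\<psi>' (l p) * l v) *\<^sub>R N)) (at p)"
proof -
  have D: "((\<lambda>p. h (l p)) has_derivative (\<lambda>v. h' (l p) * l v)) (at p)"
    if "\<And>x. (h has_real_derivative h' x) (at x)" for h h' :: "real \<Rightarrow> real"
    using has_derivative_compose[OF bounded_linear_imp_has_derivative[OF assms(2)]
        that[unfolded has_field_derivative_def]] by (simp add: mult.commute)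
  show ?thesis
    by (intro has_derivative_add has_derivative_scaleR_left D[OF assms(3)] D[OF assms(4)])
       (use has_derivative_add[OF has_derivative_const bounded_linear_imp_has_derivative[OF assms(1)]] in simp)
qed

text \<open>With \<open>l\<close>, \<open>M\<close>, \<open>N\<close> fixed and the other data
  varying, maps of this form are closed under directional derivatives.\<close>

lemma smooth_map_cylinder:
  fixes L :: "'a::real_normed_vector \<Rightarrow> 'b::real_normed_vector"
  assumes L: "bounded_linear L" and l: "bounded_linear l" and "smooth_fun \<phi>" "smooth_fun \<psi>"
  shows "smooth_map (\<lambda>p. a + L p + \<phi> (l p) *\<^sub>R M + \<psi> (l p) *\<^sub>R N)"
proof (rule smooth_map.coinduct[where X = "\<lambda>F. \<exists>a L \<phi> \<psi>. bounded_linear L \<and> smooth_fun \<phi> \<and> smooth_fun \<psi> \<and>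
     F = (\<lambda>p. a + L p + \<phi> (l p) *\<^sub>R M + \<psi> (l p) *\<^sub>R N)"])
  show "\<exists>a' L' \<phi>' \<psi>'. bounded_linear L' \<and> smooth_fun \<phi>' \<and> smooth_fun \<psi>' \<and>
     (\<lambda>p. a + L p + \<phi> (l p) *\<^sub>R M + \<psi> (l p) *\<^sub>R N) = (\<lambda>p. a' + L' p + \<phi>' (l p) *\<^sub>R M + \<psi>' (l p) *\<^sub>R N)"
    using assms by blast
next
  let ?X = "\<lambda>F. \<exists>a L \<phi> \<psi>. bounded_linear L \<and> smooth_fun \<phi> \<and> smooth_fun \<psi> \<and>
     F = (\<lambda>p. a + L p + \<phi> (l p) *\<^sub>R M + \<psi> (l p) *\<^sub>R N)"
  fix F :: "'a \<Rightarrow> 'b" assume "?X F"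
  then obtain a L \<phi> \<psi> where L: "bounded_linear L" and s: "smooth_fun \<phi>" "smooth_fun \<psi>"
     and F: "F = (\<lambda>p. a + L p + \<phi> (l p) *\<^sub>R M + \<psi> (l p) *\<^sub>R N)" by blast
  obtain \<phi>' where \<phi>': "\<And>x. (\<phi> has_real_derivative \<phi>' x) (at x)" "smooth_fun \<phi>'"
    using smooth_fun_derivative[OF s(1)] by metis
  obtain \<psi>' where \<psi>': "\<And>x. (\<psi> has_real_derivative \<psi>' x) (at x)" "smooth_fun \<psi>'"
    using smooth_fun_derivative[OF s(2)] by metis
  have 1: "(F has_derivative (\<lambda>v. L v + (\<phi>' (l p) * l v) *\<^sub>R M + (\<psi>' (l p) * l v) *\<^sub>R N)) (at p)" for p
    unfolding F by (rule cylinder_has_derivative[OF L l \<phi>'(1) \<psi>'(1)])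
  have 2: "?X (\<lambda>p. L v + (\<phi>' (l p) * l v) *\<^sub>R M + (\<psi>' (l p) * l v) *\<^sub>R N)" for v
  proof -
    have "smooth_fun (\<lambda>x. \<phi>' x * l v)" "smooth_fun (\<lambda>x. \<psi>' x * l v)"
      by (intro smooth_fun_mult smooth_fun_const \<phi>' \<psi>')+
    then show ?thesis
      by (intro exI[of _ "L v"] exI[of _ "\<lambda>p. 0"] exI[of _ "\<lambda>x. \<phi>' x * l v"] exI[of _ "\<lambda>x. \<psi>' x * l v"])
         simp
  qed
  show "\<exists>f f'. F = f \<and> (\<forall>p. (f has_derivative f' p) (at p)) \<and> (\<forall>v. ?X (\<lambda>p. f' p v) \<or> smooth_map (\<lambda>p. f' p v))"
    using 1 2 by (intro exI[of _ F] exI[of _ "\<lambda>p v. L v + (\<phi>' (l p) * l v) *\<^sub>R M + (\<psi>' (l p) * l v) *\<^sub>R N"]) blast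
qed

text \<open>Uniqueness of a derivative within a set needs short steps inside the set in every basis
  direction. On the edges of the strip only inward steps qualify, so the sign of \<open>d\<close>
  depends on the half of the strip containing \<open>y\<close>.\<close>

lemma strip_unique_derivative:
  fixes f :: "real \<times> real \<Rightarrow> 'b::real_normed_vector"
  assumes "p \<in> moebius_strip" "(f has_derivative f') (at p within moebius_strip)"
  shows "frechet_derivative f (at p within moebius_strip) = f'"
proof (rule frechet_derivative_unique_within[OF _ assms(2)])
  show "(f has_derivative frechet_derivative f (at p within moebius_strip)) (at p within moebius_strip)"
    using assms(2) frechet_derivative_works differentiable_def by blast
next
  fix i :: "real \<times> real" and e :: real assume i: "i \<in> Basis" and e: "0 < e"
  obtain x y where p: "p = (x, y)" by force
  then have y: "0 \<le> y" "y \<le> 1" using assms(1) by (auto simp: moebius_strip_def)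
  define d where "d = (if y \<le> 1 / 2 then min (e / 2) (1 / 2) else - min (e / 2) (1 / 2))"
  have d: "0 < \<bar>d\<bar>" "\<bar>d\<bar> < e" "0 \<le> y + d" "y + d \<le> 1" using e y by (auto simp: d_def)
  have "i = (1, 0) \<or> i = (0, 1)" using i by (auto simp: Basis_prod_def)
  then show "\<exists>d. 0 < \<bar>d\<bar> \<and> \<bar>d\<bar> < e \<and> p + d *\<^sub>R i \<in> moebius_strip"
    using d y by (intro exI[of _ d]) (auto simp: p moebius_strip_def)
qed

text \<open>A map on the strip is studied through maps of the whole plane agreeing with it on a piece
  \<open>(a, b) \<times> [0, 1]\<close> of the strip.\<close>

definition locally_on_strip :: "((real \<times> real \<Rightarrow> 'b) \<Rightarrow> bool) \<Rightarrow> (real \<times> real \<Rightarrow> 'b) \<Rightarrow> real \<Rightarrow> bool" where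
  "locally_on_strip Q F s \<longleftrightarrow> (\<exists>a b g. a < s \<and> s < b \<and> Q g \<and>
     (\<forall>x\<in>{a<..<b}. \<forall>y\<in>{0..1}. F (x, y) = g (x, y)))"

lemma has_derivative_local:
  fixes F :: "real \<times> real \<Rightarrow> 'b::real_normed_vector"
  assumes "(g has_derivative D) (at (x, y))" "a < x" "x < b" "y \<in> {0..1}"
    and eq: "\<And>x y. x \<in> {a<..<b} \<Longrightarrow> y \<in> {0..1} \<Longrightarrow> F (x, y) = g (x, y)"
  shows "(F has_derivative D) (at (x, y) within moebius_strip)"
proof (rule has_derivative_transform_within[where f = g and d = "min (x - a) (b - x)"])
  show "(g has_derivative D) (at (x, y) within moebius_strip)"
    using assms(1) by (rule has_derivative_at_withinI)
  show "g z = F z" if "z \<in> moebius_strip" "dist z (x, y) < min (x - a) (b - x)" for z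
  proof -
    have "\<bar>fst z - x\<bar> \<le> dist z (x, y)"
      using dist_fst_le[of z "(x, y)"] by (simp add: dist_real_def)
    then have "fst z \<in> {a<..<b}" using that(2) by auto
    then show ?thesis using that(1) eq[of "fst z" "snd z"] by (auto simp: moebius_strip_def)
  qed
qed (use assms in \<open>auto simp: moebius_strip_def\<close>)

text \<open>By induction on the order: near each \<open>s\<close> the derivative within the strip is
  that of the plane map, whose directional derivatives are smooth maps again.\<close>

lemma smooth_on_strip:
  fixes F :: "real \<times> real \<Rightarrow> 'b::real_normed_vector"
  assumes "\<And>s. locally_on_strip smooth_map F s"
  shows "smooth_on moebius_strip F"
proof -
  have "Ck_on k moebius_strip F" if "\<And>s. locally_on_strip smooth_map F s" for k F
    using that
  proof (induction k arbitrary: F)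
    case 0
    have "\<exists>D. (F has_derivative D) (at p within moebius_strip)" if "p \<in> moebius_strip" for p
    proof -
      obtain s y where p: "p = (s, y)" by force
      obtain a b g where g: "a < s" "s < b" "smooth_map g" "\<forall>x\<in>{a<..<b}. \<forall>y\<in>{0..1}. F (x, y) = g (x, y)"
        using 0[of s] by (auto simp: locally_on_strip_def)
      obtain g' where "(g has_derivative g') (at (s, y))"
        using smooth_map_derivative[OF g(3)] by blast
      from has_derivative_local[OF this g(1,2)]
      have "(F has_derivative g') (at (s, y) within moebius_strip)"
        using that g(4) p by (auto simp: moebius_strip_def)
      then show ?thesis unfolding p by blast
    qed
    then show ?case
      by (auto intro!: differentiable_imp_continuous_on simp: differentiable_on_def differentiable_def)
  next
    case (Suc k)
    have loc: "\<exists>a b g'. a < s \<and> s < b \<and> (\<forall>v. smooth_map (\<lambda>p. g' p v)) \<and>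
       (\<forall>x\<in>{a<..<b}. \<forall>y\<in>{0..1}. (F has_derivative g' (x, y)) (at (x, y) within moebius_strip))" for s
    proof -
      obtain a b g where g: "a < s" "s < b" "smooth_map g" "\<forall>x\<in>{a<..<b}. \<forall>y\<in>{0..1}. F (x, y) = g (x, y)"
        using Suc.prems[of s] by (auto simp: locally_on_strip_def)
      obtain g' where g': "\<And>p. (g has_derivative g' p) (at p)" "\<And>v. smooth_map (\<lambda>p. g' p v)"
        using smooth_map_derivative[OF g(3)] by metis
      have "(F has_derivative g' (x, y)) (at (x, y) within moebius_strip)" if "x \<in> {a<..<b}" "y \<in> {0..1}" for x y
        using that g(4) by (intro has_derivative_local[OF g'(1)]) auto
      then show ?thesis using g g' by blast
    qed
    have "F differentiable_on moebius_strip"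
      unfolding differentiable_on_def
    proof
      fix p assume p: "p \<in> moebius_strip"
      obtain s y where py: "p = (s, y)" by force
      have "y \<in> {0..1}" using p by (simp add: py moebius_strip_def)
      with loc[of s] show "F differentiable at p within moebius_strip"
        unfolding py differentiable_def by (metis greaterThanLessThan_iff)
    qed
    moreover have "Ck_on k moebius_strip (\<lambda>p. frechet_derivative F (at p within moebius_strip) v)" for v
    proof (rule Suc.IH)
      fix s
      obtain a b g' where g': "a < s" "s < b" "\<And>v. smooth_map (\<lambda>p. g' p v)"
        and D: "\<And>x y. x \<in> {a<..<b} \<Longrightarrow> y \<in> {0..1} \<Longrightarrow> (F has_derivative g' (x, y)) (at (x, y) within moebius_strip)"
        using loc[of s] by blast
      have "frechet_derivative F (at (x, y) within moebius_strip) v = g' (x, y) v"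
        if "x \<in> {a<..<b}" "y \<in> {0..1}" for x y
        using strip_unique_derivative[OF _ D[OF that]] that by (simp add: moebius_strip_def)
      then show "locally_on_strip smooth_map (\<lambda>p. frechet_derivative F (at p within moebius_strip) v) s"
        unfolding locally_on_strip_def using g' by blast
    qed
    ultimately show ?case by simp
  qed
  from this[OF assms] show ?thesis by (simp add: smooth_on_def)
qed

definition isometric_map :: "(real \<times> real \<Rightarrow> real ^ 3) \<Rightarrow> bool" where
  "isometric_map f \<longleftrightarrow> smooth_map f \<and>
     (\<forall>p. \<exists>D. (f has_derivative D) (at p) \<and> (\<forall>v w. D v \<bullet> D w = v \<bullet> w))"

lemma isometric_map_affine:
  assumes f: "isometric_map f"
    and S: "bounded_linear S" "\<And>x y. S x \<bullet> S y = x \<bullet> y"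
    and G: "bounded_linear G" "\<And>v w. G v \<bullet> G w = v \<bullet> w"
  shows "isometric_map (\<lambda>p. S (f (G p + c)))"
  unfolding isometric_map_def
proof (intro conjI allI)
  show "smooth_map (\<lambda>p. S (f (G p + c)))"
    using f S G by (intro smooth_map_affine) (auto simp: isometric_map_def)
  fix p
  obtain D where D: "(f has_derivative D) (at (G p + c))" "\<And>v w. D v \<bullet> D w = v \<bullet> w"
    using f unfolding isometric_map_def by blast
  have "((\<lambda>p. G p + c) has_derivative G) (at p)"
    by (intro has_derivative_add_const bounded_linear_imp_has_derivative G)
  from bounded_linear.has_derivative[OF S(1) has_derivative_compose[OF this D(1)]]
  show "\<exists>D. ((\<lambda>p. S (f (G p + c))) has_derivative D) (at p) \<and> (\<forall>v w. D v \<bullet> D w = v \<bullet> w)"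
    by (intro exI[of _ "\<lambda>v. S (D (G v))"]) (simp add: S D G)
qed

text \<open>The image is a cylinder over the plane curve \<open>(\<phi>, \<psi>)\<close> with
  rulings in direction \<open>E\<close>. Unit speed makes it unroll isometrically, \<open>k\<close>
  and \<open>l\<close> being orthonormal coordinates along and across the rulings.\<close>

lemma isometric_map_cylinder:
  fixes E M N :: "real ^ 3"
  assumes l: "bounded_linear k" "bounded_linear l" "\<And>v w. k v * k w + l v * l w = v \<bullet> w"
    and frame: "norm E = 1" "norm M = 1" "norm N = 1" "E \<bullet> M = 0" "E \<bullet> N = 0" "M \<bullet> N = 0"
    and s: "smooth_fun \<phi>" "smooth_fun \<psi>"
    and d: "\<And>x. (\<phi> has_real_derivative \<phi>' x) (at x)" "\<And>x. (\<psi> has_real_derivative \<psi>' x) (at x)"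
    and unit: "\<And>x. (\<phi>' x)\<^sup>2 + (\<psi>' x)\<^sup>2 = 1"
  shows "isometric_map (\<lambda>p. a + k p *\<^sub>R E + \<phi> (l p) *\<^sub>R M + \<psi> (l p) *\<^sub>R N)"
  unfolding isometric_map_def
proof (intro conjI allI)
  have kE: "bounded_linear (\<lambda>p. k p *\<^sub>R E)" by (rule bounded_linear_scaleR_left[THEN bounded_linear_compose, OF l(1)])
  show "smooth_map (\<lambda>p. a + k p *\<^sub>R E + \<phi> (l p) *\<^sub>R M + \<psi> (l p) *\<^sub>R N)"
    by (rule smooth_map_cylinder[OF kE l(2) s])
  fix p
  have i: "E \<bullet> E = 1" "M \<bullet> M = 1" "N \<bullet> N = 1" "M \<bullet> E = 0" "N \<bullet> E = 0" "N \<bullet> M = 0"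
    using frame by (simp_all add: norm_eq_1 inner_commute)
  have "(k v *\<^sub>R E + (\<phi>' (l p) * l v) *\<^sub>R M + (\<psi>' (l p) * l v) *\<^sub>R N) \<bullet>
        (k w *\<^sub>R E + (\<phi>' (l p) * l w) *\<^sub>R M + (\<psi>' (l p) * l w) *\<^sub>R N) = v \<bullet> w" for v w
  proof -
    have "(k v *\<^sub>R E + (\<phi>' (l p) * l v) *\<^sub>R M + (\<psi>' (l p) * l v) *\<^sub>R N) \<bullet>
        (k w *\<^sub>R E + (\<phi>' (l p) * l w) *\<^sub>R M + (\<psi>' (l p) * l w) *\<^sub>R N)
      = k v * k w + (\<phi>' (l p) * l v) * (\<phi>' (l p) * l w) + (\<psi>' (l p) * l v) * (\<psi>' (l p) * l w)"
      by (simp add: inner_add_left inner_add_right i frame)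
    also have "\<dots> = k v * k w + ((\<phi>' (l p))\<^sup>2 + (\<psi>' (l p))\<^sup>2) * (l v * l w)"
      by (simp add: algebra_simps power2_eq_square)
    finally show ?thesis by (simp add: unit l)
  qed
  then show "\<exists>D. ((\<lambda>p. a + k p *\<^sub>R E + \<phi> (l p) *\<^sub>R M + \<psi> (l p) *\<^sub>R N) has_derivative D) (at p) \<and>
     (\<forall>v w. D v \<bullet> D w = v \<bullet> w)"
    using cylinder_has_derivative[OF kE l(2) d] by blast
qed

section \<open>The crisscross band\<close>

text \<open>
  As \<open>\<delta> \<longrightarrow> 0\<close> the band flattens to the folded strip that runs from the middle segment \<open>s = 0\<close> on the
  \<open>y\<close>-axis to the left, turns back at \<open>x = - a\<close> (\<open>FA\<close>), crosses the square it came from, is turned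
  into the \<open>y\<close>-direction by a diagonal fold (\<open>FD\<close>) and is folded over beyond \<open>y = 1\<close> (\<open>FT\<close>), where it meets its image
  under the half-turn \<open>flip\<close> about the \<open>y\<close>-axis.  Every fold is rounded by a U-turn.
\<close>

locale crisscross = uturn +
  fixes \<delta> :: real
  assumes \<delta>: "0 < \<delta>" "\<delta> \<le> 1 / 40"
begin

text \<open>\<open>len\<close> is the arc length of the U-turns in \<open>FA\<close> and \<open>FT\<close>; the one in \<open>FD\<close> is half as long, since the
  layers that it connects are half as far apart, and the factor \<open>sqrt 8\<close> makes its coordinates along and across the
  strip rational in \<open>\<delta>\<close>.  The diagonal piece is \<open>s0 \<le> s \<le> s1\<close>, and \<open>L\<close> is the middle of the last fold.\<close>

definition len :: real where "len = sqrt 8 * \<delta>"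
text \<open>Half the rise of a large U-turn. The flat layers of half the band lie at heights 0,
  \<open>2 * h\<close> and \<open>h\<close>, and the full last fold descends from \<open>h\<close>
  to \<open>- h\<close>.\<close>

definition h :: real where "h = height * len / 2"
definition a :: real where "a = 1 / 2 + 2 * \<delta>"
definition s0 :: real where "s0 = a + len + \<delta>"
definition s1 :: real where "s1 = s0 + 1 + 3 * \<delta>"
definition L :: real where "L = s1 + len / 2"

lemma len: "0 < len" "len \<le> 3 * \<delta>" "2 * \<delta> \<le> len" "len * sqrt 2 = 4 * \<delta>"
proof -
  have s8: "sqrt 8 = 2 * sqrt 2" using real_sqrt_mult[of 4 2] by simp
  show "0 < len" using \<delta> by (simp add: len_def)
  have "sqrt 8 \<le> sqrt 9" "sqrt 4 \<le> sqrt 8" by (subst real_sqrt_le_iff; simp)+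
  then have "sqrt 8 \<le> 3" "2 \<le> sqrt 8" by simp_all
  then show "len \<le> 3 * \<delta>" "2 * \<delta> \<le> len"
    using \<delta> by (simp_all add: len_def)
  show "len * sqrt 2 = 4 * \<delta>" by (simp add: len_def s8)
qed

lemma h_pos: "0 < h" and h2: "height * len = 2 * h"
  using len height_pos by (simp_all add: h_def)

lemma L_pos: "0 < L" using \<delta> len by (simp add: L_def s1_def s0_def a_def)

definition FA :: "real \<times> real \<Rightarrow> real ^ 3" where
  "FA p = vector [- a - len * X ((fst p - a) / len), snd p, len * Z ((fst p - a) / len)]"

text \<open>The crease starts along \<open>fst p - s0 = snd p\<close>. The distance across it is
  \<open>(fst p - s0 - snd p) / sqrt 2\<close>; dividing by the arc length
  \<open>len / 2 = sqrt 2 * \<delta>\<close> of this U-turn gives \<open>m\<close>.\<close>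

definition FD :: "real \<times> real \<Rightarrow> real ^ 3" where
  "FD p = (let m = (fst p - s0 - snd p) / (2 * \<delta>) in
     vector [\<delta> - a + (fst p - s0 + snd p) / 2 + \<delta> * X m, (fst p - s0 + snd p) / 2 - \<delta> * X m,
       2 * h - len / 2 * Z m])"

definition FT :: "real \<times> real \<Rightarrow> real ^ 3" where
  "FT p = vector [snd p - 1 / 2, 1 + 2 * \<delta> + len * X ((fst p - s1) / len), h - len * Z ((fst p - s1) / len)]"

definition flip :: "real ^ 3 \<Rightarrow> real ^ 3" where
  "flip p = vector [- p $ 1, p $ 2, - p $ 3]"

definition half_band :: "real \<times> real \<Rightarrow> real ^ 3" where
  "half_band p = (if fst p \<le> s0 then FA p else if fst p \<le> s1 then FD p else FT p)"

text \<open>\<open>tw k\<close> is the action on the width of the deck transformation that translates by \<open>k\<close> lengths of the band.\<close>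

definition tw :: "int \<Rightarrow> real \<Rightarrow> real" where
  "tw k y = (if even k then y else 1 - y)"

text \<open>The summand \<open>1 / 2\<close> centres the fundamental interval at the middle segment,
  so that \<open>- L \<le> t < L\<close> and the two halves of the interval are exchanged by
  \<open>flip\<close>.\<close>

definition band :: "real \<times> real \<Rightarrow> real ^ 3" where
  "band = (\<lambda>(s, y). let k = \<lfloor>s / (2 * L) + 1 / 2\<rfloor>; t = s - of_int k * (2 * L); y' = tw k y in
     if 0 \<le> t then half_band (t, y') else flip (half_band (- t, y')))"

lemma vec3_eq_iff: "(vector [x, y, z] :: real ^ 3) = vector [x', y', z'] \<longleftrightarrow> x = x' \<and> y = y' \<and> z = z'"
  by (simp add: vec_eq_iff forall_3)

lemma vec3: "(vector [x, y, z] :: real ^ 3) = x *\<^sub>R axis 1 1 + y *\<^sub>R axis 2 1 + z *\<^sub>R axis 3 1"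
  by (simp add: vec_eq_iff forall_3 axis_def)

lemma flip_flip [simp]: "flip (flip p) = p"
  by (simp add: flip_def vec_eq_iff forall_3)

lemma flip_eq_iff: "flip p = flip q \<longleftrightarrow> p = q"
  by (metis flip_flip)

lemma bounded_linear_flip: "bounded_linear flip"
proof -
  have "linear flip" by (rule linearI) (simp_all add: flip_def vec_eq_iff forall_3)
  then show ?thesis by (simp add: linear_conv_bounded_linear)
qed

lemma inner_flip: "flip p \<bullet> flip q = p \<bullet> q"
  by (simp add: flip_def inner_vec_def sum_3)

text \<open>Outside its curved zone each piece is affine, and the shifts in the definitions are
  chosen so that consecutive pieces have the same affine formula on an overlap of positive
  length.\<close>

lemma FA_eq: "s \<le> a \<Longrightarrow> FA (s, y) = vector [- s, y, 0]"
  "a + len \<le> s \<Longrightarrow> FA (s, y) = vector [\<delta> - a + (s - s0), y, 2 * h]"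
proof -
  assume "s \<le> a"
  then have "(s - a) / len \<le> 0" using len by (simp add: divide_le_0_iff)
  then show "FA (s, y) = vector [- s, y, 0]" using len by (simp add: FA_def X_eq Z_eq)
next
  assume "a + len \<le> s"
  then have "1 \<le> (s - a) / len" using len by (simp add: field_simps)
  then show "FA (s, y) = vector [\<delta> - a + (s - s0), y, 2 * h]"
    using len h2 by (simp add: FA_def X_eq' Z_eq' vec3_eq_iff s0_def field_simps)
qed

lemma FD_eq: "s - s0 \<le> y \<Longrightarrow> FD (s, y) = vector [\<delta> - a + (s - s0), y, 2 * h]"
  "y + 2 * \<delta> \<le> s - s0 \<Longrightarrow> FD (s, y) = vector [y - 1 / 2, s - s0 - \<delta>, h]"
proof -
  assume "s - s0 \<le> y"
  then have "(s - s0 - y) / (2 * \<delta>) \<le> 0" using \<delta> by (simp add: divide_le_0_iff)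
  then show "FD (s, y) = vector [\<delta> - a + (s - s0), y, 2 * h]"
    using \<delta> by (simp add: FD_def Let_def X_eq Z_eq vec3_eq_iff field_simps)
next
  assume "y + 2 * \<delta> \<le> s - s0"
  then have "1 \<le> (s - s0 - y) / (2 * \<delta>)" using \<delta> by (simp add: field_simps)
  then show "FD (s, y) = vector [y - 1 / 2, s - s0 - \<delta>, h]"
    using \<delta> h2 by (simp add: FD_def Let_def X_eq' Z_eq' vec3_eq_iff a_def field_simps)
qed

lemma FT_eq: "s \<le> s1 \<Longrightarrow> FT (s, y) = vector [y - 1 / 2, s - s0 - \<delta>, h]"
proof -
  assume "s \<le> s1"
  then have "(s - s1) / len \<le> 0" using len by (simp add: divide_le_0_iff)
  then show ?thesis using len by (simp add: FT_def X_eq Z_eq vec3_eq_iff s1_def field_simps)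
qed

text \<open>The symmetry of the U-turn about its midpoint \<open>L\<close> makes the last fold
  continue into the flipped half, with the width reversed: this is the Moebius gluing.\<close>

lemma FT_sym: "flip (FT (2 * L - s, 1 - y)) = FT (s, y)"
proof -
  have e: "(2 * L - s - s1) / len = 1 - (s - s1) / len" using len by (simp add: L_def field_simps)
  have "flip (FT (2 * L - s, 1 - y)) = vector [- (1 - y - 1 / 2), 1 + 2 * \<delta> + len * X ((s - s1) / len),
      - (h - len * (height - Z ((s - s1) / len)))]"
    by (simp only: flip_def FT_def fst_conv snd_conv vector_3 e X_sym Z_sym)
  also have "\<dots> = FT (s, y)"
    using h2 by (simp add: FT_def vec3_eq_iff right_diff_distrib mult.commute)
  finally show ?thesis .
qed

lemma scaled_smooth: "smooth_fun \<phi> \<Longrightarrow> smooth_fun (\<lambda>x. c + d * \<phi> (e * x + f))"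
proof -
  assume \<phi>: "smooth_fun \<phi>"
  have "smooth_fun (\<lambda>x. e * x + f)"
    by (intro smooth_fun_add smooth_fun_mult smooth_fun_const smooth_fun_ident)
  from smooth_fun_add[OF smooth_fun_const smooth_fun_mult[OF smooth_fun_const smooth_fun_compose[OF \<phi> this]]]
  show ?thesis .
qed

lemma scaled_deriv:
  assumes "\<And>x. (\<phi> has_real_derivative \<phi>' x) (at x)" and "d * e = r"
  shows "((\<lambda>x. c + d * \<phi> (e * x + f)) has_real_derivative r * \<phi>' (e * x + f)) (at x)"
proof -
  have "((\<lambda>x. e * x + f) has_real_derivative e) (at x)" by (auto intro!: derivative_eq_intros)
  from DERIV_chain2[OF assms(1) this]
  have "((\<lambda>x. c + d * \<phi> (e * x + f)) has_real_derivative 0 + d * (\<phi>' (e * x + f) * e)) (at x)"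
    by (intro DERIV_add DERIV_const DERIV_cmult)
  then show ?thesis by (rule DERIV_cong) (simp add: assms(2)[symmetric])
qed

lemma axis_inner: "norm (axis i (1::real) :: real ^ 3) = 1" "i \<noteq> j \<Longrightarrow> axis i 1 \<bullet> (axis j 1 :: real ^ 3) = 0"
  by (auto simp: inner_axis_axis)

lemma linear_coordinates: "bounded_linear (fst :: real \<times> real \<Rightarrow> real)" "bounded_linear (snd :: real \<times> real \<Rightarrow> real)"
  by (rule bounded_linear_fst bounded_linear_snd)+

lemma isometric_FA: "isometric_map FA"
proof -
  have "isometric_map (\<lambda>p. 0 + snd p *\<^sub>R axis 2 1 + (- a + - len * X (1 / len * fst p + - a / len)) *\<^sub>R axis 1 1
      + (0 + len * Z (1 / len * fst p + - a / len)) *\<^sub>R axis 3 1)"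
  proof (rule isometric_map_cylinder[where k = snd and l = fst])
    show "((\<lambda>x. - a + - len * X (1 / len * x + - a / len)) has_real_derivative (- 1) * cos (\<Theta> (1 / len * x + - a / len))) (at x)"
      "((\<lambda>x. 0 + len * Z (1 / len * x + - a / len)) has_real_derivative 1 * sin (\<Theta> (1 / len * x + - a / len))) (at x)" for x
      using len by (intro scaled_deriv deriv; simp)+
    show "(- 1 * cos (\<Theta> (1 / len * x + - a / len)))\<^sup>2 + (1 * sin (\<Theta> (1 / len * x + - a / len)))\<^sup>2 = 1" for x
      by simp
    show "smooth_fun (\<lambda>x. - a + - len * X (1 / len * x + - a / len))"
      "smooth_fun (\<lambda>x. 0 + len * Z (1 / len * x + - a / len))"
      by (rule scaled_smooth[OF smooth(1)] scaled_smooth[OF smooth(2)])+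
  qed (auto intro: linear_coordinates simp: inner_prod_def axis_inner)
  moreover have "FA = (\<lambda>p. 0 + snd p *\<^sub>R axis 2 1 + (- a + - len * X (1 / len * fst p + - a / len)) *\<^sub>R axis 1 1
      + (0 + len * Z (1 / len * fst p + - a / len)) *\<^sub>R axis 3 1)"
    by (simp add: fun_eq_iff FA_def vec3 diff_divide_distrib)
  ultimately show ?thesis by simp
qed

lemma isometric_FT: "isometric_map FT"
proof -
  have "isometric_map (\<lambda>p. - (1 / 2) *\<^sub>R axis 1 1 + snd p *\<^sub>R axis 1 1 + (1 + 2 * \<delta> + len * X (1 / len * fst p + - s1 / len)) *\<^sub>R axis 2 1
      + (h + - len * Z (1 / len * fst p + - s1 / len)) *\<^sub>R axis 3 1)"
  proof (rule isometric_map_cylinder[where k = snd and l = fst])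
    show "((\<lambda>x. 1 + 2 * \<delta> + len * X (1 / len * x + - s1 / len)) has_real_derivative 1 * cos (\<Theta> (1 / len * x + - s1 / len))) (at x)"
      "((\<lambda>x. h + - len * Z (1 / len * x + - s1 / len)) has_real_derivative (- 1) * sin (\<Theta> (1 / len * x + - s1 / len))) (at x)" for x
      using len by (intro scaled_deriv deriv; simp)+
    show "(1 * cos (\<Theta> (1 / len * x + - s1 / len)))\<^sup>2 + (- 1 * sin (\<Theta> (1 / len * x + - s1 / len)))\<^sup>2 = 1" for x
      by simp
    show "smooth_fun (\<lambda>x. 1 + 2 * \<delta> + len * X (1 / len * x + - s1 / len))"
      "smooth_fun (\<lambda>x. h + - len * Z (1 / len * x + - s1 / len))"
      by (rule scaled_smooth[OF smooth(1)] scaled_smooth[OF smooth(2)])+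
  qed (auto intro: linear_coordinates simp: inner_prod_def axis_inner)
  moreover have "FT = (\<lambda>p. - (1 / 2) *\<^sub>R axis 1 1 + snd p *\<^sub>R axis 1 1 + (1 + 2 * \<delta> + len * X (1 / len * fst p + - s1 / len)) *\<^sub>R axis 2 1
      + (h + - len * Z (1 / len * fst p + - s1 / len)) *\<^sub>R axis 3 1)"
    by (simp add: fun_eq_iff FT_def vec3 diff_divide_distrib algebra_simps)
  ultimately show ?thesis by simp
qed

lemma isometric_FD: "isometric_map FD"
proof -
  let ?r = "1 / sqrt 2" and ?e = "sqrt 2 / (2 * \<delta>)" and ?f = "- s0 / (2 * \<delta>)"
  \<comment> \<open>Orthonormal coordinates along and across the diagonal crease; \<open>?E\<close>
    and \<open>?M\<close> are the corresponding directions in space.\<close>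
  let ?k = "\<lambda>p::real \<times> real. ?r * fst p + ?r * snd p" and ?l = "\<lambda>p::real \<times> real. ?r * fst p - ?r * snd p"
  let ?E = "?r *\<^sub>R (axis 1 1 + axis 2 1) :: real ^ 3" and ?M = "?r *\<^sub>R (axis 1 1 - axis 2 1) :: real ^ 3"
  have r2: "?r * ?r = 1 / 2" by simp
  have eq: "FD = (\<lambda>p. vector [\<delta> - a - s0 / 2, - s0 / 2, 2 * h] + ?k p *\<^sub>R ?E + (0 + sqrt 2 * \<delta> * X (?e * ?l p + ?f)) *\<^sub>R ?M
      + (0 + - len / 2 * Z (?e * ?l p + ?f)) *\<^sub>R axis 3 1)"
  proof
    fix p
    have "?e * ?l p + ?f = (fst p - s0 - snd p) / (2 * \<delta>)"
      using \<delta> by (simp add: field_simps)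
    then show "FD p = vector [\<delta> - a - s0 / 2, - s0 / 2, 2 * h] + ?k p *\<^sub>R ?E + (0 + sqrt 2 * \<delta> * X (?e * ?l p + ?f)) *\<^sub>R ?M
      + (0 + - len / 2 * Z (?e * ?l p + ?f)) *\<^sub>R axis 3 1"
      unfolding FD_def Let_def
      by (simp only:) (simp add: vec_eq_iff forall_3 axis_def field_simps)
  qed
  show ?thesis
    unfolding eq
  proof (rule isometric_map_cylinder[where k = ?k and l = ?l])
    show "bounded_linear ?k" "bounded_linear ?l"
      by (intro bounded_linear_add bounded_linear_sub bounded_linear_const_mult linear_coordinates)+
    show "?k v * ?k w + ?l v * ?l w = v \<bullet> w" for v w
      using r2 by (simp add: inner_prod_def field_simps)
    show "norm ?E = 1" "norm ?M = 1"
      by (simp_all add: norm_eq_sqrt_inner inner_add_left inner_add_right inner_diff_left inner_diff_right inner_axis_axis)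
    show "?E \<bullet> ?M = 0" "?E \<bullet> axis 3 1 = 0" "?M \<bullet> axis 3 1 = 0"
      by (simp_all add: inner_add_left inner_add_right inner_diff_left inner_diff_right inner_axis_axis)
    show "((\<lambda>x. 0 + sqrt 2 * \<delta> * X (?e * x + ?f)) has_real_derivative 1 * cos (\<Theta> (?e * x + ?f))) (at x)" for x
      using \<delta> by (intro scaled_deriv deriv) simp
    show "((\<lambda>x. 0 + - len / 2 * Z (?e * x + ?f)) has_real_derivative (- 1) * sin (\<Theta> (?e * x + ?f))) (at x)" for x
      using \<delta> len by (intro scaled_deriv deriv) (simp add: field_simps)
    show "(1 * cos (\<Theta> (?e * x + ?f)))\<^sup>2 + (- 1 * sin (\<Theta> (?e * x + ?f)))\<^sup>2 = 1" for x by simp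
    show "smooth_fun (\<lambda>x. 0 + sqrt 2 * \<delta> * X (?e * x + ?f))" "smooth_fun (\<lambda>x. 0 + - len / 2 * Z (?e * x + ?f))"
      by (rule scaled_smooth[OF smooth(1)] scaled_smooth[OF smooth(2)])+
  qed (auto simp: axis_inner)
qed

section \<open>Periodicity, half-turn symmetry and smoothness of the band\<close>

lemma tw_tw: "tw k (tw k' y) = tw (k + k') y"
  by (simp add: tw_def)

lemma tw_0: "tw 0 y = y" by (simp add: tw_def)

lemma tw_range: "tw k y \<in> {0..1} \<longleftrightarrow> y \<in> {0..1}"
  by (auto simp: tw_def)

lemma band_deck: "band (s + of_int k * (2 * L), tw k y) = band (s, y)"
proof -
  have "(s + of_int k * (2 * L)) / (2 * L) + 1 / 2 = (s / (2 * L) + 1 / 2) + of_int k"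
    using L_pos by (simp add: field_simps)
  then have F: "\<lfloor>(s + of_int k * (2 * L)) / (2 * L) + 1 / 2\<rfloor> = \<lfloor>s / (2 * L) + 1 / 2\<rfloor> + k"
    by (simp only: floor_add_int)
  have T: "s + of_int k * (2 * L) - of_int (j + k) * (2 * L) = s - of_int j * (2 * L)" for j
    by (simp add: algebra_simps)
  have Y: "tw (j + k) (tw k y) = tw j y" for j
    by (simp add: tw_def)
  show ?thesis by (simp only: band_def prod.case Let_def F T Y)
qed

lemma half_band_0: "half_band (0, y) = vector [0, y, 0]"
  using \<delta> len by (simp add: half_band_def FA_eq s0_def a_def)

lemma half_band_L: "half_band (L, y) = FT (L, y)"
  using \<delta> len by (simp add: half_band_def L_def s1_def)

lemma band_pos: "0 \<le> s \<Longrightarrow> s \<le> L \<Longrightarrow> band (s, y) = half_band (s, y)"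
proof -
  assume s: "0 \<le> s" "s \<le> L"
  show ?thesis
  proof (cases "s = L")
    case False
    then have "0 \<le> s / (2 * L) + 1 / 2" "s / (2 * L) + 1 / 2 < 1" using s L_pos by (auto simp: field_simps)
    then have "\<lfloor>s / (2 * L) + 1 / 2\<rfloor> = 0" by linarith
    then show ?thesis using s by (simp add: band_def tw_0)
  next
    case True
    then have "s / (2 * L) + 1 / 2 = 1" using L_pos by simp
    then have "\<lfloor>s / (2 * L) + 1 / 2\<rfloor> = 1" by simp
    then have "band (s, y) = flip (half_band (L, 1 - y))"
      using True L_pos by (simp add: band_def tw_def)
    then show ?thesis using FT_sym[of L y] by (simp add: half_band_L True)
  qed
qed

lemma band_neg: "- L \<le> s \<Longrightarrow> s \<le> 0 \<Longrightarrow> band (s, y) = flip (half_band (- s, y))"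
proof -
  assume s: "- L \<le> s" "s \<le> 0"
  then have "0 \<le> s / (2 * L) + 1 / 2" "s / (2 * L) + 1 / 2 < 1" using L_pos by (auto simp: field_simps)
  then have "\<lfloor>s / (2 * L) + 1 / 2\<rfloor> = 0" by linarith
  moreover have "flip (half_band (0, y)) = half_band (0, y)"
    by (simp add: half_band_0 flip_def)
  ultimately show ?thesis using s by (cases "s = 0") (auto simp: band_def tw_0)
qed

lemma fundamental_domain: obtains k t where "s = t + of_int k * (2 * L)" "- L \<le> t" "t < L"
proof
  let ?k = "\<lfloor>s / (2 * L) + 1 / 2\<rfloor>"
  show "s = (s - of_int ?k * (2 * L)) + of_int ?k * (2 * L)" by simp
  have "of_int ?k \<le> s / (2 * L) + 1 / 2" "s / (2 * L) + 1 / 2 < of_int ?k + 1" by linarith+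
  then have "0 \<le> (s / (2 * L) + 1 / 2 - of_int ?k) * (2 * L)" "0 < (of_int ?k + 1 - (s / (2 * L) + 1 / 2)) * (2 * L)"
    using L_pos by (intro mult_nonneg_nonneg mult_pos_pos; linarith)+
  moreover have "s / (2 * L) * (2 * L) = s" using L_pos by simp
  ultimately show "- L \<le> s - of_int ?k * (2 * L)" "s - of_int ?k * (2 * L) < L"
    by (simp_all only: left_diff_distrib distrib_right)
qed

lemma band_flip: "band (- s, y) = flip (band (s, y))"
proof -
  obtain k t where s: "s = t + of_int k * (2 * L)" and t: "- L \<le> t" "t < L"
    using fundamental_domain by blast
  have y: "tw k (tw k y) = y" "tw (- k) (tw k y) = y" by (simp_all add: tw_def)
  have "band (- s, y) = band (- t, tw k y)"
    using band_deck[of "- t" "- k" "tw k y"] by (simp add: s y)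
  also have "\<dots> = flip (band (t, tw k y))"
    using t band_pos[of "- t"] band_neg[of "- t"] band_pos[of t] band_neg[of t] by (cases "0 \<le> t") auto
  also have "band (t, tw k y) = band (s, y)"
    using band_deck[of t k "tw k y"] by (simp add: s y)
  finally show ?thesis .
qed

lemma local_deck:
  assumes "locally_on_strip isometric_map band t"
  shows "locally_on_strip isometric_map band (t + of_int k * (2 * L))"
proof -
  obtain l r g where g: "l < t" "t < r" "isometric_map g" "\<And>x y. x \<in> {l<..<r} \<Longrightarrow> y \<in> {0..1} \<Longrightarrow> band (x, y) = g (x, y)"
    using assms unfolding locally_on_strip_def by blast
  define G where "G = (\<lambda>p::real \<times> real. (fst p, (if even k then 1 else - 1) * snd p))"
  define c where "c = (- of_int k * (2 * L), if even k then 0 else (1::real))"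
  have "bounded_linear G" unfolding G_def
    by (intro bounded_linear_Pair bounded_linear_const_mult linear_coordinates)
  moreover have "G v \<bullet> G w = v \<bullet> w" for v w by (simp add: G_def inner_prod_def)
  ultimately have "isometric_map (\<lambda>p. id (g (G p + c)))"
    using g(3) by (intro isometric_map_affine) (auto simp: id_def)
  moreover have "band (x, y) = id (g (G (x, y) + c))"
    if "x \<in> {l + of_int k * (2 * L)<..<r + of_int k * (2 * L)}" "y \<in> {0..1}" for x y
  proof -
    have "band (x, y) = band (x - of_int k * (2 * L), tw k y)"
      using band_deck[of "x - of_int k * (2 * L)" k "tw k y"] by (simp add: tw_tw) (simp add: tw_def)
    also have "\<dots> = g (x - of_int k * (2 * L), tw k y)"
      using that tw_range by (intro g(4)) auto
    also have "(x - of_int k * (2 * L), tw k y) = G (x, y) + c"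
      by (simp add: G_def c_def tw_def)
    finally show ?thesis by simp
  qed
  ultimately show ?thesis
    unfolding locally_on_strip_def using g(1,2)
    by (intro exI[of _ "l + of_int k * (2 * L)"] exI[of _ "r + of_int k * (2 * L)"] exI[of _ "\<lambda>p. id (g (G p + c))"]) auto
qed

lemma local_flip:
  assumes "locally_on_strip isometric_map band t"
  shows "locally_on_strip isometric_map band (- t)"
proof -
  obtain l r g where g: "l < t" "t < r" "isometric_map g" "\<And>x y. x \<in> {l<..<r} \<Longrightarrow> y \<in> {0..1} \<Longrightarrow> band (x, y) = g (x, y)"
    using assms unfolding locally_on_strip_def by blast
  define G where "G = (\<lambda>p::real \<times> real. (- fst p, snd p))"
  have "bounded_linear G" unfolding G_def
    by (intro bounded_linear_Pair bounded_linear_minus linear_coordinates)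
  moreover have "G v \<bullet> G w = v \<bullet> w" for v w by (simp add: G_def inner_prod_def)
  ultimately have "isometric_map (\<lambda>p. flip (g (G p + 0)))"
    using g(3) by (intro isometric_map_affine bounded_linear_flip inner_flip)
  moreover have "band (x, y) = flip (g (G (x, y) + 0))" if "x \<in> {- r<..<- l}" "y \<in> {0..1}" for x y
    using band_flip[of "- x" y] that g(4)[of "- x" y] by (simp add: G_def)
  ultimately show ?thesis
    unfolding locally_on_strip_def using g(1,2)
    by (intro exI[of _ "- r"] exI[of _ "- l"] exI[of _ "\<lambda>p. flip (g (G p + 0))"]) auto
qed

text \<open>Four overlapping intervals cover \<open>[0, L]\<close>, and on each a single plane map
  gives the band. The first extends below 0, where the middle layer is its own flip; the last
  extends beyond \<open>L\<close> by a deck transformation and \<open>FT_sym\<close>.\<close>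

lemma local_fundamental:
  assumes "0 \<le> t" "t \<le> L"
  shows "locally_on_strip isometric_map band t"
proof -
  have ord: "0 < a" "a < a + len" "a + len < s0" "s0 < s1 - \<delta>" "s1 - \<delta> < s1" "s1 < L" "L < s1 + len"
    using \<delta> len by (simp_all add: a_def s0_def s1_def L_def)
  consider "t < a" | "0 < t" "t < s0" | "s0 - \<delta> < t" "t < s1" | "s1 - \<delta> < t"
    using assms ord by linarith
  then show ?thesis
  proof cases
    case 1
    have "band (x, y) = FA (x, y)" if "x \<in> {- a<..<a}" for x y
      using that ord band_pos[of x y] band_neg[of x y]
      by (cases "0 \<le> x") (auto simp: half_band_def FA_eq flip_def)
    then show ?thesis using 1 assms ord isometric_FA unfolding locally_on_strip_def
      by (intro exI[of _ "- a"] exI[of _ a] exI[of _ FA]) auto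
  next
    case 2
    have "band (x, y) = FA (x, y)" if "x \<in> {0<..<s0}" for x y
      using that ord band_pos[of x y] by (auto simp: half_band_def)
    then show ?thesis using 2 isometric_FA unfolding locally_on_strip_def
      by (intro exI[of _ 0] exI[of _ s0] exI[of _ FA]) auto
  next
    case 3
    have "band (x, y) = FD (x, y)" if "x \<in> {s0 - \<delta><..<s1}" "y \<in> {0..1}" for x y
    proof -
      have "s0 - \<delta> = a + len" by (simp add: s0_def)
      then show ?thesis
        using that ord band_pos[of x y] FA_eq(2)[of x y] FD_eq(1)[of x y] by (auto simp: half_band_def)
    qed
    then show ?thesis using 3 isometric_FD unfolding locally_on_strip_def
      by (intro exI[of _ "s0 - \<delta>"] exI[of _ s1] exI[of _ FD]) auto
  next
    case 4
    have "band (x, y) = FT (x, y)" if x: "x \<in> {s1 - \<delta><..<s1 + len}" and y: "y \<in> {0..1}" for x y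
    proof (cases "x \<le> L")
      case True
      have "s1 - \<delta> = s0 + 1 + 2 * \<delta>" by (simp add: s1_def)
      then show ?thesis
        using x y True ord band_pos[of x y] FD_eq(2)[of y x] FT_eq[of x y] by (auto simp: half_band_def)
    next
      case False
      have "2 * L - x > s1" using x by (simp add: L_def)
      have "band (x, y) = band (- (2 * L - x), 1 - y)"
        using band_deck[of "- (2 * L - x)" 1 "1 - y"] by (simp add: tw_def)
      also have "\<dots> = flip (half_band (2 * L - x, 1 - y))"
        using False x ord by (subst band_neg) (auto simp: L_def)
      also have "half_band (2 * L - x, 1 - y) = FT (2 * L - x, 1 - y)"
        using \<open>2 * L - x > s1\<close> ord by (simp add: half_band_def)
      finally show ?thesis using FT_sym by simp
    qed
    then show ?thesis using 4 assms ord isometric_FT unfolding locally_on_strip_def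
      by (intro exI[of _ "s1 - \<delta>"] exI[of _ "s1 + len"] exI[of _ FT]) auto
  qed
qed

lemma band_local: "locally_on_strip isometric_map band s"
proof -
  obtain k t where s: "s = t + of_int k * (2 * L)" and t: "- L \<le> t" "t < L"
    using fundamental_domain by blast
  have "locally_on_strip isometric_map band t"
    using local_fundamental[of t] local_flip[of "- t"] local_fundamental[of "- t"] t by (cases "0 \<le> t") auto
  then show ?thesis unfolding s by (rule local_deck)
qed

lemma band_derivative:
  assumes "p \<in> moebius_strip" and F: "\<And>p. p \<in> moebius_strip \<Longrightarrow> F p = band p"
  shows "\<And>v w. frechet_derivative F (at p within moebius_strip) v \<bullet> frechet_derivative F (at p within moebius_strip) w = v \<bullet> w"
    and "inj (frechet_derivative F (at p within moebius_strip))"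
proof -
  obtain s y where p: "p = (s, y)" by force
  then have y: "y \<in> {0..1}" using assms(1) by (simp add: moebius_strip_def)
  obtain l r g where g: "l < s" "s < r" "isometric_map g" "\<And>x y. x \<in> {l<..<r} \<Longrightarrow> y \<in> {0..1} \<Longrightarrow> band (x, y) = g (x, y)"
    using band_local[of s] unfolding locally_on_strip_def by blast
  obtain D where D: "(g has_derivative D) (at (s, y))" "\<And>v w. D v \<bullet> D w = v \<bullet> w"
    using g(3) unfolding isometric_map_def by blast
  have "(F has_derivative D) (at (s, y) within moebius_strip)"
    using g(4) F by (intro has_derivative_local[OF D(1) g(1,2) y]) (auto simp: moebius_strip_def)
  then have eq: "frechet_derivative F (at p within moebius_strip) = D"
    using assms(1) unfolding p by (intro strip_unique_derivative)
  show i: "frechet_derivative F (at p within moebius_strip) v \<bullet> frechet_derivative F (at p within moebius_strip) w = v \<bullet> w" for v w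
    by (simp only: eq D)
  have lin: "linear D" using D(1) has_derivative_linear by blast
  show "inj (frechet_derivative F (at p within moebius_strip))"
    unfolding eq linear_injective_0[OF lin]
    using D(2) by (metis inner_eq_zero_iff inner_zero_left)
qed

section \<open>Injectivity of the band\<close>

lemma FD_z_ge: "h \<le> 2 * h - len / 2 * Z m"
proof -
  have "len * Z m \<le> len * height" using Z_range(2)[of m] len by (intro mult_left_mono) auto
  then show ?thesis using h2 by (simp add: mult.commute)
qed

text \<open>Half of the band lies in \<open>z \<ge> 0\<close> and its flip in
  \<open>z \<le> 0\<close>; the zero set of \<open>z\<close> is therefore the only place where the
  two can meet.\<close>

lemma half_band_z: "0 \<le> s \<Longrightarrow> s \<le> L \<Longrightarrow> 0 \<le> half_band (s, y) $ 3"
  "0 \<le> s \<Longrightarrow> s \<le> L \<Longrightarrow> half_band (s, y) $ 3 = 0 \<Longrightarrow> s \<le> a \<or> s = L"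
proof -
  assume s: "0 \<le> s" "s \<le> L"
  have zT: "h - len * Z ((s - s1) / len) \<ge> 0 \<and> (h - len * Z ((s - s1) / len) = 0 \<longrightarrow> s = L)" if "s1 \<le> s"
  proof -
    have le: "(s - s1) / len \<le> 1 / 2" using s len by (simp add: L_def field_simps)
    then have 1: "len * Z ((s - s1) / len) \<le> len * (height / 2)"
      using Z_mono[OF le] len Z_half by (intro mult_left_mono) auto
    have "len * Z ((s - s1) / len) < len * (height / 2)" if "s \<noteq> L"
    proof -
      have "(s - s1) / len < 1 / 2" using that s len by (simp add: L_def field_simps)
      then show ?thesis using Z_strict_mono[of "(s - s1) / len" "1 / 2"] \<open>s1 \<le> s\<close> len Z_half by simp
    qed
    moreover have "len * (height / 2) = h" by (simp add: h_def)
    ultimately show ?thesis using 1 by force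
  qed
  note zD = FD_z_ge
  have zA: "0 \<le> len * Z m" for m using len Z_range by simp
  show "0 \<le> half_band (s, y) $ 3"
    using zT zD[of "(s - s0 - y) / (2 * \<delta>)"] h_pos zA by (auto simp: half_band_def FA_def FD_def FT_def Let_def)
  assume 0: "half_band (s, y) $ 3 = 0"
  show "s \<le> a \<or> s = L"
  proof (rule ccontr)
    assume n: "\<not> (s \<le> a \<or> s = L)"
    then have "0 < Z ((s - a) / len)"
      using Z_strict_mono[of 0 "min 1 ((s - a) / len)"] Z_mono[of "min 1 ((s - a) / len)" "(s - a) / len"] len start by auto
    then show False using 0 n zT zD[of "(s - s0 - y) / (2 * \<delta>)"] h_pos len
      by (auto simp: half_band_def FA_def FD_def FT_def Let_def split: if_splits)
  qed
qed

lemma inj_FA: "FA (s, y) = FA (s', y') \<Longrightarrow> s = s' \<and> y = y'"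
proof -
  assume "FA (s, y) = FA (s', y')"
  then have "X ((s - a) / len) = X ((s' - a) / len)" "Z ((s - a) / len) = Z ((s' - a) / len)" "y = y'"
    using len by (auto simp: FA_def vec3_eq_iff)
  with uturn_inj[OF this(1,2)] show ?thesis using len by simp
qed

lemma inj_FT: "FT (s, y) = FT (s', y') \<Longrightarrow> s = s' \<and> y = y'"
proof -
  assume "FT (s, y) = FT (s', y')"
  then have "X ((s - s1) / len) = X ((s' - s1) / len)" "Z ((s - s1) / len) = Z ((s' - s1) / len)" "y = y'"
    using len by (auto simp: FT_def vec3_eq_iff)
  with uturn_inj[OF this(1,2)] show ?thesis using len by simp
qed

lemma inj_FD: "FD (s, y) = FD (s', y') \<Longrightarrow> s = s' \<and> y = y'"
proof -
  let ?m = "(s - s0 - y) / (2 * \<delta>)" and ?m' = "(s' - s0 - y') / (2 * \<delta>)"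
  assume "FD (s, y) = FD (s', y')"
  then have *: "(s - s0 + y) / 2 + \<delta> * X ?m = (s' - s0 + y') / 2 + \<delta> * X ?m'"
    "(s - s0 + y) / 2 - \<delta> * X ?m = (s' - s0 + y') / 2 - \<delta> * X ?m'" "Z ?m = Z ?m'"
    using len by (auto simp: FD_def Let_def vec3_eq_iff)
  then have "\<delta> * X ?m = \<delta> * X ?m'" "(s - s0 + y) / 2 = (s' - s0 + y') / 2" by linarith+
  then have "\<delta> * X ?m = \<delta> * X ?m'" "s + y = s' + y'" by simp_all
  then have "X ?m = X ?m'" using \<delta> by simp
  from uturn_inj[OF this *(3)] have "s - y = s' - y'" using \<delta> by simp
  with \<open>s + y = s' + y'\<close> show ?thesis by linarith
qed

lemma FA_x_le: "a \<le> s \<Longrightarrow> s \<le> s0 \<Longrightarrow> FA (s, y) $ 1 \<le> \<delta> - a \<and> (FA (s, y) $ 1 = \<delta> - a \<longrightarrow> s = s0)"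
proof -
  assume s: "a \<le> s" "s \<le> s0"
  show ?thesis
  proof (cases "s \<le> a + len")
    case True
    then have "0 \<le> X ((s - a) / len)" using s len by (intro X_nonneg) auto
    then have "0 \<le> len * X ((s - a) / len)" using len by simp
    then show ?thesis using \<delta> by (simp add: FA_def)
  next
    case False
    then show ?thesis using s FA_eq(2)[of s y] by simp
  qed
qed

lemma FD_x_ge: "s0 \<le> s \<Longrightarrow> y \<in> {0..1} \<Longrightarrow> \<delta> - a \<le> FD (s, y) $ 1"
proof -
  assume s: "s0 \<le> s" and y: "y \<in> {0..1}"
  consider "s - s0 \<le> y" | "y < s - s0" "s - s0 < y + 2 * \<delta>" | "y + 2 * \<delta> \<le> s - s0" by linarith
  then show ?thesis
  proof cases
    case 2
    then have "0 \<le> X ((s - s0 - y) / (2 * \<delta>))" using \<delta> by (intro X_nonneg) (auto simp: field_simps)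
    then have "0 \<le> \<delta> * X ((s - s0 - y) / (2 * \<delta>))" using \<delta> by simp
    then show ?thesis using s y by (simp add: FD_def Let_def)
  qed (use s y \<delta> FD_eq[of s y] FD_eq(2)[of y s] in \<open>auto simp: a_def\<close>)
qed

lemma FD_y_less: "y \<in> {0..1} \<Longrightarrow> s \<le> s1 \<Longrightarrow> FD (s, y) $ 2 \<le> 1 + 2 * \<delta> \<and> (FD (s, y) $ 2 = 1 + 2 * \<delta> \<longrightarrow> s = s1)"
proof (cases "y + 2 * \<delta> \<le> s - s0")
  case True
  assume "s \<le> s1"
  then show ?thesis using FD_eq(2)[OF True] by (auto simp: s1_def)
next
  case False
  assume y: "y \<in> {0..1}"
  let ?m = "(s - s0 - y) / (2 * \<delta>)"
  have "?m \<le> 1" using False \<delta> by (simp add: field_simps)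
  from X_minus_mono[OF this] X_eq'[of 1] have "?m - X ?m \<le> 1" by simp
  then have "\<delta> * (?m - X ?m) \<le> \<delta> * 1" using \<delta> by (intro mult_left_mono) auto
  moreover have "\<delta> * ?m = (s - s0 - y) / 2" using \<delta> by simp
  ultimately have "(s - s0 - y) / 2 - \<delta> * X ?m \<le> \<delta>" by (simp only: right_diff_distrib mult_1_right)
  then have "FD (s, y) $ 2 \<le> y + \<delta>" by (simp add: FD_def Let_def field_simps)
  then show ?thesis using y \<delta> by auto
qed

lemma FT_y_ge: "s1 \<le> s \<Longrightarrow> s \<le> L \<Longrightarrow> 1 + 2 * \<delta> \<le> FT (s, y) $ 2"
proof -
  assume "s1 \<le> s" "s \<le> L"
  then have "0 \<le> X ((s - s1) / len)" using len by (intro X_nonneg) (auto simp: L_def field_simps)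
  then show ?thesis using len by (simp add: FT_def)
qed

text \<open>Each piece is injective, and different pieces are separated by a coordinate:
  \<open>FD\<close> and \<open>FT\<close> by \<open>y = 1 + 2 * \<delta>\<close>, \<open>FA\<close>
  and \<open>FT\<close> by \<open>y \<le> 1\<close>, the ground layer of \<open>FA\<close> and
  \<open>FD\<close> by \<open>z\<close>, the remainder of \<open>FA\<close> and \<open>FD\<close> by
  \<open>x = \<delta> - a\<close>.\<close>

lemma inj_half_band:
  assumes "0 \<le> s" "s \<le> L" "y \<in> {0..1}" "0 \<le> s'" "s' \<le> L" "y' \<in> {0..1}"
    and eq: "half_band (s, y) = half_band (s', y')"
  shows "s = s' \<and> y = y'"
proof -
  have AD: False if "s \<le> s0" "s0 < s'" "s' \<le> s1" "y \<in> {0..1}" "y' \<in> {0..1}" "FA (s, y) = FD (s', y')" for s s' y y'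
  proof -
    have "h \<le> FD (s', y') $ 3" using FD_z_ge by (simp add: FD_def Let_def)
    then have "FA (s, y) $ 3 \<noteq> 0" using that h_pos by auto
    then have "a \<le> s" using FA_eq(1)[of s y] by force
    with FA_x_le[of s y] FD_x_ge[of s' y'] that have "s = s0" by auto
    moreover have "FA (s0, y) = FD (s0, y)"
      using FA_eq(2)[of s0 y] FD_eq(1)[of s0 y] that \<delta> by (simp add: s0_def)
    ultimately show False using inj_FD[of s0 y s' y'] that by simp
  qed
  have AT: False if "s1 < s'" "s' \<le> L" "y \<in> {0..1}" "FA (s, y) = FT (s', y')" for s s' y y'
  proof -
    have "FA (s, y) $ 2 = y" by (simp add: FA_def)
    then show False using FT_y_ge[of s' y'] that \<delta> by auto
  qed
  have DT: False if "s \<le> s1" "s1 < s'" "s' \<le> L" "y \<in> {0..1}" "FD (s, y) = FT (s', y')" for s s' y y'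
  proof -
    have "s = s1" using FD_y_less[of y s] FT_y_ge[of s' y'] that by auto
    moreover have "FD (s1, y) = FT (s1, y)"
      using FD_eq(2)[of y s1] FT_eq[of s1 y] that \<delta> by (simp add: s1_def)
    ultimately show False using inj_FT[of s1 y s' y'] that by simp
  qed
  have s01: "s0 \<le> s1" using \<delta> by (simp add: s1_def)
  consider (A) "s \<le> s0" | (D) "s0 < s" "s \<le> s1" | (T) "s1 < s" by linarith
  then show ?thesis
  proof cases
    case A
    then have e: "FA (s, y) = half_band (s', y')" using eq by (simp add: half_band_def)
    consider "s' \<le> s0" | "s0 < s'" "s' \<le> s1" | "s1 < s'" by linarith
    then show ?thesis
    proof cases
      case 1 then show ?thesis using e inj_FA by (simp add: half_band_def)
    next
      case 2 then show ?thesis using e AD[of s s' y y'] A assms by (simp add: half_band_def)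
    next
      case 3 then show ?thesis using e AT[of s' y s y'] s01 assms by (simp add: half_band_def)
    qed
  next
    case D
    then have e: "FD (s, y) = half_band (s', y')" using eq by (simp add: half_band_def)
    consider "s' \<le> s0" | "s0 < s'" "s' \<le> s1" | "s1 < s'" by linarith
    then show ?thesis
    proof cases
      case 1 then show ?thesis using e AD[of s' s y' y] D assms by (simp add: half_band_def)
    next
      case 2 then show ?thesis using e inj_FD by (simp add: half_band_def)
    next
      case 3 then show ?thesis using e DT[of s s' y y'] s01 D assms by (simp add: half_band_def)
    qed
  next
    case T
    then have e: "FT (s, y) = half_band (s', y')" using eq s01 by (simp add: half_band_def)
    consider "s' \<le> s0" | "s0 < s'" "s' \<le> s1" | "s1 < s'" by linarith
    then show ?thesis
    proof cases
      case 1 then show ?thesis using e AT[of s y' s' y] T assms by (simp add: half_band_def)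
    next
      case 2 then show ?thesis using e DT[of s' s y' y] T assms by (simp add: half_band_def)
    next
      case 3 then show ?thesis using e inj_FT s01 by (simp add: half_band_def)
    qed
  qed
qed

text \<open>A common point of the two halves has \<open>z = 0\<close>, so it lies on the middle
  layer or at \<open>s = L\<close>; these differ in the \<open>y\<close>-coordinate.\<close>

lemma inj_band_domain:
  assumes "- L \<le> s" "s < L" "y \<in> {0..1}" "- L \<le> s'" "s' < L" "y' \<in> {0..1}"
    and eq: "band (s, y) = band (s', y')"
  shows "s = s' \<and> y = y'"
proof -
  have mixed: "s = s' \<and> y = y'" if "0 \<le> s" "s < L" "y \<in> {0..1}" "- L \<le> s'" "s' < 0" "y' \<in> {0..1}"
    "band (s, y) = band (s', y')" for s y s' y'
  proof -
    have e: "half_band (s, y) = flip (half_band (- s', y'))"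
      using that band_pos[of s y] band_neg[of s' y'] by simp
    then have "half_band (s, y) $ 3 = - (half_band (- s', y') $ 3)" by (simp add: flip_def)
    with half_band_z(1)[of s y] half_band_z(1)[of "- s'" y'] that
    have z: "half_band (s, y) $ 3 = 0" "half_band (- s', y') $ 3 = 0" by auto
    from half_band_z(2)[OF _ _ z(1)] that have "s \<le> a" by auto
    then have s: "half_band (s, y) = vector [- s, y, 0]" using \<delta> len by (simp add: half_band_def FA_eq s0_def)
    from half_band_z(2)[OF _ _ z(2)] that have "- s' \<le> a \<or> - s' = L" by auto
    then show ?thesis
    proof
      assume "- s' \<le> a"
      then have "half_band (- s', y') = vector [s', y', 0]" using \<delta> len by (simp add: half_band_def FA_eq s0_def)
      then show ?thesis using e s by (simp add: flip_def vec3_eq_iff)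
    next
      assume L: "- s' = L"
      then have "half_band (s, y) $ 2 = FT (L, y') $ 2" using e by (simp add: half_band_L flip_def)
      then show ?thesis using FT_y_ge[of L y'] s that \<delta> len by (simp add: L_def)
    qed
  qed
  show ?thesis
  proof (cases "0 \<le> s"; cases "0 \<le> s'")
    assume "0 \<le> s" "0 \<le> s'"
    then show ?thesis using assms band_pos[of s y] band_pos[of s' y'] by (intro inj_half_band) auto
  next
    assume "0 \<le> s" "\<not> 0 \<le> s'"
    then show ?thesis using mixed[of s y s' y'] assms by simp
  next
    assume "\<not> 0 \<le> s" "0 \<le> s'"
    then show ?thesis using mixed[of s' y' s y] assms by simp
  next
    assume n: "\<not> 0 \<le> s" "\<not> 0 \<le> s'"
    then have "half_band (- s, y) = half_band (- s', y')"
      using eq assms band_neg[of s y] band_neg[of s' y'] by (simp add: flip_eq_iff)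
    then have "- s = - s' \<and> y = y'" using assms n by (intro inj_half_band) auto
    then show ?thesis by simp
  qed
qed

lemma inj_band:
  assumes "y \<in> {0..1}" "y' \<in> {0..1}" "band (s, y) = band (s', y')"
  obtains k where "s' = s + of_int k * (2 * L)" "y' = tw k y"
proof -
  obtain k t where s: "s = t + of_int k * (2 * L)" and t: "- L \<le> t" "t < L" using fundamental_domain by blast
  obtain k' t' where s': "s' = t' + of_int k' * (2 * L)" and t': "- L \<le> t'" "t' < L" using fundamental_domain by blast
  have "band (t, tw k y) = band (t', tw k' y')"
    using band_deck[of t k "tw k y"] band_deck[of t' k' "tw k' y'"] assms(3) by (simp add: s s' tw_tw) (simp add: tw_def)
  then have "t = t' \<and> tw k y = tw k' y'"
    using t t' assms tw_range by (intro inj_band_domain) auto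
  then have "s' = s + of_int (k' - k) * (2 * L)" "y' = tw (k' - k) y"
    by (auto simp: s s' tw_def algebra_simps split: if_splits)
  then show ?thesis using that by blast
qed

section \<open>Descent to the Moebius band\<close>

definition lam :: real where "lam = 2 * L"

lemma lam_pos: "0 < lam" and lam_le: "lam \<le> 3 + 21 * \<delta>"
  using L_pos len by (simp_all add: lam_def L_def s1_def s0_def a_def)

definition embed :: "(real \<times> real) set \<Rightarrow> real ^ 3" where
  "embed c = band (SOME p. p \<in> c)"

lemma tw_twice: "tw k (tw k y) = y"
  by (simp add: tw_def)

lemma band_reduce: "band (s - of_int k * lam, tw k y) = band (s, y)"
  using band_deck[of "s - of_int k * lam" k "tw k y"] by (simp add: lam_def tw_twice)

lemma reduce_range: "0 \<le> s - of_int \<lfloor>s / lam\<rfloor> * lam" "s - of_int \<lfloor>s / lam\<rfloor> * lam \<le> lam"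
proof -
  have "of_int \<lfloor>s / lam\<rfloor> \<le> s / lam" "s / lam < of_int \<lfloor>s / lam\<rfloor> + 1" by linarith+
  then have "0 \<le> (s / lam - of_int \<lfloor>s / lam\<rfloor>) * lam" "0 \<le> (of_int \<lfloor>s / lam\<rfloor> + 1 - s / lam) * lam"
    using lam_pos by (intro mult_nonneg_nonneg; linarith)+
  moreover have "s / lam * lam = s" using lam_pos by simp
  ultimately show "0 \<le> s - of_int \<lfloor>s / lam\<rfloor> * lam" "s - of_int \<lfloor>s / lam\<rfloor> * lam \<le> lam"
    by (simp_all only: left_diff_distrib distrib_right)
qed

lemma band_eq_iff_related:
  assumes "p \<in> moebius_rect lam" "q \<in> moebius_rect lam"
  shows "band p = band q \<longleftrightarrow> (p, q) \<in> moebius_rel lam"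
proof
  assume "(p, q) \<in> moebius_rel lam"
  moreover have "band (0, y) = band (lam, 1 - y)" for y
    using band_deck[of 0 1 y] by (simp add: lam_def tw_def)
  ultimately show "band p = band q" by (auto simp: moebius_rel_def)
next
  assume eq: "band p = band q"
  obtain s y s' y' where pq: "p = (s, y)" "q = (s', y')" by force
  have r: "0 \<le> s" "s \<le> lam" "0 \<le> s'" "s' \<le> lam" "y \<in> {0..1}" "y' \<in> {0..1}"
    using assms by (auto simp: pq moebius_rect_def)
  obtain k where k: "s' = s + of_int k * lam" "y' = tw k y"
    using inj_band[OF r(5,6)] eq unfolding pq lam_def by metis
  have "\<bar>of_int k * lam\<bar> \<le> 1 * lam" using k r by auto
  then have "\<bar>real_of_int k\<bar> \<le> 1" using lam_pos unfolding abs_mult by (simp add: mult_le_cancel_right1)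
  then have "\<bar>k\<bar> \<le> 1" by linarith
  then consider "k = 0" | "k = 1" | "k = - 1" by linarith
  then show "(p, q) \<in> moebius_rel lam"
  proof cases
    case 2
    then have "s = 0" "s' = lam" using k r by auto
    moreover have "y' = 1 - y" using 2 k by (simp add: tw_def)
    ultimately show ?thesis using assms unfolding moebius_rel_def pq by blast
  next
    case 3
    then have "s' = 0" "s = lam" using k r by auto
    moreover have "y = 1 - y'" using 3 k by (simp add: tw_def)
    ultimately show ?thesis using assms unfolding moebius_rel_def pq by blast
  qed (use assms k in \<open>simp add: moebius_rel_def pq tw_def\<close>)
qed

lemma embed_class: "p \<in> moebius_rect lam \<Longrightarrow> embed (moebius_rel lam `` {p}) = band p"
proof -
  assume p: "p \<in> moebius_rect lam"
  then have "p \<in> moebius_rel lam `` {p}" by (simp add: moebius_rel_def)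
  then have "(SOME q. q \<in> moebius_rel lam `` {p}) \<in> moebius_rel lam `` {p}" by (rule someI)
  then have "(p, SOME q. q \<in> moebius_rel lam `` {p}) \<in> moebius_rel lam" by blast
  moreover then have "(SOME q. q \<in> moebius_rel lam `` {p}) \<in> moebius_rect lam" by (auto simp: moebius_rel_def)
  ultimately show ?thesis using band_eq_iff_related[OF p] unfolding embed_def by metis
qed

lemma embed_cover: "p \<in> moebius_strip \<Longrightarrow> (embed \<circ> moebius_cover lam) p = band p"
proof -
  assume p: "p \<in> moebius_strip"
  obtain s y where py: "p = (s, y)" by force
  then have y: "y \<in> {0..1}" using p by (simp add: moebius_strip_def)
  let ?k = "\<lfloor>s / lam\<rfloor>"
  have "(s - of_int ?k * lam, tw ?k y) \<in> moebius_rect lam"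
    using y tw_range[of ?k y] reduce_range[of s] by (simp add: moebius_rect_def)
  then have "embed (moebius_cover lam p) = band (s - of_int ?k * lam, tw ?k y)"
    using embed_class by (simp add: moebius_cover_def py tw_def)
  also have "\<dots> = band (s, y)"
    by (rule band_reduce)
  finally show ?thesis by (simp add: py)
qed

lemma paper_moebius_band_embed: "paper_moebius_band lam embed"
proof -
  let ?F = "embed \<circ> moebius_cover lam"
  have "locally_on_strip smooth_map ?F s" for s
  proof -
    obtain l r g where g: "l < s" "s < r" "isometric_map g" "\<And>x y. x \<in> {l<..<r} \<Longrightarrow> y \<in> {0..1} \<Longrightarrow> band (x, y) = g (x, y)"
      using band_local[of s] unfolding locally_on_strip_def by blast
    moreover have "?F (x, y) = band (x, y)" if "y \<in> {0..1}" for x y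
      using that by (intro embed_cover) (simp add: moebius_strip_def)
    moreover have "smooth_map g" using g(3) by (simp add: isometric_map_def)
    ultimately show ?thesis unfolding locally_on_strip_def by metis
  qed
  then have "smooth_on moebius_strip ?F" by (rule smooth_on_strip)
  moreover have "inj_on embed (moebius_band lam)"
  proof (rule inj_onI)
    fix c d assume "c \<in> moebius_band lam" "d \<in> moebius_band lam" and eq: "embed c = embed d"
    then obtain p q where p: "p \<in> moebius_rect lam" "c = moebius_rel lam `` {p}"
      and q: "q \<in> moebius_rect lam" "d = moebius_rel lam `` {q}"
      unfolding moebius_band_def by (auto elim!: quotientE)
    then have "(p, q) \<in> moebius_rel lam"
      using eq embed_class band_eq_iff_related by simp
    then show "c = d" using equiv_class_eq[OF equiv_moebius_rel[OF lam_pos]] p q by simp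
  qed
  ultimately show ?thesis
    unfolding paper_moebius_band_def Let_def
    using band_derivative[OF _ embed_cover] by blast
qed

section \<open>The boundary curve is a knot\<close>

text \<open>One edge of the infinite strip covers the whole boundary, because a deck transformation
  carries the edge \<open>y = 1\<close> to the edge \<open>y = 0\<close>; its period is
  \<open>2 * lam\<close>.\<close>

definition bdry :: "(real ^ 3) set" where
  "bdry = range (\<lambda>s. band (s, 0))"

lemma band_1: "band (s, 1) = band (s + lam, 0)"
  using band_deck[of s 1 1] by (simp add: lam_def tw_def)

lemma in_bdry: "y = 0 \<or> y = 1 \<Longrightarrow> band (s, y) \<in> bdry"
  using band_1 by (auto simp: bdry_def)

lemma image_boundary: "embed ` moebius_boundary lam = bdry"
proof
  have "embed (moebius_rel lam `` {p}) \<in> bdry" if p: "p \<in> {0..lam} \<times> {0, 1}" for p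
  proof -
    have "p \<in> moebius_rect lam" using p by (auto simp: moebius_rect_def)
    moreover have "p = (fst p, 0) \<or> p = (fst p, 1)" using p by (auto simp: prod_eq_iff)
    ultimately show ?thesis using embed_class[of p] in_bdry by metis
  qed
  then show "embed ` moebius_boundary lam \<subseteq> bdry" by (auto simp: moebius_boundary_def)
  show "bdry \<subseteq> embed ` moebius_boundary lam"
  proof
    fix x assume "x \<in> bdry"
    then obtain s where x: "x = band (s, 0)" by (auto simp: bdry_def)
    let ?k = "\<lfloor>s / lam\<rfloor>"
    note * = reduce_range[of s]
    let ?p = "(s - of_int ?k * lam, tw ?k 0)"
    have p: "?p \<in> {0..lam} \<times> {0, 1}" using * by (simp add: tw_def)
    then have "?p \<in> moebius_rect lam" by (auto simp: moebius_rect_def)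
    moreover have "band ?p = band (s, 0)"
      by (rule band_reduce)
    ultimately have "x = embed (moebius_rel lam `` {?p})" using embed_class x by simp
    then show "x \<in> embed ` moebius_boundary lam" using p unfolding moebius_boundary_def by blast
  qed
qed

lemma continuous_band: "continuous_on moebius_strip band"
proof -
  have "locally_on_strip smooth_map band s" for s
    using band_local[of s] unfolding locally_on_strip_def isometric_map_def by blast
  then have "smooth_on moebius_strip band" by (rule smooth_on_strip)
  then have "Ck_on 0 moebius_strip band" unfolding smooth_on_def by blast
  then show ?thesis by simp
qed

lemma continuous_edge: "y \<in> {0..1} \<Longrightarrow> continuous_on S (\<lambda>s. band (s, y))"
  by (rule continuous_on_compose2[OF continuous_band]) (auto intro!: continuous_intros simp: moebius_strip_def)

lemma knot_bdry: "knot bdry"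
proof -
  define g where "g = (\<lambda>t. band (2 * lam * t, 0))"
  have per: "band (s + of_int k * (2 * lam), 0) = band (s, 0)" for s k
    using band_deck[of s "2 * k" 0] by (simp add: lam_def tw_def algebra_simps)
  have "path g"
    unfolding g_def path_def
    by (rule continuous_on_compose2[OF continuous_edge[of 0 UNIV]]) (auto intro!: continuous_intros)
  moreover have "loop_free g"
    unfolding loop_free_def
  proof (intro ballI impI)
    fix t u :: real assume tu: "t \<in> {0..1}" "u \<in> {0..1}" and "g t = g u"
    then obtain k where k: "2 * lam * u = 2 * lam * t + of_int k * lam" "0 = tw k 0"
      using inj_band[of 0 0 "2 * lam * t" "2 * lam * u"] unfolding g_def lam_def by auto
    \<comment> \<open>An odd translate would land on the other edge; the boundary closes up only
      after two passages around the band.\<close>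
    then have "even k" by (auto simp: tw_def split: if_splits)
    then obtain j where j: "k = 2 * j" by blast
    then have "2 * lam * u = 2 * lam * (t + of_int j)" using k by (simp add: algebra_simps)
    then have u: "u = t + of_int j" using lam_pos by simp
    then have "\<bar>j\<bar> \<le> 1" using tu by auto
    then consider "j = 0" | "j = 1" | "j = - 1" by linarith
    then show "t = u \<or> t = 0 \<and> u = 1 \<or> t = 1 \<and> u = 0"
      using u tu by cases auto
  qed
  moreover have "pathfinish g = pathstart g"
    using per[of 0 1] by (simp add: g_def pathfinish_def pathstart_def)
  moreover have "path_image g = bdry"
  proof
    show "path_image g \<subseteq> bdry" by (auto simp: path_image_def g_def bdry_def)
    show "bdry \<subseteq> path_image g"
    proof
      fix x assume "x \<in> bdry"
      then obtain s where x: "x = band (s, 0)" by (auto simp: bdry_def)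
      let ?k = "\<lfloor>s / (2 * lam)\<rfloor>" and ?t = "frac (s / (2 * lam))"
      have "s = 2 * lam * ?t + of_int ?k * (2 * lam)"
        using lam_pos by (simp add: frac_def field_simps)
      then have "x = g ?t" using per[of "2 * lam * ?t" ?k] by (simp add: x g_def)
      moreover have "?t \<in> {0..1}" using frac_lt_1[of "s / (2 * lam)"] by (auto intro: less_imp_le)
      ultimately show "x \<in> path_image g" unfolding path_image_def by blast
    qed
  qed
  ultimately show ?thesis unfolding knot_def simple_path_def by blast
qed

end

section \<open>The boundary as a closed braid\<close>

lemma inverse_of_strict_antimono:
  fixes g :: "real \<Rightarrow> real"
  assumes g: "continuous_on {p..q} g" and anti: "strict_antimono_on {p..q} g" and "p \<le> q"
  obtains i where "continuous_on {g q..g p} i" "\<And>t. t \<in> {g q..g p} \<Longrightarrow> i t \<in> {p..q} \<and> g (i t) = t"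
    "\<And>x. x \<in> {p..q} \<Longrightarrow> i (g x) = x"
proof -
  have mono: "g y \<le> g x" if "p \<le> x" "x \<le> y" "y \<le> q" for x y
    using monotone_onD[OF anti, of x y] that by (cases "x = y") auto
  have im: "g ` {p..q} = {g q..g p}"
  proof
    show "g ` {p..q} \<subseteq> {g q..g p}" using mono \<open>p \<le> q\<close> by auto
    show "{g q..g p} \<subseteq> g ` {p..q}"
    proof
      fix t assume "t \<in> {g q..g p}"
      then show "t \<in> g ` {p..q}" using IVT2'[of g q t p] g \<open>p \<le> q\<close> by force
    qed
  qed
  have "inj_on g {p..q}"
  proof (rule inj_onI)
    fix x y assume "x \<in> {p..q}" "y \<in> {p..q}" "g x = g y"
    then show "x = y" using monotone_onD[OF anti, of x y] monotone_onD[OF anti, of y x] by (cases x y rule: linorder_cases) auto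
  qed
  then obtain i where "homeomorphism {p..q} {g q..g p} g i"
    using homeomorphism_compact[OF compact_Icc g im] by blast
  then have i: "\<And>x. x \<in> {p..q} \<Longrightarrow> i (g x) = x" "\<And>t. t \<in> {g q..g p} \<Longrightarrow> g (i t) = t"
    "i ` {g q..g p} = {p..q}" "continuous_on {g q..g p} i"
    unfolding homeomorphism_def by blast+
  show ?thesis
    by (rule that[OF i(4) _ i(1)]) (use i(2,3) in blast)+
qed

text \<open>Near \<open>q\<close>, where \<open>f\<close> may vanish, the bound is given; on
  \<open>[p, r]\<close> the minimum of \<open>f\<close> is positive and \<open>g\<close> is bounded.
  The 1 added to the maximum of \<open>g\<close> guards against division by 0.\<close>

lemma compact_linear_bound:
  fixes f g :: "real \<Rightarrow> real"
  assumes f: "continuous_on {p..q} f" and g: "continuous_on {p..q} g" and "p \<le> q"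
    and pos: "\<And>s. p \<le> s \<Longrightarrow> s < q \<Longrightarrow> 0 < f s" and g0: "\<And>s. s \<in> {p..q} \<Longrightarrow> 0 \<le> g s"
    and near: "0 < k" "r < q" "\<And>s. r \<le> s \<Longrightarrow> p \<le> s \<Longrightarrow> s \<le> q \<Longrightarrow> k * g s \<le> f s"
  obtains c where "0 < c" "\<And>s. s \<in> {p..q} \<Longrightarrow> c * g s \<le> f s"
proof (cases "p \<le> r")
  case True
  have c: "continuous_on {p..r} f" "continuous_on {p..r} g"
    using f g near by (auto intro: continuous_on_subset)
  obtain m where m: "m \<in> {p..r}" "\<And>s. s \<in> {p..r} \<Longrightarrow> f m \<le> f s"
    using continuous_attains_inf[OF compact_Icc _ c(1)] True by auto
  obtain M where M: "M \<in> {p..r}" "\<And>s. s \<in> {p..r} \<Longrightarrow> g s \<le> g M"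
    using continuous_attains_sup[OF compact_Icc _ c(2)] True by auto
  have fm: "0 < f m" using pos m near by auto
  have gM: "0 \<le> g M" using g0[of M] M near by auto
  define d where "d = min k (f m / (g M + 1))"
  have d: "0 < d" "d \<le> k" "d \<le> f m / (g M + 1)" using fm gM near by (auto simp: d_def)
  have "d * g s \<le> f s" if s: "s \<in> {p..q}" for s
  proof (cases "s \<le> r")
    case True
    then have "d * g s \<le> f m / (g M + 1) * (g M + 1)"
      using d M(2)[of s] gM fm g0[of s] s by (intro mult_mono) auto
    also have "\<dots> = f m" using gM by simp
    also have "\<dots> \<le> f s" using m True s by auto
    finally show ?thesis .
  next
    case False
    have "d * g s \<le> k * g s" using d g0[OF s] by (intro mult_right_mono) auto
    also have "\<dots> \<le> f s" using False s by (intro near) auto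
    finally show ?thesis .
  qed
  with d that show ?thesis by blast
next
  case False
  then show ?thesis using that[of k] near by auto
qed

context crisscross
begin

text \<open>The height \<open>\<zeta>\<close> is \<open>z\<close>, perturbed so that it becomes strictly monotone on the boundary also where the
  band is horizontal: \<open>\<eta> * x\<close> takes care of the parts running in the \<open>x\<close>-direction, the \<open>shear\<close> term
  of those running in the \<open>y\<close>-direction.\<close>

definition \<eta> :: real where "\<eta> = h * \<delta> / 64"

definition ramp :: "real \<Rightarrow> real" where "ramp x = max 0 (min 1 x)"

text \<open>Equal to 1 for \<open>z \<ge> 3 / 4 * h\<close> and \<open>x \<ge> \<delta> - a\<close>,
  and to 0 for \<open>z \<le> h / 2\<close> or \<open>x \<le> - a\<close>. So it acts on the
  diagonal fold but leaves the first fold alone. \<open>\<zeta>\<close> contains it antisymmetrised,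
  which makes \<open>\<zeta>\<close> odd under \<open>flip\<close>.\<close>

definition shear :: "real ^ 3 \<Rightarrow> real" where
  "shear p = ramp (4 * (p $ 3) / h - 2) * ramp ((p $ 1 + a) / \<delta>)"

definition \<zeta> :: "real ^ 3 \<Rightarrow> real" where
  "\<zeta> p = p $ 3 - \<eta> * (p $ 1 + max 0 (min 3 (p $ 2)) * (shear p - shear (flip p)))"

definition \<tau> :: "real \<Rightarrow> real" where "\<tau> z = max (-1) (min 1 (4 * z / h))"

definition tilt :: "real \<Rightarrow> real" where "tilt t = Z t + \<eta> * X t"

section \<open>The perturbed height and its monotonicity\<close>

lemma ramp: "0 \<le> ramp x" "ramp x \<le> 1" "x \<le> 0 \<Longrightarrow> ramp x = 0" "1 \<le> x \<Longrightarrow> ramp x = 1" "x \<le> y \<Longrightarrow> ramp x \<le> ramp y"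
  by (auto simp: ramp_def)

lemma ramp_lipschitz: "x \<le> y \<Longrightarrow> ramp y - ramp x \<le> y - x"
  by (auto simp: ramp_def)

lemma flip_nth: "flip p $ 1 = - p $ 1" "flip p $ 2 = p $ 2" "flip p $ 3 = - p $ 3"
  by (simp_all add: flip_def)

lemma \<zeta>_flip: "\<zeta> (flip p) = - \<zeta> p"
  by (simp add: \<zeta>_def flip_nth algebra_simps)

lemma \<tau>_minus: "\<tau> (- z) = - \<tau> z"
  by (simp add: \<tau>_def max_def min_def)

lemma height_le: "height \<le> 1"
proof -
  have "\<exists>z. 0 < z \<and> z < 1 \<and> Z 1 - Z 0 = (1 - 0) * sin (\<Theta> z)"
    by (rule MVT2) (auto intro: deriv)
  then show ?thesis using start by (auto simp: height_def)
qed

text \<open>The perturbation is small against all scales in play: below \<open>h / 2560\<close> it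
  cannot interchange layers, and the exact value turns \<open>z \<le> 4 * \<eta>\<close> into
  \<open>\<tau> z \<le> \<delta> / 4\<close>.\<close>

lemma \<eta>: "0 < \<eta>" "\<eta> \<le> h / 2560" "\<eta> * 64 = h * \<delta>" "\<eta> \<le> 1 / 1000" "\<eta> \<le> len / 1000" "\<eta> \<le> height / 1000"
proof -
  show "0 < \<eta>" "\<eta> * 64 = h * \<delta>" using h_pos \<delta> by (simp_all add: \<eta>_def)
  have "h * \<delta> \<le> h * (1 / 40)" using h_pos \<delta> by (intro mult_left_mono) auto
  then show e: "\<eta> \<le> h / 2560" by (simp add: \<eta>_def mult.commute)
  have l1: "len \<le> 3 / 40" using len \<delta> by linarith
  have "height * len \<le> 1 * len" using height_le len by (intro mult_right_mono) auto
  then have hl: "h \<le> len / 2" by (simp add: h_def)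
  then show "\<eta> \<le> len / 1000" "\<eta> \<le> 1 / 1000" using e l1 len by linarith+
  have "height * len \<le> height * 1" using height_pos l1 by (intro mult_left_mono) auto
  then have "h \<le> height / 2" by (simp add: h_def)
  then show "\<eta> \<le> height / 1000" using e height_pos by linarith
qed

lemma tilt_deriv: "(tilt has_real_derivative sin (\<Theta> t) + \<eta> * cos (\<Theta> t)) (at t)"
  unfolding tilt_def by (rule DERIV_add[OF deriv(2) DERIV_cmult[OF deriv(1)]])

lemma continuous_tilt: "continuous_on S tilt"
  using DERIV_isCont[OF tilt_deriv] by (auto intro: continuous_at_imp_continuous_on)

text \<open>Rotating by \<open>arctan \<eta>\<close> makes the derivative of \<open>tilt\<close> a
  positive multiple of a sine, so its sign changes where the angle passes
  \<open>pi - arctan \<eta>\<close>.\<close>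

lemma tilt_speed: "cos (arctan \<eta>) * (sin (\<Theta> t) + \<eta> * cos (\<Theta> t)) = sin (\<Theta> t + arctan \<eta>)" "0 < cos (arctan \<eta>)"
proof -
  show c: "0 < cos (arctan \<eta>)" by (intro cos_gt_zero_pi arctan_lbound arctan_ubound)
  have "\<eta> = sin (arctan \<eta>) / cos (arctan \<eta>)" using tan_arctan[of \<eta>] by (simp add: tan_def)
  then have "\<eta> * cos (arctan \<eta>) = sin (arctan \<eta>)" using c by (simp add: field_simps)
  then show "cos (arctan \<eta>) * (sin (\<Theta> t) + \<eta> * cos (\<Theta> t)) = sin (\<Theta> t + arctan \<eta>)"
    by (simp add: sin_add algebra_simps)
qed

lemma arctan_\<eta>: "0 < arctan \<eta>" "arctan \<eta> \<le> \<eta>"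
  using \<eta> by (simp_all add: arctan_le_self)

text \<open>The maximum of \<open>\<zeta>\<close> on the boundary is on the first fold, at the point of the U-turn where the
  tangent is orthogonal to the gradient \<open>(\<eta>, 1)\<close> of \<open>tilt\<close>.\<close>

definition tstar :: real where "tstar = (SOME t. 0 \<le> t \<and> t \<le> 1 \<and> \<Theta> t = pi - arctan \<eta>)"

lemma tstar: "1 / 2 < tstar" "tstar < 1" "\<Theta> tstar = pi - arctan \<eta>"
proof -
  have a: "arctan \<eta> < pi / 2" "0 < arctan \<eta>" using arctan_ubound arctan_\<eta> by auto
  have "\<exists>t. 0 \<le> t \<and> t \<le> 1 \<and> \<Theta> t = pi - arctan \<eta>"
  proof (rule IVT')
    show "\<Theta> 0 \<le> pi - arctan \<eta>" "pi - arctan \<eta> \<le> \<Theta> 1"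
      using a angle(1)[of 0] angle(2)[of 1] pi_gt_zero by linarith+
  qed (auto intro: continuous_on_subset[OF cont_angle])
  then have *: "0 \<le> tstar \<and> tstar \<le> 1 \<and> \<Theta> tstar = pi - arctan \<eta>"
    unfolding tstar_def by (rule someI_ex)
  then show "\<Theta> tstar = pi - arctan \<eta>" by blast
  show "1 / 2 < tstar"
    using angle_mono[of tstar "1 / 2"] * a angle_half by (cases "tstar \<le> 1 / 2") auto
  show "tstar < 1" using * a angle(2)[of 1] by (cases "tstar = 1") auto
qed

lemma tilt_increasing: "s < t \<Longrightarrow> t \<le> tstar \<Longrightarrow> tilt s < tilt t"
proof (rule DERIV_pos_imp_increasing_open[of s t tilt])
  fix x assume "t \<le> tstar" "x < t"
  have "\<Theta> x < pi - arctan \<eta>"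
  proof (cases "0 \<le> x")
    case True
    then show ?thesis using angle(3)[of x tstar] tstar \<open>t \<le> tstar\<close> \<open>x < t\<close> by simp
  next
    case False
    then show ?thesis using angle(1)[of x] arctan_ubound[of \<eta>] pi_gt_zero by (simp, linarith)
  qed
  then have "0 < sin (\<Theta> x + arctan \<eta>)"
    using angle_range(1)[of x] arctan_\<eta>(1) by (intro sin_gt_zero; linarith)
  then have "0 < sin (\<Theta> x) + \<eta> * cos (\<Theta> x)"
    using tilt_speed by (metis zero_less_mult_pos)
  with tilt_deriv[of x] show "\<exists>y. (tilt has_real_derivative y) (at x) \<and> 0 < y" by blast
qed (auto intro: continuous_tilt)

lemma tilt_decreasing: "tstar \<le> s \<Longrightarrow> s < t \<Longrightarrow> tilt t < tilt s"
proof -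
  assume st: "tstar \<le> s" "s < t"
  have "- tilt s < - tilt t"
  proof (rule DERIV_pos_imp_increasing_open[of s t "\<lambda>x. - tilt x"])
    fix x assume x: "s < x" "x < t"
    have "pi - arctan \<eta> < \<Theta> x"
    proof (cases "x \<le> 1")
      case True
      then show ?thesis using angle(3)[of tstar x] tstar x st by simp
    next
      case False
      then show ?thesis using angle(2)[of x] arctan_\<eta> by simp
    qed
    then have "sin (\<Theta> x + arctan \<eta>) < 0"
      using angle_range(2)[of x] arctan_ubound[of \<eta>] pi_gt_zero by (intro sin_lt_zero; linarith)
    then have "cos (arctan \<eta>) * (sin (\<Theta> x) + \<eta> * cos (\<Theta> x)) < 0" unfolding tilt_speed by simp
    then have "0 < - (sin (\<Theta> x) + \<eta> * cos (\<Theta> x))"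
      using tilt_speed(2) by (simp add: mult_less_0_iff)
    with DERIV_minus[OF tilt_deriv[of x]] show "\<exists>y. ((\<lambda>x. - tilt x) has_real_derivative y) (at x) \<and> 0 < y" by blast
  qed (use st in \<open>auto intro!: continuous_intros continuous_tilt\<close>)
  then show ?thesis by simp
qed

text \<open>Parameter, \<open>x\<close>-coordinate and value of the maximum of
  \<open>\<zeta>\<close>. At large height \<open>V\<close> vanishes exactly on
  \<open>x = xs\<close>.\<close>

definition smax :: real where "smax = a + len * tstar"
definition xs :: real where "xs = - a - len * X tstar"
definition \<zeta>m :: real where "\<zeta>m = len * tilt tstar + \<eta> * a"

lemma smax: "0 < smax" "a + len / 2 < smax" "smax < a + len"
proof -
  show "smax < a + len" using mult_strict_left_mono[OF tstar(2), of len] len by (simp add: smax_def)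
  show "a + len / 2 < smax" using mult_strict_left_mono[OF tstar(1), of len] len by (simp add: smax_def)
  then show "0 < smax" using \<delta> len by (simp add: a_def)
qed

lemma order: "0 < a" "smax < a + len" "a + len < s0" "s0 < s1" "s1 < L" "L < lam"
  using \<delta> len smax L_pos by (simp_all add: s0_def s1_def L_def lam_def a_def)

text \<open>Beyond \<open>tstar\<close> the angle is within \<open>arctan \<eta>\<close> of
  \<open>pi\<close>, so the curve rises by at most \<open>\<eta>\<close> until the turn is
  complete.\<close>

lemma Z_tstar: "height - \<eta> \<le> Z tstar"
proof -
  have "\<exists>z. tstar < z \<and> z < 1 \<and> Z 1 - Z tstar = (1 - tstar) * sin (\<Theta> z)"
    using tstar by (intro MVT2) (auto intro: deriv)
  then obtain z where z: "tstar < z" "z < 1" "Z 1 - Z tstar = (1 - tstar) * sin (\<Theta> z)" by blast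
  have "sin (\<Theta> z) = sin (pi - \<Theta> z)" by simp
  also have "\<dots> \<le> pi - \<Theta> z" using angle_range by (intro sin_x_le_x) auto
  also have "\<dots> \<le> \<eta>" using angle_mono[of tstar z] z tstar arctan_\<eta> by simp
  finally have "(1 - tstar) * sin (\<Theta> z) \<le> (1 - tstar) * \<eta>" using tstar by (intro mult_left_mono) auto
  also have "\<dots> \<le> 1 * \<eta>" using tstar \<eta> by (intro mult_right_mono) auto
  finally show ?thesis using z by (simp add: height_def)
qed

lemma X_le: "X t \<le> 1 / 2" "0 \<le> t \<Longrightarrow> X t \<le> t"
proof -
  show "0 \<le> t \<Longrightarrow> X t \<le> t" for t using X_minus_mono[of 0 t] start by simp
  note * = this
  show "X t \<le> 1 / 2"
  proof (cases "t \<le> 1 / 2")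
    case True
    have "X t \<le> X (1 / 2)" using X_mono[of t "1 / 2"] True by simp
    then show ?thesis using *[of "1 / 2"] by simp
  next
    case False
    have "X (1 - t) \<le> X (1 / 2)" using X_mono[of "1 - t" "1 / 2"] False by simp
    then show ?thesis using *[of "1 / 2"] X_sym[of t] by simp
  qed
qed

lemma X_strict_mono: "s < t \<Longrightarrow> t \<le> 1 / 2 \<Longrightarrow> X s < X t"
proof (rule DERIV_pos_imp_increasing_open[of s t X])
  fix x assume "t \<le> 1 / 2" "x < t"
  have "\<Theta> x < pi / 2"
  proof (cases "0 \<le> x")
    case True
    then show ?thesis using angle(3)[of x "1 / 2"] angle_half \<open>t \<le> 1 / 2\<close> \<open>x < t\<close> by simp
  qed (use angle(1)[of x] in simp)
  then have "0 < cos (\<Theta> x)" using angle_range(1)[of x] by (intro cos_gt_zero_pi) auto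
  with deriv(1)[of x] show "\<exists>y. (X has_real_derivative y) (at x) \<and> 0 < y" by blast
qed (auto intro: continuous_X)

lemma X_strict_anti: "1 / 2 \<le> s \<Longrightarrow> s < t \<Longrightarrow> X t < X s"
  using X_strict_mono[of "1 - t" "1 - s"] X_sym[of s] X_sym[of t] by simp

lemma shear_0: "p $ 1 \<le> - a \<or> p $ 3 \<le> h / 2 \<Longrightarrow> shear p = 0"
  using h_pos \<delta> ramp(3) by (auto simp: shear_def divide_le_0_iff mult_le_0_iff field_simps)

lemma \<zeta>_A: "0 \<le> s \<Longrightarrow> s \<le> a + len \<Longrightarrow> \<zeta> (FA (s, y)) = len * tilt ((s - a) / len) + \<eta> * a"
proof -
  assume s: "0 \<le> s" "s \<le> a + len"
  have "shear (FA (s, y)) = 0"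
  proof (cases "s \<le> a")
    case True
    then show ?thesis using h_pos by (intro shear_0) (simp add: FA_eq)
  next
    case False
    then have "0 \<le> X ((s - a) / len)" using s len by (intro X_nonneg) auto
    then have "0 \<le> len * X ((s - a) / len)" using len by simp
    then show ?thesis by (intro shear_0) (simp add: FA_def)
  qed
  moreover have "shear (flip (FA (s, y))) = 0"
  proof -
    have "0 \<le> len * Z ((s - a) / len)" using len Z_range by simp
    then show ?thesis using h_pos by (intro shear_0) (simp add: flip_nth FA_def)
  qed
  ultimately show ?thesis by (simp add: \<zeta>_def FA_def tilt_def algebra_simps)
qed

text \<open>Moving to larger \<open>x\<close> and \<open>y\<close> and smaller \<open>z\<close>
  lowers \<open>\<zeta>\<close>. The one opposing effect is that a drop in \<open>z\<close> reduces
  the shear; it is at most \<open>12 * \<eta> / h\<close> times the drop, less than half of it. A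
  gain in \<open>y\<close> alone is effective where the shear equals 1, hence the side
  conditions.\<close>

lemma \<zeta>_less:
  assumes x: "p $ 1 \<le> q $ 1" and y: "0 \<le> p $ 2" "p $ 2 \<le> q $ 2" "q $ 2 \<le> 3" and z: "0 \<le> q $ 3" "q $ 3 \<le> p $ 3"
    and strict: "p $ 1 < q $ 1 \<or> q $ 3 < p $ 3 \<or> (p $ 2 < q $ 2 \<and> h \<le> q $ 3 \<and> \<delta> - a \<le> q $ 1)"
  shows "\<zeta> q < \<zeta> p"
proof -
  have f0: "shear (flip p) = 0" "shear (flip q) = 0"
    using z h_pos by (intro shear_0; simp add: flip_nth)+
  define cp cq where "cp = ramp (4 * (p $ 3) / h - 2)" and "cq = ramp (4 * (q $ 3) / h - 2)"
  define wp wq where "wp = ramp ((p $ 1 + a) / \<delta>)" and "wq = ramp ((q $ 1 + a) / \<delta>)"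
  have shp: "shear p = cp * wp" "shear q = cq * wq"
    by (simp_all add: shear_def cp_def cq_def wp_def wq_def)
  have c: "0 \<le> cq" "cq \<le> cp" "cp \<le> 1" and w: "0 \<le> wp" "wp \<le> wq" "wq \<le> 1"
    using x z h_pos \<delta> by (auto simp: cp_def cq_def wp_def wq_def ramp divide_right_mono intro!: ramp(5))
  have "cp - cq \<le> (4 * (p $ 3) / h - 2) - (4 * (q $ 3) / h - 2)"
    unfolding cp_def cq_def using z h_pos by (intro ramp_lipschitz) (simp add: divide_right_mono)
  then have cl: "cp - cq \<le> 4 / h * (p $ 3 - q $ 3)" by (simp add: algebra_simps diff_divide_distrib)
  have sh: "p $ 2 * (cp * wp) - q $ 2 * (cq * wq) \<le> 3 * (cp - cq) + (p $ 2 - q $ 2) * (cq * wq)"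
  proof -
    have "p $ 2 * (cp * wp) \<le> p $ 2 * (cp * wq)" using y c w by (intro mult_left_mono) auto
    also have "\<dots> = p $ 2 * wq * (cp - cq) + p $ 2 * (cq * wq)" by (simp add: algebra_simps)
    also have "p $ 2 * wq * (cp - cq) \<le> 3 * 1 * (cp - cq)" using y c w by (intro mult_right_mono mult_mono) auto
    finally show ?thesis by (simp add: algebra_simps)
  qed
  have "\<eta> * (3 * (cp - cq)) \<le> \<eta> * (3 * (4 / h * (p $ 3 - q $ 3)))" using cl \<eta> by (intro mult_left_mono) auto
  also have "\<dots> = (12 * \<eta> / h) * (p $ 3 - q $ 3)" by simp
  also have "\<dots> \<le> 1 / 2 * (p $ 3 - q $ 3)"
    using \<eta> h_pos z by (intro mult_right_mono) (auto simp: field_simps)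
  finally have e1: "\<eta> * (3 * (cp - cq)) \<le> 1 / 2 * (p $ 3 - q $ 3)" .
  have "max 0 (min 3 (p $ 2)) = p $ 2" "max 0 (min 3 (q $ 2)) = q $ 2" using y by auto
  then have "\<zeta> p - \<zeta> q = (p $ 3 - q $ 3) + \<eta> * (q $ 1 - p $ 1) - \<eta> * (p $ 2 * (cp * wp) - q $ 2 * (cq * wq))"
    using f0 shp by (simp add: \<zeta>_def algebra_simps)
  also have "\<dots> \<ge> (p $ 3 - q $ 3) + \<eta> * (q $ 1 - p $ 1) - \<eta> * (3 * (cp - cq) + (p $ 2 - q $ 2) * (cq * wq))"
    using mult_left_mono[OF sh, of \<eta>] \<eta> by linarith
  finally have ge0: "(p $ 3 - q $ 3) + \<eta> * (q $ 1 - p $ 1) - \<eta> * (3 * (cp - cq) + (p $ 2 - q $ 2) * (cq * wq)) \<le> \<zeta> p - \<zeta> q" .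
  define A B C where "A = 1 / 2 * (p $ 3 - q $ 3)" and "B = \<eta> * (q $ 1 - p $ 1)" and "C = \<eta> * ((q $ 2 - p $ 2) * (cq * wq))"
  have "(p $ 3 - q $ 3) + \<eta> * (q $ 1 - p $ 1) - \<eta> * (3 * (cp - cq) + (p $ 2 - q $ 2) * (cq * wq))
      = 2 * A + B + C - \<eta> * (3 * (cp - cq))"
    by (simp add: A_def B_def C_def algebra_simps)
  with ge0 e1 have ge: "A + B + C \<le> \<zeta> p - \<zeta> q" unfolding A_def[symmetric] by linarith
  have nn: "0 \<le> A" "0 \<le> B" "0 \<le> C"
    using \<eta> x y z c w by (auto simp: A_def B_def C_def)
  have "0 < A \<or> 0 < B \<or> 0 < C"
    using strict
  proof (elim disjE conjE)
    assume *: "p $ 2 < q $ 2" "h \<le> q $ 3" "\<delta> - a \<le> q $ 1"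
    have "cq = 1" unfolding cq_def using * h_pos by (intro ramp(4)) (simp add: field_simps)
    moreover have "wq = 1" unfolding wq_def using * \<delta> by (intro ramp(4)) (simp add: field_simps)
    ultimately show ?thesis using * \<eta> by (simp add: C_def)
  qed (use \<eta> in \<open>simp_all add: A_def B_def\<close>)
  then show ?thesis using ge nn by linarith
qed

lemma FD_nth: "FD (s, y) $ 1 = \<delta> - a + (s - s0 + y) / 2 + \<delta> * X ((s - s0 - y) / (2 * \<delta>))"
  "FD (s, y) $ 2 = (s - s0 + y) / 2 - \<delta> * X ((s - s0 - y) / (2 * \<delta>))"
  "FD (s, y) $ 3 = 2 * h - len / 2 * Z ((s - s0 - y) / (2 * \<delta>))"
  by (simp_all add: FD_def Let_def)

text \<open>The horizontal coordinates are monotone by \<open>X_plus_mono\<close> and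
  \<open>X_minus_mono\<close>; their sum is affine in \<open>s\<close>, so at least one of them
  grows strictly.\<close>

lemma FD_mono:
  assumes "s < s'"
  shows "FD (s, y) $ 1 \<le> FD (s', y) $ 1" "FD (s, y) $ 2 \<le> FD (s', y) $ 2" "FD (s', y) $ 3 \<le> FD (s, y) $ 3"
    "FD (s, y) $ 1 < FD (s', y) $ 1 \<or> FD (s, y) $ 2 < FD (s', y) $ 2"
proof -
  let ?m = "(s - s0 - y) / (2 * \<delta>)" and ?m' = "(s' - s0 - y) / (2 * \<delta>)"
  have m: "?m \<le> ?m'" using assms \<delta> by (simp add: divide_right_mono)
  have e: "\<delta> * ?m = (s - s0 - y) / 2" "\<delta> * ?m' = (s' - s0 - y) / 2" using \<delta> by simp_all
  have "\<delta> * (?m + X ?m) \<le> \<delta> * (?m' + X ?m')" using X_plus_mono[OF m] \<delta> by (intro mult_left_mono) auto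
  then have "(s - s0 - y) / 2 + \<delta> * X ?m \<le> (s' - s0 - y) / 2 + \<delta> * X ?m'" by (simp only: distrib_left e)
  then show 1: "FD (s, y) $ 1 \<le> FD (s', y) $ 1" unfolding FD_nth by argo
  have "\<delta> * (?m - X ?m) \<le> \<delta> * (?m' - X ?m')" using X_minus_mono[OF m] \<delta> by (intro mult_left_mono) auto
  then have "(s - s0 - y) / 2 - \<delta> * X ?m \<le> (s' - s0 - y) / 2 - \<delta> * X ?m'" by (simp only: right_diff_distrib e)
  then show 2: "FD (s, y) $ 2 \<le> FD (s', y) $ 2" unfolding FD_nth by argo
  show "FD (s', y) $ 3 \<le> FD (s, y) $ 3"
    unfolding FD_nth using Z_mono[OF m] len by (simp add: mult_left_mono)
  have "FD (s, y) $ 1 + FD (s, y) $ 2 < FD (s', y) $ 1 + FD (s', y) $ 2"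
    unfolding FD_nth using assms by argo
  with 1 2 show "FD (s, y) $ 1 < FD (s', y) $ 1 \<or> FD (s, y) $ 2 < FD (s', y) $ 2" by linarith
qed

lemma half_band_D: "s0 \<le> s \<Longrightarrow> s \<le> s1 \<Longrightarrow> y \<in> {0..1} \<Longrightarrow> half_band (s, y) = FD (s, y)"
  and half_band_T: "s1 \<le> s \<Longrightarrow> y \<in> {0..1} \<Longrightarrow> half_band (s, y) = FT (s, y)"
proof -
  assume s: "s0 \<le> s" "s \<le> s1" and y: "y \<in> {0..1}"
  have "FA (s0, y) = FD (s0, y)" using FA_eq(2)[of s0 y] FD_eq(1)[of s0 y] order y by simp
  then show "half_band (s, y) = FD (s, y)" using s by (auto simp: half_band_def)
next
  assume s: "s1 \<le> s" and y: "y \<in> {0..1}"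
  have "FD (s1, y) = FT (s1, y)" using FD_eq(2)[of y s1] FT_eq[of s1 y] y \<delta> by (simp add: s1_def)
  then show "half_band (s, y) = FT (s, y)" using s order by (auto simp: half_band_def)
qed

text \<open>Past the maximum, the rest of the first U-turn is governed by \<open>tilt\<close>; from
  there on the strip runs only in directions of growing \<open>x\<close> and \<open>y\<close> and
  falling \<open>z\<close>.\<close>

lemma \<zeta>_half_band_decreasing:
  assumes "smax \<le> s" "s < s'" "s' \<le> L" "y \<in> {0..1}"
  shows "\<zeta> (half_band (s', y)) < \<zeta> (half_band (s, y))"
proof -
  let ?f = "\<lambda>s. \<zeta> (half_band (s, y))"
  have join: "?f s' < ?f s"
    if "\<And>s s'. p \<le> s \<Longrightarrow> s < s' \<Longrightarrow> s' \<le> q \<Longrightarrow> ?f s' < ?f s" "\<And>s s'. q \<le> s \<Longrightarrow> s < s' \<Longrightarrow> s' \<le> r \<Longrightarrow> ?f s' < ?f s"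
      "p \<le> s" "s < s'" "s' \<le> r" for p q r s s'
  proof -
    consider "s' \<le> q" | "q \<le> s" | "s < q" "q < s'" by linarith
    then show ?thesis
    proof cases
      case 3
      then have "?f q < ?f s" "?f s' < ?f q" using that(1)[of s q] that(2)[of q s'] that(3,5) by auto
      then show ?thesis by simp
    qed (use that in auto)
  qed
  have A1: "?f s' < ?f s" if "smax \<le> s" "s < s'" "s' \<le> a + len" for s s'
  proof -
    have "tstar \<le> (s - a) / len" using that len by (simp add: smax_def field_simps)
    moreover have "(s - a) / len < (s' - a) / len" using that len by (simp add: divide_strict_right_mono)
    ultimately have "len * tilt ((s' - a) / len) < len * tilt ((s - a) / len)" using tilt_decreasing len by simp
    moreover have "half_band (s, y) = FA (s, y)" "half_band (s', y) = FA (s', y)"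
      using that order by (auto simp: half_band_def)
    ultimately show ?thesis using that smax \<zeta>_A[of s y] \<zeta>_A[of s' y] by simp
  qed
  have A2: "?f s' < ?f s" if "a + len \<le> s" "s < s'" "s' \<le> s0" for s s'
  proof -
    have "half_band (s, y) = vector [\<delta> - a + (s - s0), y, 2 * h]" "half_band (s', y) = vector [\<delta> - a + (s' - s0), y, 2 * h]"
      using that order FA_eq(2)[of s y] FA_eq(2)[of s' y] by (auto simp: half_band_def)
    then show ?thesis using that assms h_pos by (intro \<zeta>_less) auto
  qed
  have Dy: "0 \<le> FD (s, y) $ 2" if "s0 \<le> s" for s
  proof -
    have "FD (s0, y) $ 2 \<le> FD (s, y) $ 2" using that FD_mono(2)[of s0 s y] by (cases "s = s0") auto
    then show ?thesis using FD_eq(1)[of s0 y] assms by simp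
  qed
  have D: "?f s' < ?f s" if "s0 \<le> s" "s < s'" "s' \<le> s1" for s s'
  proof -
    have "half_band (s, y) = FD (s, y)" "half_band (s', y) = FD (s', y)" using that assms half_band_D by auto
    moreover have "h \<le> FD (s', y) $ 3" unfolding FD_nth by (rule FD_z_ge)
    moreover have "FD (s', y) $ 2 \<le> 3" using FD_y_less[OF assms(4) that(3)] \<delta> by linarith
    ultimately show ?thesis
      using FD_mono[OF that(2), of y] Dy[OF that(1)] FD_x_ge[of s' y] assms that h_pos by (intro \<zeta>_less) auto
  qed
  have T: "?f s' < ?f s" if "s1 \<le> s" "s < s'" "s' \<le> L" for s s'
  proof -
    let ?t = "(s - s1) / len" and ?t' = "(s' - s1) / len"
    have t: "0 \<le> ?t" "?t < ?t'" "?t' \<le> 1 / 2" using that len by (auto simp: L_def field_simps divide_strict_right_mono)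
    have e: "half_band (s, y) = FT (s, y)" "half_band (s', y) = FT (s', y)" using that assms half_band_T by auto
    have "len * Z ?t < len * Z ?t'" using Z_strict_mono[of ?t ?t'] t len by simp
    moreover have "len * X ?t \<le> len * X ?t'" using X_mono[of ?t ?t'] t len by simp
    moreover have "0 \<le> X ?t" using t by (intro X_nonneg; linarith)
    then have "0 \<le> len * X ?t" using len by simp
    moreover have "len * X ?t' \<le> len * (1 / 2)" using X_le(1)[of ?t'] len by (intro mult_left_mono) auto
    then have "1 + 2 * \<delta> + len * X ?t' \<le> 3" using len \<delta> by linarith
    moreover have "0 \<le> s'" using that order len by linarith
    then have "0 \<le> FT (s', y) $ 3" using half_band_z(1)[of s' y] that e by simp
    ultimately show ?thesis unfolding e using \<delta> len by (intro \<zeta>_less) (auto simp: FT_def)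
  qed
  have "?f s' < ?f s" if "smax \<le> s" "s < s'" "s' \<le> s0" for s s'
    by (rule join[OF A1 A2 that])
  then have "?f s' < ?f s" if "smax \<le> s" "s < s'" "s' \<le> s1" for s s'
    by (rule join[OF _ D that])
  then show ?thesis by (rule join[OF _ T assms(1-3)])
qed

section \<open>Level coordinates\<close>

text \<open>The middle of the gap between the middle segment, where \<open>y \<le> 1\<close>, and
  the last fold, where \<open>y \<ge> 1 + 2 * \<delta>\<close>.\<close>

definition y0 :: real where "y0 = 1 + \<delta>"

text \<open>Level coordinates.  At large \<open>\<bar>\<zeta>\<bar>\<close> they are \<open>(y, x - xs)\<close> and its image under \<open>flip\<close>, so that \<open>V\<close> separates
  the two sides of the first fold and its mirror image; at \<open>\<zeta> = 0\<close> they are \<open>(- x, y - y0)\<close>, so that \<open>V\<close>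
  separates the fold of \<open>FT\<close> from the middle segment.  In between they are interpolated linearly.\<close>

definition U :: "real ^ 3 \<Rightarrow> real" where
  "U p = \<tau> (\<zeta> p) * p $ 2 - (1 - \<bar>\<tau> (\<zeta> p)\<bar>) * p $ 1"

definition V :: "real ^ 3 \<Rightarrow> real" where
  "V p = \<tau> (\<zeta> p) * p $ 1 - \<bar>\<tau> (\<zeta> p)\<bar> * xs + (1 - \<bar>\<tau> (\<zeta> p)\<bar>) * (p $ 2 - y0)"

lemma U_flip: "U (flip p) = - U p" and V_flip: "V (flip p) = V p"
  by (simp_all add: U_def V_def \<zeta>_flip \<tau>_minus flip_nth)

lemma \<tau>_range: "- 1 \<le> \<tau> z" "\<tau> z \<le> 1" "\<bar>\<tau> z\<bar> \<le> 1"
  by (auto simp: \<tau>_def)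

lemma \<tau>_1: "h / 4 \<le> z \<Longrightarrow> \<tau> z = 1"
  using h_pos by (simp add: \<tau>_def field_simps)

lemma \<tau>_nonneg: "0 \<le> z \<Longrightarrow> 0 \<le> \<tau> z"
proof -
  assume "0 \<le> z"
  then have "0 \<le> 4 * z / h" using h_pos by simp
  then show ?thesis by (simp add: \<tau>_def max_def)
qed

lemma \<tau>_le: "0 \<le> z \<Longrightarrow> z \<le> 4 * \<eta> \<Longrightarrow> \<tau> z \<le> \<delta> / 4"
proof -
  assume "0 \<le> z" "z \<le> 4 * \<eta>"
  then have "4 * z \<le> \<delta> / 4 * h" using \<eta>(3) by (simp add: mult.commute)
  then have "4 * z / h \<le> \<delta> / 4" using h_pos by (simp only: pos_divide_le_eq)
  then show ?thesis using \<delta> by (simp add: \<tau>_def)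
qed

lemma continuous_\<tau>: "continuous_on S \<tau>"
  unfolding \<tau>_def by (intro continuous_intros) (use h_pos in simp)

lemma continuous_\<zeta>: "continuous_on S \<zeta>"
  unfolding \<zeta>_def shear_def ramp_def flip_def vector_3
  by (intro continuous_intros) (use h_pos \<delta> in simp_all)

lemma continuous_UV: "continuous_on S U" "continuous_on S V"
proof -
  have "continuous_on S (\<lambda>p. \<tau> (\<zeta> p))"
    by (rule continuous_on_compose2[OF continuous_\<tau>[of UNIV] continuous_\<zeta>]) simp
  then show "continuous_on S U" "continuous_on S V"
    unfolding U_def [abs_def] V_def [abs_def] by (intro continuous_intros; assumption)+
qed

text \<open>On a vertical line the shear terms vary by at most
  \<open>24 * \<eta> / h \<le> 1 / 2\<close> times the difference in \<open>z\<close>, so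
  \<open>\<zeta>\<close> still determines \<open>z\<close>.\<close>

lemma \<zeta>_vertical:
  assumes "p $ 1 = q $ 1" "p $ 2 = q $ 2" "q $ 3 < p $ 3"
  shows "\<zeta> q < \<zeta> p"
proof -
  define Y where "Y = max 0 (min 3 (p $ 2))"
  have Y: "0 \<le> Y" "Y \<le> 3" by (auto simp: Y_def)
  have lip: "\<bar>ramp (4 * z / h - 2) * w - ramp (4 * z' / h - 2) * w\<bar> \<le> 4 / h * \<bar>z - z'\<bar>"
    if w: "0 \<le> w" "w \<le> 1" for z z' w
  proof -
    have r: "\<bar>ramp x - ramp y\<bar> \<le> \<bar>x - y\<bar>" for x y
      by (auto simp: ramp_def)
    have "\<bar>ramp (4 * z / h - 2) - ramp (4 * z' / h - 2)\<bar> \<le> \<bar>(4 * z / h - 2) - (4 * z' / h - 2)\<bar>" by (rule r)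
    also have "(4 * z / h - 2) - (4 * z' / h - 2) = 4 / h * (z - z')"
      by (simp add: right_diff_distrib)
    also have "\<bar>4 / h * (z - z')\<bar> = 4 / h * \<bar>z - z'\<bar>" using h_pos by (simp only: abs_mult) simp
    finally have "\<bar>ramp (4 * z / h - 2) - ramp (4 * z' / h - 2)\<bar> * w \<le> 4 / h * \<bar>z - z'\<bar> * 1"
      using w h_pos by (intro mult_mono) auto
    then show ?thesis using w by (simp add: left_diff_distrib[symmetric] abs_mult)
  qed
  have "\<bar>shear p - shear q\<bar> \<le> 4 / h * \<bar>p $ 3 - q $ 3\<bar>"
    unfolding shear_def assms by (intro lip ramp)
  moreover have "\<bar>shear (flip p) - shear (flip q)\<bar> \<le> 4 / h * \<bar>- p $ 3 - - q $ 3\<bar>"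
    unfolding shear_def flip_nth assms by (intro lip ramp)
  ultimately have
    "\<bar>shear p - shear q\<bar> \<le> 4 / h * (p $ 3 - q $ 3)"
    "\<bar>shear (flip p) - shear (flip q)\<bar> \<le> 4 / h * (p $ 3 - q $ 3)"
    using assms(3) by simp_all
  then have "\<bar>(shear p - shear (flip p)) - (shear q - shear (flip q))\<bar> \<le> 2 * (4 / h * (p $ 3 - q $ 3))"
    by linarith
  then have "\<bar>(shear p - shear (flip p)) - (shear q - shear (flip q))\<bar> \<le> 8 / h * (p $ 3 - q $ 3)" by simp
  then have "(shear p - shear (flip p)) - (shear q - shear (flip q)) \<le> 8 / h * (p $ 3 - q $ 3)" by linarith
  then have "Y * ((shear p - shear (flip p)) - (shear q - shear (flip q))) \<le> Y * (8 / h * (p $ 3 - q $ 3))"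
    using Y by (intro mult_left_mono)
  also have "\<dots> \<le> 3 * (8 / h * (p $ 3 - q $ 3))"
    using Y assms h_pos by (intro mult_right_mono) simp_all
  finally have "Y * ((shear p - shear (flip p)) - (shear q - shear (flip q))) \<le> 3 * (8 / h * (p $ 3 - q $ 3))" .
  then have "\<eta> * (Y * ((shear p - shear (flip p)) - (shear q - shear (flip q)))) \<le> \<eta> * (3 * (8 / h * (p $ 3 - q $ 3)))"
    using \<eta> by (intro mult_left_mono) auto
  also have "\<dots> = 24 * \<eta> / h * (p $ 3 - q $ 3)" by simp
  also have "\<dots> \<le> 1 / 2 * (p $ 3 - q $ 3)"
    using \<eta> h_pos assms by (intro mult_right_mono) (auto simp: field_simps)
  also have "\<dots> < p $ 3 - q $ 3" using assms by simp
  finally show ?thesis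
    using assms by (simp add: \<zeta>_def Y_def algebra_simps)
qed

text \<open>On a level, \<open>(U, V)\<close> is affine in \<open>(x, y)\<close> with determinant
  \<open>- (t^2 + b^2)\<close>, where \<open>b = 1 - |t|\<close> and \<open>t\<close> do not vanish
  together. Then \<open>z\<close> is recovered by monotonicity on vertical lines.\<close>

lemma level_coordinates_inj:
  assumes "\<zeta> p = \<zeta> q" "U p = U q" "V p = V q"
  shows "p = q"
proof -
  define t b where "t = \<tau> (\<zeta> q)" and "b = 1 - \<bar>\<tau> (\<zeta> q)\<bar>"
  define dx dy where "dx = p $ 1 - q $ 1" and "dy = p $ 2 - q $ 2"
  have 1: "t * dy = b * dx" "t * dx = - (b * dy)"
    using assms by (simp_all add: U_def V_def t_def b_def dx_def dy_def algebra_simps)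
  have n: "t\<^sup>2 + b\<^sup>2 \<noteq> 0" by (auto simp: t_def b_def)
  have "(t\<^sup>2 + b\<^sup>2) * dx = t * (t * dx) + b * (b * dx)" by (simp add: power2_eq_square algebra_simps)
  also have "\<dots> = 0" using 1 by (simp add: 1(1)[symmetric])
  finally have "dx = 0" using n mult_eq_0_iff by blast
  have "(t\<^sup>2 + b\<^sup>2) * dy = t * (t * dy) + b * (b * dy)" by (simp add: power2_eq_square algebra_simps)
  also have "t * dy = 0" using 1(1) \<open>dx = 0\<close> by simp
  also have "b * dy = 0" using 1(2) \<open>dx = 0\<close> by simp
  finally have "(t\<^sup>2 + b\<^sup>2) * dy = 0" by simp
  then have "dy = 0" using n mult_eq_0_iff by blast
  then have e: "p $ 1 = q $ 1" "p $ 2 = q $ 2" using \<open>dx = 0\<close> by (simp_all add: dx_def dy_def)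
  then have "p $ 3 = q $ 3" using \<zeta>_vertical[of p q] \<zeta>_vertical[of q p] assms(1) by linarith
  with e show ?thesis by (simp add: vec_eq_iff forall_3)
qed

lemma \<zeta>_bounds:
  assumes "0 \<le> p $ 2" "p $ 2 \<le> 3" "0 \<le> p $ 3" "\<bar>p $ 1\<bar> \<le> 1"
  shows "p $ 3 - 4 * \<eta> \<le> \<zeta> p" "\<zeta> p \<le> p $ 3 - \<eta> * p $ 1"
proof -
  have "shear (flip p) = 0" using assms h_pos by (intro shear_0) (simp add: flip_nth)
  moreover have "max 0 (min 3 (p $ 2)) = p $ 2" using assms by auto
  ultimately have e: "\<zeta> p = p $ 3 - \<eta> * p $ 1 - \<eta> * (p $ 2 * shear p)"
    by (simp add: \<zeta>_def algebra_simps)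
  have "shear p \<le> 1 * 1" "0 \<le> shear p" unfolding shear_def by (intro mult_mono mult_nonneg_nonneg ramp; simp)+
  then have "p $ 2 * shear p \<le> 3 * 1" "0 \<le> p $ 2 * shear p" using assms by (intro mult_mono mult_nonneg_nonneg; simp)+
  then have "\<eta> * (p $ 2 * shear p) \<le> \<eta> * 3" "0 \<le> \<eta> * (p $ 2 * shear p)" "\<eta> * p $ 1 \<le> \<eta> * 1"
    using assms \<eta> by (auto intro: mult_left_mono)
  with e show "p $ 3 - 4 * \<eta> \<le> \<zeta> p" "\<zeta> p \<le> p $ 3 - \<eta> * p $ 1" by linarith+
qed

lemma \<zeta>m: "h \<le> \<zeta>m"
proof -
  have "0 \<le> \<eta> * X tstar" using \<eta> tstar by (intro mult_nonneg_nonneg X_nonneg) auto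
  then have "height / 2 \<le> tilt tstar"
    unfolding tilt_def using Z_mono[of "1 / 2" tstar] tstar Z_half by linarith
  then have "len * (height / 2) \<le> len * tilt tstar" using len by (intro mult_left_mono) auto
  moreover have "0 \<le> \<eta> * a" using \<eta> order by simp
  ultimately show ?thesis using h2 by (simp add: \<zeta>m_def mult.commute)
qed

lemma a_le: "1 / 2 < a" "a \<le> 11 / 20"
  using \<delta> by (simp_all add: a_def)

lemma len_le: "len \<le> 3 / 40" using len \<delta> by linarith

lemma X_tstar: "0 < X tstar"
  using X_strict_anti[of tstar 1] X_sym[of 1] tstar start by simp

lemma xs: "xs < - a" "- 1 \<le> xs"
proof -
  have "0 < len * X tstar" by (rule mult_pos_pos[OF len(1) X_tstar])
  then show "xs < - a" unfolding xs_def by linarith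
  have "len * X tstar \<le> len * (1 / 2)" by (rule mult_left_mono[OF X_le(1) less_imp_le[OF len(1)]])
  then show "- 1 \<le> xs" unfolding xs_def using a_le len_le by linarith
qed

lemma FT_facts:
  assumes "s1 \<le> s" "s \<le> L" "y \<in> {0..1}"
  shows "FT (s, y) $ 1 = y - 1 / 2" "1 + 2 * \<delta> \<le> FT (s, y) $ 2" "FT (s, y) $ 2 \<le> 3"
    "0 \<le> FT (s, y) $ 3" "FT (s, y) $ 3 \<le> h"
proof -
  let ?t = "(s - s1) / len"
  show "FT (s, y) $ 1 = y - 1 / 2" by (simp add: FT_def)
  show "1 + 2 * \<delta> \<le> FT (s, y) $ 2" by (rule FT_y_ge[OF assms(1,2)])
  have "len * X ?t \<le> len * (1 / 2)" using len by (intro mult_left_mono X_le(1)) simp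
  then have "1 + 2 * \<delta> + len * X ?t \<le> 3" using len_le \<delta> by linarith
  then show "FT (s, y) $ 2 \<le> 3" by (simp add: FT_def)
  have "0 \<le> s" using assms(1) order smax by linarith
  then show "0 \<le> FT (s, y) $ 3"
    using half_band_z(1)[OF _ assms(2), of y] half_band_T[OF assms(1,3)] by simp
  have "0 \<le> len * Z ?t" by (intro mult_nonneg_nonneg Z_range less_imp_le[OF len(1)])
  then have "h - len * Z ?t \<le> h" by linarith
  then show "FT (s, y) $ 3 \<le> h" by (simp only: FT_def fst_conv snd_conv vector_3)
qed

lemma \<zeta>_T:
  assumes "s1 \<le> s" "s \<le> L" "y \<in> {0..1}"
  shows "- \<eta> / 2 \<le> \<zeta> (FT (s, y))"
proof (cases "FT (s, y) $ 3 \<le> h / 2")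
  case True
  have "shear (FT (s, y)) = 0" "shear (flip (FT (s, y))) = 0"
    using True FT_facts[OF assms] h_pos by (intro shear_0; simp add: flip_nth)+
  then have "\<zeta> (FT (s, y)) = FT (s, y) $ 3 - \<eta> * (y - 1 / 2)"
    by (simp add: \<zeta>_def FT_facts[OF assms])
  moreover have "\<eta> * (y - 1 / 2) \<le> \<eta> * (1 / 2)" using assms \<eta> by (intro mult_left_mono) auto
  ultimately show ?thesis using FT_facts[OF assms] by linarith
next
  case False
  have "FT (s, y) $ 3 - 4 * \<eta> \<le> \<zeta> (FT (s, y))"
    using FT_facts[OF assms] assms \<delta> by (intro \<zeta>_bounds) auto
  then show ?thesis using False \<eta> by linarith
qed

text \<open>By monotonicity the estimate at \<open>s1\<close>, where \<open>z = h\<close>, suffices.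
  Up to the last fold \<open>\<tau>\<close> is therefore 1, and the level coordinates are
  \<open>(y, x - xs)\<close>.\<close>

lemma \<zeta>_upper:
  assumes "smax \<le> s" "s \<le> s1" "y \<in> {0..1}"
  shows "h / 2 \<le> \<zeta> (half_band (s, y))"
proof -
  have "\<zeta> (half_band (s1, y)) \<le> \<zeta> (half_band (s, y))"
    using \<zeta>_half_band_decreasing[of s s1 y] assms order by (cases "s = s1") auto
  moreover have "FT (s1, y) $ 3 - 4 * \<eta> \<le> \<zeta> (FT (s1, y))"
    using FT_facts[of s1 y] assms \<delta> order by (intro \<zeta>_bounds) auto
  moreover have "FT (s1, y) $ 3 = h" using Z_eq[of 0] by (simp add: FT_def)
  ultimately show ?thesis using \<eta> half_band_T[of s1 y] assms by simp
qed

section \<open>The two sides of the axis\<close>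

text \<open>One bound for each of the three stretches of the front: the rest of the first U-turn,
  the layers up to \<open>s1\<close>, and the last fold.\<close>

definition csep :: real where "csep = min (\<zeta>m / \<eta>) (min (len * X tstar) (\<delta> / 2))"

lemma csep: "0 < csep" "csep \<le> \<zeta>m / \<eta>" "csep \<le> len * X tstar" "csep \<le> \<delta> / 2"
proof -
  show "0 < csep" using \<zeta>m h_pos \<eta>(1) len X_tstar \<delta> by (simp add: csep_def)
  show "csep \<le> \<zeta>m / \<eta>" "csep \<le> len * X tstar" "csep \<le> \<delta> / 2" unfolding csep_def by linarith+
qed

text \<open>The bound vanishes at the maximum, where front and back meet on the axis. A bound linear
  in the remaining height is what \<open>Im_ge\<close> demands for the radial extension.\<close>

lemma V_front:
  assumes s: "smax \<le> s" "s \<le> L" and y: "y \<in> {0..1}"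
  shows "csep * (1 - \<bar>\<zeta> (half_band (s, y))\<bar> / \<zeta>m) \<le> V (half_band (s, y))"
proof -
  let ?p = "half_band (s, y)"
  have m: "0 < \<zeta>m" using \<zeta>m h_pos by simp
  have weak: "csep * (1 - \<bar>\<zeta> ?p\<bar> / \<zeta>m) \<le> csep"
    using csep m by (simp add: mult_le_cancel_left1)
  have top: "V ?p = ?p $ 1 - xs" if "s \<le> s1"
    using \<tau>_1[of "\<zeta> ?p"] \<zeta>_upper[OF s(1) that y] h_pos by (simp add: V_def)
  consider "s \<le> a + len" | "a + len \<le> s" "s \<le> s1" | "s1 \<le> s" using order by linarith
  then show ?thesis
  proof cases
    case 1
    let ?t = "(s - a) / len"
    have p: "?p = FA (s, y)" using 1 order by (simp add: half_band_def)
    have t: "tstar \<le> ?t" using s len by (simp add: smax_def field_simps)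
    have "0 \<le> s" using s smax by linarith
    then have "\<zeta>m - \<zeta> ?p = len * (tilt tstar - tilt ?t)"
      using \<zeta>_A[of s y] 1 by (simp add: p \<zeta>m_def algebra_simps)
    \<comment> \<open>Past \<open>tstar\<close> the coordinate \<open>Z\<close> does not fall, so
      any loss in \<open>tilt\<close> comes from its part \<open>\<eta> * X\<close>.\<close>
    also have "\<dots> \<le> len * (\<eta> * (X tstar - X ?t))"
      using Z_mono[OF t] len by (intro mult_left_mono) (auto simp: tilt_def algebra_simps)
    also have "\<dots> = \<eta> * V ?p"
    proof -
      have "V ?p = ?p $ 1 - xs" using 1 order by (intro top) linarith
      also have "\<dots> = len * (X tstar - X ?t)" by (simp add: p FA_def xs_def right_diff_distrib)
      finally show ?thesis by simp
    qed
    finally have Vge: "(\<zeta>m - \<zeta> ?p) / \<eta> \<le> V ?p" using \<eta> by (simp add: field_simps)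
    have pos: "0 \<le> \<zeta> ?p" using \<zeta>_upper[OF s(1) _ y] 1 order h_pos by simp
    have "\<zeta> ?p \<le> \<zeta>m"
    proof -
      have "tilt ?t \<le> tilt tstar" using tilt_decreasing[of tstar ?t] t by (cases "?t = tstar") auto
      then have "len * tilt ?t \<le> len * tilt tstar" using len by simp
      then show ?thesis using \<zeta>_A[of s y] 1 \<open>0 \<le> s\<close> by (simp add: p \<zeta>m_def)
    qed
    then have "csep * (1 - \<zeta> ?p / \<zeta>m) \<le> \<zeta>m / \<eta> * (1 - \<zeta> ?p / \<zeta>m)"
      using csep m by (intro mult_right_mono) auto
    also have "\<dots> = (\<zeta>m - \<zeta> ?p) / \<eta>" using m \<eta> by (simp add: field_simps)
    finally show ?thesis using Vge pos by simp
  next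
    case 2
    have "- a \<le> ?p $ 1"
    proof (cases "s \<le> s0")
      case True
      then show ?thesis using 2 FA_eq(2)[of s y] by (simp add: half_band_def s0_def)
    next
      case False
      then show ?thesis using 2 half_band_D[of s y] FD_x_ge[of s y] y \<delta> by simp
    qed
    then have "len * X tstar \<le> V ?p" using top 2 by (simp add: xs_def)
    then show ?thesis using weak csep by linarith
  next
    case 3
    have p: "?p = FT (s, y)" using 3 y by (rule half_band_T)
    note T = FT_facts[OF 3 s(2) y]
    let ?T = "\<tau> (\<zeta> ?p)"
    have "\<delta> / 2 \<le> V ?p"
    proof (cases "0 \<le> \<zeta> ?p")
      case True
      then have t: "0 \<le> ?T" by (rule \<tau>_nonneg)
      have "?T * \<delta> \<le> ?T * (?p $ 1 - xs)"
        using T y xs a_le \<delta> t by (intro mult_left_mono) (auto simp: p a_def)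
      moreover have "(1 - ?T) * \<delta> \<le> (1 - ?T) * (?p $ 2 - y0)"
        using T \<tau>_range(2) by (intro mult_left_mono) (auto simp: p y0_def)
      moreover have "V ?p = ?T * (?p $ 1 - xs) + (1 - ?T) * (?p $ 2 - y0)"
        using t by (simp add: V_def algebra_simps)
      ultimately show ?thesis using \<delta> by (simp add: algebra_simps)
    next
      case False
      \<comment> \<open>Below level 0 this half of the last fold reaches only a depth of order
        \<open>\<eta>\<close>. There \<open>1 + \<tau>\<close> is at least \<open>1 / 2\<close>, and
        the contribution of \<open>x\<close> to \<open>V\<close> has the right sign.\<close>
      have "0 \<le> - \<zeta> ?p" "- \<zeta> ?p \<le> 4 * \<eta>"
        using False \<zeta>_T[OF 3 s(2) y] \<eta>(1) unfolding p by linarith+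
      then have "\<tau> (- \<zeta> ?p) \<le> \<delta> / 4" "0 \<le> \<tau> (- \<zeta> ?p)" using \<tau>_le \<tau>_nonneg by blast+
      then have t: "- ?T \<le> \<delta> / 4" "?T \<le> 0" by (simp_all add: \<tau>_minus)
      have "0 \<le> ?T * (?p $ 1 + xs)" 
        using T y xs a_le t by (intro mult_nonpos_nonpos) (auto simp: p)
      moreover have "1 / 2 * \<delta> \<le> (1 + ?T) * (?p $ 2 - y0)"
        using T t \<delta> by (intro mult_mono) (auto simp: p y0_def)
      moreover have "V ?p = ?T * (?p $ 1 + xs) + (1 + ?T) * (?p $ 2 - y0)"
        using t by (simp add: V_def algebra_simps)
      ultimately show ?thesis by simp
    qed
    then show ?thesis using weak csep by linarith
  qed
qed

lemma back_half_band:
  assumes "0 \<le> s" "s \<le> smax"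
  shows "half_band (s, y) = FA (s, y)" "\<zeta> (half_band (s, y)) = len * tilt ((s - a) / len) + \<eta> * a"
    "0 \<le> \<zeta> (half_band (s, y))"
proof -
  show e: "half_band (s, y) = FA (s, y)" using assms order by (simp add: half_band_def)
  then show f: "\<zeta> (half_band (s, y)) = len * tilt ((s - a) / len) + \<eta> * a"
    using \<zeta>_A[of s y] assms smax by simp
  have "- (a / len) \<le> (s - a) / len" using assms len by (simp add: field_simps)
  then have "tilt (- (a / len)) \<le> tilt ((s - a) / len)"
    using tilt_increasing[of "- (a / len)" "(s - a) / len"] assms len
    by (cases "- (a / len) = (s - a) / len") (auto simp: smax_def field_simps)
  moreover have "tilt (- (a / len)) = - (\<eta> * a / len)"
    using order len by (simp add: tilt_def X_eq Z_eq)
  ultimately have "len * (- (\<eta> * a / len)) \<le> len * tilt ((s - a) / len)" using len by (intro mult_left_mono) auto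
  then show "0 \<le> \<zeta> (half_band (s, y))" using f len by simp
qed

text \<open>Up to the parameter \<open>1 - tstar\<close> of the U-turn the level is so low that the
  gap in \<open>y\<close> decides the sign; between \<open>1 - tstar\<close> and
  \<open>tstar\<close> the symmetry of \<open>X\<close> puts the strand to the left of
  \<open>xs\<close>.\<close>

lemma V_back:
  assumes s: "0 \<le> s" "s < smax" and y: "y \<in> {0..1}"
  shows "0 < - V (half_band (s, y))"
proof -
  let ?p = "half_band (s, y)" and ?t = "(s - a) / len"
  let ?T = "\<tau> (\<zeta> ?p)"
  note b = back_half_band[of s y]
  have t: "0 \<le> ?T" "?T \<le> 1" using b s \<tau>_nonneg \<tau>_range by auto
  have V: "- V ?p = ?T * (xs - ?p $ 1) + (1 - ?T) * (y0 - y)"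
    using t b s by (simp add: V_def FA_def algebra_simps)
  have yy: "\<delta> \<le> y0 - y" using y by (simp add: y0_def)
  have xx: "- 1 \<le> xs - ?p $ 1" if "?p $ 1 \<le> 0" using xs that by linarith
  have small: "0 < - V ?p" if "\<zeta> ?p \<le> 4 * \<eta>" "?p $ 1 \<le> 0"
  proof -
    have T4: "?T \<le> \<delta> / 4" using that b s by (intro \<tau>_le) auto
    have "?T * (- 1) \<le> ?T * (xs - ?p $ 1)" using xx that t by (intro mult_left_mono) auto
    moreover have "1 / 2 * \<delta> \<le> (1 - ?T) * (y0 - y)" using T4 yy \<delta> by (intro mult_mono) auto
    ultimately show ?thesis using V T4 \<delta> by linarith
  qed
  consider "s \<le> a" | "a \<le> s" "?t < 1 - tstar" | "a \<le> s" "1 - tstar \<le> ?t" by linarith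
  then show ?thesis
  proof cases
    case 1
    then have "?t \<le> 0" using len by (simp add: field_simps)
    then have "\<zeta> ?p = \<eta> * s" using b s len by (simp add: tilt_def X_eq Z_eq field_simps)
    moreover have "\<eta> * s \<le> \<eta> * 4" using 1 a_le \<eta> by (intro mult_left_mono) auto
    moreover have "?p $ 1 \<le> 0" using b s 1 FA_eq(1)[of s y] by simp
    ultimately show ?thesis by (intro small) auto
  next
    case 2
    have t0: "0 \<le> ?t" using 2 len by simp
    have "Z ?t \<le> Z (1 - tstar)" using 2 by (intro Z_mono) auto
    then have "Z ?t \<le> \<eta>" using Z_sym[of tstar] Z_tstar by simp
    moreover have "\<eta> * X ?t \<le> \<eta> * (1 / 2)" using X_le(1) \<eta> by (intro mult_left_mono) auto
    ultimately have "tilt ?t \<le> 2 * \<eta>" unfolding tilt_def using \<eta>(1) by linarith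
    then have "len * tilt ?t \<le> len * (2 * \<eta>)" using len by (intro mult_left_mono) auto
    also have "\<dots> \<le> 1 * (2 * \<eta>)" using len_le \<eta> by (intro mult_right_mono) auto
    finally have "len * tilt ?t \<le> 2 * \<eta>" by simp
    moreover have "\<eta> * a \<le> \<eta> * 2" using a_le \<eta> by (intro mult_left_mono) auto
    ultimately have "\<zeta> ?p \<le> 4 * \<eta>" using b s by simp
    moreover have "?t \<le> 1" using 2 tstar by simp
    then have "0 \<le> len * X ?t" using X_nonneg[of ?t] t0 len by simp
    then have "?p $ 1 \<le> 0" using b s order by (simp add: FA_def)
    ultimately show ?thesis by (rule small)
  next
    case 3
    have tt: "?t < tstar" using s len by (simp add: smax_def field_simps)
    have "X tstar \<le> X ?t \<and> (0 < ?T * len * (X ?t - X tstar) \<or> ?T < 1)"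
    \<comment> \<open>At the mirror image of the maximum the values of \<open>X\<close> coincide,
      but the level is still low enough for the \<open>y\<close>-part of \<open>V\<close> to be
      present.\<close>
    proof (cases "?t = 1 - tstar")
      case True
      have "Z ?t \<le> \<eta>" using Z_sym[of tstar] Z_tstar True by simp
      moreover have "\<eta> * X ?t \<le> \<eta> * (1 / 2)" using X_le(1) \<eta> by (intro mult_left_mono) auto
      ultimately have "tilt ?t \<le> 2 * \<eta>" unfolding tilt_def using \<eta>(1) by linarith
      then have "len * tilt ?t \<le> len * (2 * \<eta>)" using len by (intro mult_left_mono) auto
      also have "\<dots> \<le> 1 * (2 * \<eta>)" using len_le \<eta> by (intro mult_right_mono) auto
      finally have "len * tilt ?t \<le> 2 * \<eta>" by simp
      moreover have "\<eta> * a \<le> \<eta> * 2" using a_le \<eta> by (intro mult_left_mono) auto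
      ultimately have "\<zeta> ?p \<le> 4 * \<eta>" using b s by simp
      then have "?T \<le> \<delta> / 4" using b s by (intro \<tau>_le) auto
      then show ?thesis using True X_sym[of tstar] \<delta> by simp
    next
      case False
      have "X tstar < X ?t"
      proof (cases "1 / 2 \<le> ?t")
        case True
        then show ?thesis using X_strict_anti tt by simp
      next
        case F: False
        then have "X (1 - tstar) < X ?t" using X_strict_mono[of "1 - tstar" ?t] 3 False by simp
        then show ?thesis using X_sym[of tstar] by simp
      qed
      moreover have "0 < ?T \<or> ?T < 1" by linarith
      ultimately show ?thesis using len by auto
    qed
    moreover have "xs - ?p $ 1 = len * (X ?t - X tstar)" using b s by (simp add: xs_def FA_def algebra_simps)
    ultimately have "0 < ?T * (xs - ?p $ 1) + (1 - ?T) * \<delta>"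
      using t \<delta> len
      by (cases "?T < 1") (auto intro!: add_pos_nonneg add_nonneg_pos mult_nonneg_nonneg simp: mult.assoc)
    moreover have "(1 - ?T) * \<delta> \<le> (1 - ?T) * (y0 - y)" using t yy by (intro mult_left_mono) auto
    ultimately show ?thesis using V by linarith
  qed
qed

text \<open>Once the angle exceeds \<open>2 * pi / 3\<close>, \<open>X\<close> falls at speed at
  least \<open>1 / 2\<close> while \<open>tilt\<close> rises at speed at most 1; hence the factor
  \<open>1 / 2\<close>.\<close>

lemma V_back_near:
  obtains r where "r < smax" "\<And>s y. r \<le> s \<Longrightarrow> 0 \<le> s \<Longrightarrow> s \<le> smax \<Longrightarrow> y \<in> {0..1} \<Longrightarrow>
    1 / 2 * (\<zeta>m - \<zeta> (half_band (s, y))) \<le> - V (half_band (s, y))"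
proof -
  have ae: "arctan \<eta> \<le> 1 / 1000" using arctan_\<eta> \<eta> by linarith
  have "\<exists>t. 1 / 2 \<le> t \<and> t \<le> tstar \<and> \<Theta> t = pi - pi / 3"
  proof (rule IVT')
    show "\<Theta> (1 / 2) \<le> pi - pi / 3" "pi - pi / 3 \<le> \<Theta> tstar" 
      using angle_half tstar(3) ae pi_gt3 by auto
  qed (use tstar in \<open>auto intro: continuous_on_subset[OF cont_angle]\<close>)
  then obtain t0 where t0: "1 / 2 \<le> t0" "t0 \<le> tstar" "\<Theta> t0 = pi - pi / 3" by blast
  have "t0 \<noteq> tstar" using t0 tstar(3) ae pi_gt3 by auto
  then have lt: "t0 < tstar" using t0 by simp
  show ?thesis
  proof (rule that[of "a + len * t0"])
    show "a + len * t0 < smax" using lt len by (simp add: smax_def)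
  next
    fix s y :: real assume s: "a + len * t0 \<le> s" "0 \<le> s" "s \<le> smax" and y: "y \<in> {0..1}"
    let ?p = "half_band (s, y)" and ?t = "(s - a) / len"
    note b = back_half_band[OF s(2,3), of y]
    have t: "t0 \<le> ?t" "?t \<le> tstar" using s len by (simp_all add: smax_def field_simps)
    show "1 / 2 * (\<zeta>m - \<zeta> ?p) \<le> - V ?p"
    proof -
      have "1 / 2 \<le> ?t" using t t0 by linarith
      then have "height / 2 \<le> Z ?t" using Z_mono[of "1 / 2" ?t] Z_half by simp
      moreover have "0 \<le> X ?t" using t t0 tstar by (intro X_nonneg) linarith+
      then have "0 \<le> \<eta> * X ?t" using \<eta> by simp
      ultimately have "height / 2 \<le> tilt ?t" by (simp add: tilt_def)
      then have "len * (height / 2) \<le> len * tilt ?t" using len by (intro mult_left_mono) auto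
      then have "h \<le> \<zeta> ?p" using b order \<eta> by (simp add: h_def mult.commute add_increasing2)
      then have T: "\<tau> (\<zeta> ?p) = 1" using h_pos by (intro \<tau>_1) auto
      have V: "- V ?p = len * (X ?t - X tstar)" using b T by (simp add: V_def FA_def xs_def algebra_simps)
      have "1 / 2 * (tilt tstar - tilt ?t) \<le> X ?t - X tstar"
      proof (cases "?t = tstar")
        case False
        then have lt: "?t < tstar" using t by simp
        let ?g = "\<lambda>x. X x + 1 / 2 * tilt x"
        have "?g tstar \<le> ?g ?t"
        proof (rule DERIV_nonpos_imp_nonincreasing[OF t(2)])
          fix x assume x: "?t \<le> x" "x \<le> tstar"
          have "pi - pi / 3 \<le> \<Theta> x" using angle_mono[of t0 x] t0 t x by simp
          then have "cos (\<Theta> x) \<le> cos (pi - pi / 3)" using angle_range(2)[of x] pi_gt_zero by (intro cos_monotone_0_pi_le) auto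
          then have c: "cos (\<Theta> x) \<le> - (1 / 2)" by (simp only: cos_pi_minus cos_60)
          then have "\<eta> * cos (\<Theta> x) \<le> 0" using \<eta> by (simp add: mult_le_0_iff)
          then have "cos (\<Theta> x) + 1 / 2 * (sin (\<Theta> x) + \<eta> * cos (\<Theta> x)) \<le> 0"
            using c sin_le_one[of "\<Theta> x"] by argo
          then show "\<exists>y. (?g has_real_derivative y) (at x) \<and> y \<le> 0"
            using DERIV_add[OF deriv(1)[of x] DERIV_cmult[OF tilt_deriv[of x], of "1 / 2"]] by blast
        qed
        then show ?thesis by (simp add: algebra_simps)
      qed simp
      then have "len * (1 / 2 * (tilt tstar - tilt ?t)) \<le> len * (X ?t - X tstar)" using len by (intro mult_left_mono) auto
      then show ?thesis using V b by (simp add: \<zeta>m_def algebra_simps)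
    qed
  qed
qed

lemma tilt_back: "0 \<le> s \<Longrightarrow> s \<le> smax \<Longrightarrow> \<zeta> (half_band (s, y)) \<le> \<zeta>m"
proof -
  assume s: "0 \<le> s" "s \<le> smax"
  have "(s - a) / len \<le> tstar" using s len by (simp add: smax_def field_simps)
  then have "tilt ((s - a) / len) \<le> tilt tstar"
    using tilt_increasing[of "(s - a) / len" tstar] by (cases "(s - a) / len = tstar") auto
  then have "len * tilt ((s - a) / len) \<le> len * tilt tstar" using len by simp
  then show ?thesis using back_half_band(2)[OF s, of y] by (simp add: \<zeta>m_def)
qed

lemma V_back_linear:
  assumes y: "y \<in> {0..1}"
  obtains c where "0 < c" "\<And>s. s \<in> {0..smax} \<Longrightarrow> c * (1 - \<bar>\<zeta> (half_band (s, y))\<bar> / \<zeta>m) \<le> - V (half_band (s, y))"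
proof -
  obtain r where r: "r < smax" "\<And>s y. r \<le> s \<Longrightarrow> 0 \<le> s \<Longrightarrow> s \<le> smax \<Longrightarrow> y \<in> {0..1} \<Longrightarrow>
      1 / 2 * (\<zeta>m - \<zeta> (half_band (s, y))) \<le> - V (half_band (s, y))"
    using V_back_near by metis
  have "continuous_on {0..smax} (\<lambda>s. half_band (s, y)) \<longleftrightarrow> continuous_on {0..smax} (\<lambda>s. band (s, y))"
    by (rule continuous_on_cong) (use band_pos order in auto)
  then have hb: "continuous_on {0..smax} (\<lambda>s. half_band (s, y))" using continuous_edge[OF y] by blast
  obtain c where c: "0 < c" "\<And>s. s \<in> {0..smax} \<Longrightarrow> c * (\<zeta>m - \<zeta> (half_band (s, y))) \<le> - V (half_band (s, y))"
  proof (rule compact_linear_bound[where f = "\<lambda>s. - V (half_band (s, y))" and g = "\<lambda>s. \<zeta>m - \<zeta> (half_band (s, y))" and p = 0 and q = smax and r = r and k = "1 / 2"])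
    show "continuous_on {0..smax} (\<lambda>s. - V (half_band (s, y)))"
      by (intro continuous_intros continuous_on_compose2[OF continuous_UV(2) hb]) auto
    show "continuous_on {0..smax} (\<lambda>s. \<zeta>m - \<zeta> (half_band (s, y)))"
      by (intro continuous_intros continuous_on_compose2[OF continuous_\<zeta> hb]) auto
    show "0 < - V (half_band (s, y))" if "0 \<le> s" "s < smax" for s using V_back that y by blast
    show "1 / 2 * (\<zeta>m - \<zeta> (half_band (s, y))) \<le> - V (half_band (s, y))" if "r \<le> s" "0 \<le> s" "s \<le> smax" for s
      using r(2) that y by blast
    show "0 \<le> \<zeta>m - \<zeta> (half_band (s, y))" if "s \<in> {0..smax}" for s
      using tilt_back that by simp
  qed (use smax r in auto)
  have m: "0 < \<zeta>m" using \<zeta>m h_pos by simp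
  show ?thesis
  proof (rule that[of "c * \<zeta>m"])
    fix s assume "s \<in> {0..smax}"
    then have "c * (\<zeta>m - \<zeta> (half_band (s, y))) \<le> - V (half_band (s, y))" "0 \<le> \<zeta> (half_band (s, y))"
      using c back_half_band by auto
    moreover have "c * \<zeta>m * (1 - \<zeta> (half_band (s, y)) / \<zeta>m) = c * (\<zeta>m - \<zeta> (half_band (s, y)))"
      using m by (simp add: field_simps)
    ultimately show "c * \<zeta>m * (1 - \<bar>\<zeta> (half_band (s, y))\<bar> / \<zeta>m) \<le> - V (half_band (s, y))"
      by (simp only: abs_of_nonneg)
  qed (use c m in simp)
qed

section \<open>The four strands of the boundary\<close>

lemma \<zeta>m_pos: "0 < \<zeta>m"
  using \<zeta>m h_pos by simp

text \<open>The half-turn composed with a deck transformation reverses the front and exchanges the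
  edges; it reduces statements below level 0 to those above.\<close>

lemma band_mirror: "band (lam - s, 1 - y) = flip (band (s, y))"
  using band_deck[of "- s" 1 y] by (simp add: lam_def tw_def band_flip)

lemma front_decreasing:
  assumes "smax \<le> s" "s < s'" "s' \<le> lam - smax" "y \<in> {0..1}"
  shows "\<zeta> (band (s', y)) < \<zeta> (band (s, y))"
proof -
  have LL: "lam = 2 * L" by (simp add: lam_def)
  have low: "\<zeta> (band (s', y)) < \<zeta> (band (s, y))" if "smax \<le> s" "s < s'" "s' \<le> L" "y \<in> {0..1}" for s s' y
    using \<zeta>_half_band_decreasing[OF that] band_pos[of s y] band_pos[of s' y] that smax by simp
  have mirror: "\<zeta> (band (s, y)) = - \<zeta> (band (lam - s, 1 - y))" for s
    using band_mirror[of s y] by (simp add: \<zeta>_flip)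
  have high: "\<zeta> (band (s', y)) < \<zeta> (band (s, y))" if "L \<le> s" "s < s'" "s' \<le> lam - smax" for s s'
    using low[of "lam - s'" "lam - s" "1 - y"] that assms(4) mirror[of s] mirror[of s'] LL by simp
  consider "s' \<le> L" | "L \<le> s" | "s < L" "L < s'" by linarith
  then show ?thesis
  proof cases
    case 1
    then show ?thesis using low assms by blast
  next
    case 2
    then show ?thesis using high assms by blast
  next
    case 3
    then have "\<zeta> (band (L, y)) < \<zeta> (band (s, y))" "\<zeta> (band (s', y)) < \<zeta> (band (L, y))"
      using low[of s L y] high[of L s'] assms by auto
    then show ?thesis by simp
  qed
qed

lemma back_coordinates:
  assumes "\<bar>s\<bar> \<le> smax"
  shows "band (s, y) $ 2 = y" "band (s, y) $ 1 = band (s, y') $ 1" "\<zeta> (band (s, y)) = \<zeta> (band (s, y'))"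
proof -
  have *: "half_band (s, y) $ 2 = y \<and> half_band (s, y) $ 1 = half_band (s, y') $ 1 \<and>
      \<zeta> (half_band (s, y)) = \<zeta> (half_band (s, y'))" if "0 \<le> s" "s \<le> smax" for s y y'
    using back_half_band[OF that] by (simp add: FA_def)
  have e: "0 \<le> s \<Longrightarrow> band (s, y) = half_band (s, y)" "s \<le> 0 \<Longrightarrow> band (s, y) = flip (half_band (- s, y))" for y
    using assms order smax by (auto intro: band_pos band_neg)
  have "band (s, y) $ 2 = y \<and> band (s, y) $ 1 = band (s, y') $ 1 \<and> \<zeta> (band (s, y)) = \<zeta> (band (s, y'))"
  proof (cases "0 \<le> s")
    case True
    then show ?thesis using *[of s] assms by (simp add: e)
  next
    case False
    then show ?thesis using *[of "- s"] assms by (simp add: e \<zeta>_flip flip_nth)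
  qed
  then show "band (s, y) $ 2 = y" "band (s, y) $ 1 = band (s, y') $ 1" "\<zeta> (band (s, y)) = \<zeta> (band (s, y'))" by blast+
qed

lemma back_increasing:
  assumes "- smax \<le> s" "s < s'" "s' \<le> smax"
  shows "\<zeta> (band (s, y)) < \<zeta> (band (s', y))"
proof -
  have pos: "\<zeta> (band (s, y)) < \<zeta> (band (s', y))" if "0 \<le> s" "s < s'" "s' \<le> smax" for s s'
  proof -
    have "(s - a) / len < (s' - a) / len" "(s' - a) / len \<le> tstar"
      using that len by (simp_all add: smax_def field_simps divide_strict_right_mono)
    then have "len * tilt ((s - a) / len) < len * tilt ((s' - a) / len)" using tilt_increasing len by simp
    then show ?thesis
      using back_half_band(2)[of s y] back_half_band(2)[of s' y] band_pos[of s y] band_pos[of s' y] that order by simp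
  qed
  have neg: "\<zeta> (band (s, y)) < \<zeta> (band (s', y))" if "- smax \<le> s" "s < s'" "s' \<le> 0" for s s'
    using pos[of "- s'" "- s"] that by (simp add: band_flip \<zeta>_flip)
  consider "0 \<le> s" | "s' \<le> 0" | "s < 0" "0 < s'" by linarith
  then show ?thesis
  proof cases
    case 3
    then have "\<zeta> (band (s, y)) < \<zeta> (band (0, y))" "\<zeta> (band (0, y)) < \<zeta> (band (s', y))"
      using neg[of s 0] pos[of 0 s'] assms by auto
    then show ?thesis by simp
  qed (use pos neg assms in blast)+
qed

text \<open>The whole cross-section at \<open>smax\<close> lies on one level, with
  \<open>V = 0\<close> and \<open>U\<close> equal to the width; both edges pass there from back to
  front, which is the upper joint of the braid.\<close>

lemma apex:
  "\<zeta> (band (smax, y)) = \<zeta>m" "U (band (smax, y)) = y" "V (band (smax, y)) = 0"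
proof -
  have e: "band (smax, y) = half_band (smax, y)" using order smax by (intro band_pos) auto
  note b = back_half_band[of smax y]
  have t: "(smax - a) / len = tstar" using len by (simp add: smax_def)
  show z: "\<zeta> (band (smax, y)) = \<zeta>m" using b smax by (simp add: e t \<zeta>m_def)
  then have "\<tau> (\<zeta> (band (smax, y))) = 1" using \<zeta>m h_pos by (intro \<tau>_1) auto
  then show "U (band (smax, y)) = y" "V (band (smax, y)) = 0"
    using b smax by (simp_all add: U_def V_def e FA_def t xs_def)
qed

lemma apex_mirror:
  "band (lam - smax, y) = flip (band (smax, 1 - y))" "band (- smax, y) = flip (band (smax, y))"
  using band_mirror[of smax "1 - y"] by (simp_all add: band_flip)

lemma smax_less: "smax < lam - smax"
  using order smax by (simp add: lam_def)

lemma V_front_band: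
  assumes "smax \<le> s" "s \<le> lam - smax" "y \<in> {0..1}"
  shows "csep * (1 - \<bar>\<zeta> (band (s, y)) / \<zeta>m\<bar>) \<le> V (band (s, y))"
proof (cases "s \<le> L")
  case True
  then show ?thesis using V_front[of s y] assms band_pos[of s y] smax \<zeta>m_pos by (simp add: abs_divide)
next
  case False
  have e: "band (s, y) = flip (half_band (lam - s, 1 - y))"
    using band_mirror[of "lam - s" "1 - y"] band_pos[of "lam - s" "1 - y"] False assms smax by (simp add: lam_def)
  show ?thesis using V_front[of "lam - s" "1 - y"] assms False \<zeta>m_pos
    by (simp add: e V_flip \<zeta>_flip abs_divide lam_def)
qed

lemma V_back_band:
  obtains c where "0 < c" "\<And>s y. \<bar>s\<bar> \<le> smax \<Longrightarrow> y \<in> {0, 1} \<Longrightarrow> c * (1 - \<bar>\<zeta> (band (s, y)) / \<zeta>m\<bar>) \<le> - V (band (s, y))"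
proof -
  have y01: "0 \<in> {0..1::real}" "1 \<in> {0..1::real}" by auto
  obtain c0 where c0: "0 < c0" "\<And>s. s \<in> {0..smax} \<Longrightarrow> c0 * (1 - \<bar>\<zeta> (half_band (s, 0))\<bar> / \<zeta>m) \<le> - V (half_band (s, 0))"
    using V_back_linear[OF y01(1)] by metis
  obtain c1 where c1: "0 < c1" "\<And>s. s \<in> {0..smax} \<Longrightarrow> c1 * (1 - \<bar>\<zeta> (half_band (s, 1))\<bar> / \<zeta>m) \<le> - V (half_band (s, 1))"
    using V_back_linear[OF y01(2)] by metis
  have *: "min c0 c1 * (1 - \<bar>\<zeta> (half_band (s, y))\<bar> / \<zeta>m) \<le> - V (half_band (s, y))"
    if s: "s \<in> {0..smax}" and y: "y \<in> {0, 1}" for s y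
  proof -
    have "\<bar>\<zeta> (half_band (s, y))\<bar> \<le> \<zeta>m" using tilt_back[of s y] back_half_band(3)[of s y] s by simp
    then have nn: "0 \<le> 1 - \<bar>\<zeta> (half_band (s, y))\<bar> / \<zeta>m" using \<zeta>m_pos by simp
    have "min c0 c1 * (1 - \<bar>\<zeta> (half_band (s, y))\<bar> / \<zeta>m) \<le> c0 * (1 - \<bar>\<zeta> (half_band (s, y))\<bar> / \<zeta>m)"
      "min c0 c1 * (1 - \<bar>\<zeta> (half_band (s, y))\<bar> / \<zeta>m) \<le> c1 * (1 - \<bar>\<zeta> (half_band (s, y))\<bar> / \<zeta>m)"
      using nn by (intro mult_right_mono; simp)+
    then show ?thesis using y c0(2)[OF s] c1(2)[OF s] by fastforce
  qed
  show ?thesis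
  proof (rule that[of "min c0 c1"])
    fix s y :: real assume s: "\<bar>s\<bar> \<le> smax" and y: "y \<in> {0, 1}"
    show "min c0 c1 * (1 - \<bar>\<zeta> (band (s, y)) / \<zeta>m\<bar>) \<le> - V (band (s, y))"
    proof (cases "0 \<le> s")
      case True
      then have "band (s, y) = half_band (s, y)" using s order by (intro band_pos) auto
      then show ?thesis using *[of s y] True s y \<zeta>m_pos by (simp add: abs_divide)
    next
      case False
      then have "band (s, y) = flip (half_band (- s, y))" using s order by (intro band_neg) auto
      then show ?thesis using *[of "- s" y] False s y \<zeta>m_pos by (simp add: abs_divide \<zeta>_flip V_flip)
    qed
  qed (use c0 c1 in simp)
qed

lemma front_parameter:
  assumes y: "y \<in> {0..1}"
  obtains i where "continuous_on {-1..1} i"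
    "\<And>t. t \<in> {-1..1} \<Longrightarrow> smax \<le> i t \<and> i t \<le> lam - smax \<and> \<zeta> (band (i t, y)) = t * \<zeta>m"
    "\<And>s. smax \<le> s \<Longrightarrow> s \<le> lam - smax \<Longrightarrow> i (\<zeta> (band (s, y)) / \<zeta>m) = s"
proof -
  let ?g = "\<lambda>s. \<zeta> (band (s, y)) / \<zeta>m"
  have g: "continuous_on {smax..lam - smax} ?g"
    by (intro continuous_intros continuous_on_compose2[OF continuous_\<zeta>[of UNIV] continuous_edge[OF y]])
      (use \<zeta>m_pos in auto)
  have anti: "strict_antimono_on {smax..lam - smax} ?g"
  proof (rule monotone_onI)
    fix s s' assume "s \<in> {smax..lam - smax}" "s' \<in> {smax..lam - smax}" "s < s'"
    then show "?g s' < ?g s"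
      using front_decreasing[of s s' y] y \<zeta>m_pos by (simp add: divide_strict_right_mono)
  qed
  have ends: "?g smax = 1" "?g (lam - smax) = - 1"
    using \<zeta>m_pos by (simp_all add: apex apex_mirror \<zeta>_flip)
  obtain i where i: "continuous_on {?g (lam - smax)..?g smax} i"
    "\<And>t. t \<in> {?g (lam - smax)..?g smax} \<Longrightarrow> i t \<in> {smax..lam - smax} \<and> ?g (i t) = t"
    "\<And>s. s \<in> {smax..lam - smax} \<Longrightarrow> i (?g s) = s"
    using inverse_of_strict_antimono[OF g anti less_imp_le[OF smax_less]] by metis
  show ?thesis
  proof (rule that[of i])
    show "continuous_on {-1..1} i" using i(1) unfolding ends .
    show "smax \<le> i t \<and> i t \<le> lam - smax \<and> \<zeta> (band (i t, y)) = t * \<zeta>m" if "t \<in> {-1..1}" for t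
      using i(2)[of t] that \<zeta>m_pos unfolding ends by (auto simp: field_simps)
  qed (use i(3) in auto)
qed

lemma back_parameter:
  obtains i where "continuous_on {-1..1} i"
    "\<And>t y. t \<in> {-1..1} \<Longrightarrow> \<bar>i t\<bar> \<le> smax \<and> \<zeta> (band (i t, y)) = t * \<zeta>m"
    "i 1 = smax" "i (- 1) = - smax"
proof -
  \<comment> \<open>The parameter is reversed because \<open>\<zeta>\<close> increases along the
    back, while the inversion lemma is for decreasing functions.\<close>
  let ?g = "\<lambda>s. \<zeta> (band (- s, 0)) / \<zeta>m"
  have y: "(0::real) \<in> {0..1}" by simp
  have "continuous_on {- smax..smax} (\<lambda>s. \<zeta> (band (s, 0)))"
    by (intro continuous_on_compose2[OF continuous_\<zeta>[of UNIV] continuous_edge[OF y]]) auto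
  then have "continuous_on {- smax..smax} (\<lambda>s. \<zeta> (band (- s, 0)))"
    by (rule continuous_on_compose2) (auto intro!: continuous_intros)
  then have g: "continuous_on {- smax..smax} ?g"
    by (intro continuous_intros) (use \<zeta>m_pos in auto)
  have anti: "strict_antimono_on {- smax..smax} ?g"
  proof (rule monotone_onI)
    fix s s' assume "s \<in> {- smax..smax}" "s' \<in> {- smax..smax}" "s < s'"
    then show "?g s' < ?g s"
      using back_increasing[of "- s'" "- s" 0] \<zeta>m_pos by (simp add: divide_strict_right_mono)
  qed
  have ends: "?g (- smax) = 1" "?g smax = - 1"
    using \<zeta>m_pos by (simp_all add: apex apex_mirror \<zeta>_flip)
  have le: "- smax \<le> smax" using smax by simp
  obtain i where i: "continuous_on {?g smax..?g (- smax)} i"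
    "\<And>t. t \<in> {?g smax..?g (- smax)} \<Longrightarrow> i t \<in> {- smax..smax} \<and> ?g (i t) = t"
    "\<And>s. s \<in> {- smax..smax} \<Longrightarrow> i (?g s) = s"
    using inverse_of_strict_antimono[OF g anti le] by metis
  show ?thesis
  proof (rule that[of "\<lambda>t. - i t"])
    show "continuous_on {-1..1} (\<lambda>t. - i t)" using i(1) unfolding ends by (intro continuous_intros)
    show "\<bar>- i t\<bar> \<le> smax \<and> \<zeta> (band (- i t, y)) = t * \<zeta>m" if "t \<in> {-1..1}" for t y
    proof -
      have it: "i t \<in> {- smax..smax}" "?g (i t) = t" using i(2)[of t] that unfolding ends by auto
      then have r: "\<bar>- i t\<bar> \<le> smax" by auto
      then have "\<zeta> (band (- i t, y)) = \<zeta> (band (- i t, 0))" by (rule back_coordinates(3))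
      then show ?thesis using it r \<zeta>m_pos by (simp add: field_simps)
    qed
    show "- i 1 = smax" "- i (- 1) = - smax" using i(3)[of "- smax"] i(3)[of smax] le unfolding ends by auto
  qed
qed

text \<open>Cutting one period at \<open>- smax\<close> and \<open>smax\<close> leaves a back and a
  front interval; with two edges each this gives the four strands.\<close>

lemma bdry_strands:
  assumes "p \<in> bdry"
  obtains s y where "p = band (s, y)" "y \<in> {0, 1}" "\<bar>s\<bar> \<le> smax \<or> smax \<le> s \<and> s \<le> lam - smax"
proof -
  obtain s where s: "p = band (s, 0)" using assms by (auto simp: bdry_def)
  obtain k t where t: "s = t + of_int k * (2 * L)" "- L \<le> t" "t < L" using fundamental_domain by blast
  have p: "p = band (t, tw k 0)" using band_deck[of t k "tw k 0"] t s by (simp add: tw_twice)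
  have y: "tw k 0 \<in> {0, 1}" by (simp add: tw_def)
  show ?thesis
  proof (cases "- smax \<le> t")
    case True
    then have "\<bar>t\<bar> \<le> smax \<or> smax \<le> t \<and> t \<le> lam - smax" using t order len by (auto simp: lam_def)
    then show ?thesis using that[OF p y] by blast
  next
    case False
    have "band (t, tw k 0) = band (t + lam, 1 - tw k 0)"
      using band_deck[of t 1 "tw k 0"] by (simp add: lam_def tw_def)
    moreover have "1 - tw k 0 \<in> {0, 1}" by (simp add: tw_def)
    ultimately show ?thesis using that[of "t + lam" "1 - tw k 0"] p t False order by (simp add: lam_def)
  qed
qed

lemma \<zeta>_le:
  assumes "\<bar>p $ 1\<bar> \<le> 1"
  shows "\<zeta> p \<le> p $ 3 + 4 * \<eta>"
proof -
  define Y where "Y = max 0 (min 3 (p $ 2))"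
  have Y: "0 \<le> Y" "Y \<le> 3" by (auto simp: Y_def)
  have sh: "0 \<le> shear q" "shear q \<le> 1 * 1" for q
    unfolding shear_def by (intro mult_mono mult_nonneg_nonneg ramp; simp)+
  have "Y * (- 1) \<le> Y * (shear p - shear (flip p))" using Y sh[of p] sh[of "flip p"] by (intro mult_left_mono) auto
  then have "- 4 \<le> p $ 1 + Y * (shear p - shear (flip p))" using Y assms by linarith
  then have "\<eta> * (- 4) \<le> \<eta> * (p $ 1 + Y * (shear p - shear (flip p)))" using \<eta>(1) by (intro mult_left_mono) auto
  then show ?thesis unfolding \<zeta>_def Y_def[symmetric] by linarith
qed

lemma band_T:
  assumes "s1 \<le> s" "s \<le> lam - s1" "y \<in> {0..1}"
  shows "band (s, y) $ 1 = y - 1 / 2" "1 + 2 * \<delta> \<le> band (s, y) $ 2" "band (s, y) $ 3 \<le> h"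
proof -
  have e: "band (s, y) = FT (s, y)"
  proof (cases "s \<le> L")
    case True
    then show ?thesis using band_pos[of s y] half_band_T[of s y] assms order smax by simp
  next
    case False
    have "band (s, y) = flip (half_band (lam - s, 1 - y))"
      using band_mirror[of "lam - s" "1 - y"] band_pos[of "lam - s" "1 - y"] False assms order smax by (simp add: lam_def)
    also have "half_band (lam - s, 1 - y) = FT (lam - s, 1 - y)" using assms by (intro half_band_T) auto
    finally show ?thesis by (simp add: FT_sym lam_def)
  qed
  let ?t = "(s - s1) / len"
  have "lam = 2 * s1 + len" by (simp add: lam_def L_def)
  then have "0 \<le> ?t" "?t \<le> 1" using assms len by simp_all
  then have "0 \<le> len * X ?t" using X_nonneg len by simp
  moreover have "0 \<le> len * Z ?t" using len Z_range(1)[of ?t] by simp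
  ultimately show "band (s, y) $ 1 = y - 1 / 2" "1 + 2 * \<delta> \<le> band (s, y) $ 2" "band (s, y) $ 3 \<le> h"
    by (simp_all add: e FT_def)
qed

lemma front_upper:
  assumes "smax \<le> s" "s \<le> lam - smax" "y \<in> {0..1}" "0 \<le> \<zeta> (band (s, y))"
  shows "s < lam - s1"
proof (rule ccontr)
  assume *: "\<not> s < lam - s1"
  have "\<zeta> (band (lam - s1, y)) = - \<zeta> (half_band (s1, 1 - y))"
    using band_mirror[of s1 "1 - y"] band_pos[of s1 "1 - y"] order smax by (simp add: \<zeta>_flip)
  moreover have "h / 2 \<le> \<zeta> (half_band (s1, 1 - y))" using assms order by (intro \<zeta>_upper) auto
  moreover have "\<zeta> (band (s, y)) \<le> \<zeta> (band (lam - s1, y))"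
    using front_decreasing[of "lam - s1" s y] assms * order by (cases "s = lam - s1") (auto simp: lam_def)
  ultimately show False using assms h_pos by linarith
qed

section \<open>Relative position of the two edges\<close>

text \<open>The edge \<open>y = 0\<close> meets the diagonal crease at its very beginning; by the
  time it reaches \<open>y \<ge> 1\<close> it runs along the line \<open>x = - 1 / 2\<close> in the
  layer at \<open>h\<close> or on the last fold.\<close>

lemma edge_0:
  assumes "smax \<le> s" "s < lam - s1" "1 \<le> band (s, 0) $ 2"
  shows "band (s, 0) $ 1 = - 1 / 2" "band (s, 0) $ 3 \<le> h"
proof -
  have "band (s, 0) $ 1 = - 1 / 2 \<and> band (s, 0) $ 3 \<le> h"
  proof (cases "s1 \<le> s")
    case True
    then show ?thesis using band_T[of s 0] assms by simp
  next
    case False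
    then have e: "band (s, 0) = half_band (s, 0)" using assms smax order by (intro band_pos) auto
    show ?thesis
    proof (cases "s0 \<le> s")
      case True
      then have e': "band (s, 0) = FD (s, 0)" using half_band_D[of s 0] False e by simp
      have "s0 + 2 * \<delta> \<le> s"
      proof (rule ccontr)
        assume "\<not> s0 + 2 * \<delta> \<le> s"
        then have "FD (s, 0) $ 2 \<le> FD (s0 + 2 * \<delta>, 0) $ 2" by (intro FD_mono) auto
        also have "\<dots> = \<delta>" using FD_eq(2)[of 0 "s0 + 2 * \<delta>"] by simp
        finally show False using assms e' \<delta> by simp
      qed
      then show ?thesis using FD_eq(2)[of 0 s] e' by simp
    next
      case False
      then have "band (s, 0) $ 2 = 0" using e by (simp add: half_band_def FA_def)
      then show ?thesis using assms by simp
    qed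
  qed
  then show "band (s, 0) $ 1 = - 1 / 2" "band (s, 0) $ 3 \<le> h" by blast+
qed

text \<open>From \<open>s0 + 1\<close> on this edge is to the right of \<open>x = - 1 / 2\<close>.
  Earlier it may be to the left, but then monotonicity keeps \<open>\<zeta>\<close> above its value
  at \<open>s0 + 1\<close>, where \<open>z = 2 * h\<close>.\<close>

lemma edge_1:
  assumes "smax \<le> s" "s < lam - s1"
  shows "1 \<le> band (s, 1) $ 2" "- 1 / 2 < band (s, 1) $ 1 \<or> 3 / 2 * h \<le> \<zeta> (band (s, 1))"
proof -
  have "1 \<le> band (s, 1) $ 2 \<and> (- 1 / 2 < band (s, 1) $ 1 \<or> 3 / 2 * h \<le> \<zeta> (band (s, 1)))"
  proof (cases "s1 \<le> s")
    case True
    then show ?thesis using band_T[of s 1] assms \<delta> by simp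
  next
    case False
    then have e: "band (s, 1) = half_band (s, 1)" using assms smax order by (intro band_pos) auto
    have s01: "s0 \<le> s0 + 1" "s0 + 1 \<le> s1" using \<delta> by (simp_all add: s1_def)
    have m: "FD (s0 + 1, 1) = vector [\<delta> - a + 1, 1, 2 * h]" using FD_eq(1)[of "s0 + 1" 1] by simp
    have y: "1 \<le> half_band (s, 1) $ 2"
    proof (cases "s0 \<le> s")
      case True
      then have "FD (s0, 1) $ 2 \<le> FD (s, 1) $ 2" using FD_mono(2)[of s0 s 1] by (cases "s = s0") auto
      then show ?thesis using True False half_band_D[of s 1] FD_eq(1)[of s0 1] by simp
    next
      case False
      then show ?thesis by (simp add: half_band_def FA_def)
    qed
    show ?thesis
    proof (cases "s0 + 1 \<le> s")
      case True
      then have "FD (s0 + 1, 1) $ 1 \<le> FD (s, 1) $ 1" using FD_mono(1)[of "s0 + 1" s 1] by (cases "s = s0 + 1") auto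
      then have "- 1 / 2 < half_band (s, 1) $ 1"
        using True False half_band_D[of s 1] s01 a_le \<delta> by (simp add: m)
      then show ?thesis using y e by simp
    next
      case F: False
      have "half_band (s0 + 1, 1) = FD (s0 + 1, 1)" using s01 by (intro half_band_D) auto
      moreover have "FD (s0 + 1, 1) $ 3 - 4 * \<eta> \<le> \<zeta> (FD (s0 + 1, 1))"
        by (intro \<zeta>_bounds) (use a_le \<delta> h_pos in \<open>simp_all add: m\<close>)
      moreover have "\<zeta> (half_band (s0 + 1, 1)) < \<zeta> (half_band (s, 1))"
        using F assms s01 order by (intro \<zeta>_half_band_decreasing) auto
      ultimately have "3 / 2 * h \<le> \<zeta> (half_band (s, 1))" using \<eta> h_pos by (simp add: m)
      then show ?thesis using y e by simp
    qed
  qed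
  then show "1 \<le> band (s, 1) $ 2" "- 1 / 2 < band (s, 1) $ 1 \<or> 3 / 2 * h \<le> \<zeta> (band (s, 1))" by blast+
qed

text \<open>Seen along the axis, the edge \<open>y = 1\<close> passes the edge \<open>y = 0\<close> always on the same side.\<close>

lemma crossing:
  assumes s: "smax \<le> s" "s \<le> lam - smax" and s': "smax \<le> s'" "s' \<le> lam - smax"
    and \<zeta>: "\<zeta> (band (s, 1)) = \<zeta> (band (s', 0))" "0 \<le> \<zeta> (band (s', 0))" and U: "U (band (s, 1)) = U (band (s', 0))"
  shows "V (band (s', 0)) < V (band (s, 1))"
proof -
  let ?p = "band (s, 1)" and ?q = "band (s', 0)"
  have lt: "s < lam - s1" "s' < lam - s1" using front_upper[of s 1] front_upper[of s' 0] assms by auto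
  show ?thesis
  proof (cases "s1 \<le> s \<and> s1 \<le> s'")
    case True
    \<comment> \<open>Both strands are on the last fold, at \<open>x = 1 / 2\<close> and
      \<open>x = - 1 / 2\<close>, so that equality of \<open>U\<close> becomes
      \<open>T * d = 1 - T\<close>.\<close>
    define T where "T = \<tau> (\<zeta> ?q)"
    define d where "d = ?p $ 2 - ?q $ 2"
    have T: "0 \<le> T" "T \<le> 1" using \<zeta> \<tau>_nonneg \<tau>_range by (auto simp: T_def)
    have x: "?p $ 1 = 1 / 2" "?q $ 1 = - 1 / 2" using band_T(1)[of s 1] band_T(1)[of s' 0] True lt by auto
    have Td: "T * d = 1 - T"
      using U T unfolding U_def \<zeta>(1) x T_def[symmetric] by (simp add: d_def algebra_simps)
    have "T \<noteq> 0" using Td by auto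
    then have "0 < T" using T by simp
    have "0 \<le> T * d" using Td T by simp
    then have "0 \<le> d" using \<open>0 < T\<close> by (simp add: zero_le_mult_iff)
    then have "0 \<le> (1 - T) * d" using T by simp
    moreover have "V ?p - V ?q = T + (1 - T) * d"
      using T unfolding V_def \<zeta>(1) x T_def[symmetric] by (simp add: d_def algebra_simps)
    ultimately show ?thesis using \<open>0 < T\<close> by linarith
  next
    case False
    \<comment> \<open>One strand has not yet reached the last fold, so the common level is high,
      \<open>U\<close> and \<open>V\<close> are \<open>y\<close> and \<open>x - xs\<close>, and the
      edges are compared by \<open>x\<close>.\<close>
    have up: "h / 2 \<le> \<zeta> (band (s, y))" if "smax \<le> s" "s < s1" "y \<in> {0..1}" for s y
      using \<zeta>_upper[of s y] that band_pos[of s y] order smax by simp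
    have "h / 2 \<le> \<zeta> ?q" using up[of s 1] up[of s' 0] False s s' \<zeta>(1) by auto
    then have "\<tau> (\<zeta> ?q) = 1" using h_pos by (intro \<tau>_1) auto
    then have UV: "U ?p = ?p $ 2" "V ?p = ?p $ 1 - xs" "U ?q = ?q $ 2" "V ?q = ?q $ 1 - xs"
      by (simp_all add: U_def V_def \<zeta>(1))
    have "1 \<le> ?q $ 2" using edge_1(1)[of s] s lt U UV by simp
    then have q: "?q $ 1 = - 1 / 2" "?q $ 3 \<le> h" using edge_0[of s'] s' lt by auto
    then have "\<zeta> ?q \<le> h + 4 * \<eta>" using \<zeta>_le[of ?q] by simp
    then have "\<zeta> ?p < 3 / 2 * h" using \<zeta>(1) \<eta> h_pos by linarith
    then have "- 1 / 2 < ?p $ 1" using edge_1(2)[of s] s lt by auto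
    then show ?thesis using UV q by simp
  qed
qed

lemma front_at_0:
  assumes "smax \<le> s" "s \<le> lam - smax" "y \<in> {0..1}" "\<zeta> (band (s, y)) = 0"
  shows "U (band (s, y)) = 1 / 2 - y" "\<delta> \<le> V (band (s, y))"
proof -
  have "s < lam - s1" using front_upper[of s y] assms by simp
  moreover have "s1 \<le> s"
    using \<zeta>_upper[of s y] band_pos[of s y] assms order smax h_pos by (cases "s1 \<le> s") auto
  ultimately show "U (band (s, y)) = 1 / 2 - y" "\<delta> \<le> V (band (s, y))"
    using band_T[of s y] assms(3,4) by (simp_all add: U_def V_def \<tau>_def y0_def)
qed

section \<open>Verification of the braid hypotheses\<close>

text \<open>Near the strands the level \<open>\<zeta> = 0\<close> is the plane
  \<open>z = \<eta> * x\<close>; this parametrises it by \<open>U + \<i> * V\<close> and serves as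
  the section \<open>\<sigma>\<close>.\<close>

definition plane_point :: "complex \<Rightarrow> real ^ 3" where
  "plane_point q = vector [- Re q, Im q + y0, - \<eta> * Re q]"

lemma plane_point:
  assumes "\<bar>Re q\<bar> < 1"
  shows "\<zeta> (plane_point q) = 0" "U (plane_point q) = Re q" "V (plane_point q) = Im q"
proof -
  have "\<bar>\<eta> * Re q\<bar> \<le> \<eta> * 1" using assms \<eta> unfolding abs_mult by (intro mult_mono) auto
  then have "- (\<eta> * Re q) \<le> h / 2" "\<eta> * Re q \<le> h / 2" using \<eta> h_pos by linarith+
  then have "shear (plane_point q) = 0" "shear (flip (plane_point q)) = 0"
    by (intro shear_0 disjI2; simp add: plane_point_def flip_nth)+
  then show "\<zeta> (plane_point q) = 0" by (simp add: \<zeta>_def plane_point_def)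
  then show "U (plane_point q) = Re q" "V (plane_point q) = Im q"
    by (simp_all add: U_def V_def \<tau>_def) (simp_all add: plane_point_def)
qed

lemma continuous_plane_point: "continuous_on S plane_point"
  unfolding plane_point_def vec3 by (intro continuous_intros)

lemma bdry_not_loops_commute: "\<exists>x. x \<notin> bdry \<and> \<not> loops_commute (- bdry) x"
proof -
  have y01: "0 \<in> {0..1::real}" "1 \<in> {0..1::real}" by auto
  obtain i0 where i0: "continuous_on {-1..1} i0"
    "\<And>t. t \<in> {-1..1} \<Longrightarrow> smax \<le> i0 t \<and> i0 t \<le> lam - smax \<and> \<zeta> (band (i0 t, 0)) = t * \<zeta>m"
    "\<And>s. smax \<le> s \<Longrightarrow> s \<le> lam - smax \<Longrightarrow> i0 (\<zeta> (band (s, 0)) / \<zeta>m) = s"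
    using front_parameter[OF y01(1)] by metis
  obtain i1 where i1: "continuous_on {-1..1} i1"
    "\<And>t. t \<in> {-1..1} \<Longrightarrow> smax \<le> i1 t \<and> i1 t \<le> lam - smax \<and> \<zeta> (band (i1 t, 1)) = t * \<zeta>m"
    "\<And>s. smax \<le> s \<Longrightarrow> s \<le> lam - smax \<Longrightarrow> i1 (\<zeta> (band (s, 1)) / \<zeta>m) = s"
    using front_parameter[OF y01(2)] by metis
  obtain j where j: "continuous_on {-1..1} j"
    "\<And>t y. t \<in> {-1..1} \<Longrightarrow> \<bar>j t\<bar> \<le> smax \<and> \<zeta> (band (j t, y)) = t * \<zeta>m" "j 1 = smax" "j (- 1) = - smax"
    using back_parameter by metis
  obtain c' where c': "0 < c'"
    "\<And>s y. \<bar>s\<bar> \<le> smax \<Longrightarrow> y \<in> {0, 1} \<Longrightarrow> c' * (1 - \<bar>\<zeta> (band (s, y)) / \<zeta>m\<bar>) \<le> - V (band (s, y))"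
    using V_back_band by metis
  define c where "c = min csep c'"
  have c: "0 < c" "c \<le> csep" "c \<le> c'" using csep c' by (auto simp: c_def)
  define f b where "f = (\<lambda>p. Complex (U p) (V p))" and "b = (\<lambda>p. Complex (U p) (- V p))"
  \<comment> \<open>The edge \<open>y = 1\<close> supplies \<open>P\<close> and \<open>R1\<close>,
    the edge \<open>y = 0\<close> supplies \<open>Q\<close> and \<open>R0\<close>. Each edge
    continues itself through the upper joint, while the gluing exchanges them at the lower
    one.\<close>
  define P Q where "P = (\<lambda>t. f (band (i1 t, 1)))" and "Q = (\<lambda>t. f (band (i0 t, 0)))"
  define R0 R1 where "R0 = (\<lambda>t. b (band (j t, 0)))" and "R1 = (\<lambda>t. b (band (j t, 1)))"
  note defs = P_def Q_def R0_def R1_def f_def b_def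
  \<comment> \<open>The bounds on the real part are those under which \<open>plane_point\<close> is
    a section; \<open>D\<close> is convex, so the segment between the strands lies in it with its
    endpoints.\<close>
  define D where "D = {q. c < Im q} \<inter> ({q. Re q < 1} \<inter> {q. - 1 < Re q})"
  have ends: "i1 1 = smax" "i0 1 = smax" "i1 (- 1) = lam - smax" "i0 (- 1) = lam - smax"
    using i1(3)[of smax] i0(3)[of smax] i1(3)[of "lam - smax"] i0(3)[of "lam - smax"] smax_less \<zeta>m_pos
    by (simp_all add: apex apex_mirror \<zeta>_flip)
  have cont_f: "continuous_on UNIV f" "continuous_on UNIV b"
    unfolding f_def b_def Complex_eq by (intro continuous_intros continuous_UV)+
  have cont_edge: "continuous_on {-1..1} (\<lambda>t. band (i t, y))" if "continuous_on {-1..1} i" "y \<in> {0..1}" for i y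
    by (rule continuous_on_compose2[OF continuous_edge[OF that(2), of UNIV] that(1)]) auto
  have weak: "c * (1 - \<bar>t\<bar>) \<le> csep * (1 - \<bar>t\<bar>)" "c * (1 - \<bar>t\<bar>) \<le> c' * (1 - \<bar>t\<bar>)" if "t \<in> {-1..1}" for t
    using c that by (intro mult_right_mono; auto)+
  have lev: "t * \<zeta>m / \<zeta>m = t" for t using \<zeta>m_pos by simp
  have not_nonpos: "\<i> * w \<notin> \<real>\<^sub>\<le>\<^sub>0 \<longleftrightarrow> (Re w = 0 \<longrightarrow> Im w < 0)"
    "- \<i> * w \<notin> \<real>\<^sub>\<le>\<^sub>0 \<longleftrightarrow> (Re w = 0 \<longrightarrow> 0 < Im w)" for w
    by (auto simp: complex_nonpos_Reals_iff)
  have mid: "P 0 = Complex (- 1 / 2) (Im (P 0))" "Q 0 = Complex (1 / 2) (Im (Q 0))" "\<delta> \<le> Im (P 0)" "\<delta> \<le> Im (Q 0)"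
    using front_at_0[of "i1 0" 1] front_at_0[of "i0 0" 0] i1(2)[of 0] i0(2)[of 0]
    by (simp_all add: P_def Q_def f_def)
  interpret three_half_twists bdry "\<lambda>p. \<zeta> p / \<zeta>m" U V c P Q R0 R1 D plane_point
  proof
    show "continuous_on UNIV (\<lambda>p. \<zeta> p / \<zeta>m)"
      using \<zeta>m_pos by (intro continuous_intros continuous_\<zeta>) simp
    show "continuous_on UNIV U" "continuous_on UNIV V" by (rule continuous_UV)+
    show "0 < c" by (rule c)
    show "continuous_on {-1..1} P" "continuous_on {-1..1} Q" "continuous_on {-1..1} R0" "continuous_on {-1..1} R1"
      unfolding P_def Q_def R0_def R1_def
      by (rule continuous_on_compose2[OF cont_f(1) cont_edge[OF i1(1) y01(2)]]
          continuous_on_compose2[OF cont_f(1) cont_edge[OF i0(1) y01(1)]]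
          continuous_on_compose2[OF cont_f(2) cont_edge[OF j(1) y01(1)]]
          continuous_on_compose2[OF cont_f(2) cont_edge[OF j(1) y01(2)]]; simp)+
    show "P 1 = R1 1" "Q 1 = R0 1" "Im (R0 1) = 0" "Im (R1 1) = 0" "Re (R0 1) < Re (R1 1)"
      "P (- 1) = R0 (- 1)" "Q (- 1) = R1 (- 1)" "Im (R0 (- 1)) = 0" "Im (R1 (- 1)) = 0" "Re (R1 (- 1)) < Re (R0 (- 1))"
      by (simp_all add: defs ends j apex apex_mirror U_flip V_flip)
    show "c * (1 - \<bar>t\<bar>) \<le> Im (P t)" if "t \<in> {-1..1}" for t
      using V_front_band[of "i1 t" 1] i1(2)[OF that] weak(1)[OF that] by (simp add: P_def f_def lev)
    show "c * (1 - \<bar>t\<bar>) \<le> Im (Q t)" if "t \<in> {-1..1}" for t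
      using V_front_band[of "i0 t" 0] i0(2)[OF that] weak(1)[OF that] by (simp add: Q_def f_def lev)
    show "c * (1 - \<bar>t\<bar>) \<le> Im (R0 t)" if "t \<in> {-1..1}" for t
      using c'(2)[of "j t" 0] j(2)[OF that] weak(2)[OF that] by (simp add: R0_def b_def lev)
    show "c * (1 - \<bar>t\<bar>) \<le> Im (R1 t)" if "t \<in> {-1..1}" for t
      using c'(2)[of "j t" 1] j(2)[OF that] weak(2)[OF that] by (simp add: R1_def b_def lev)
    show "p \<in> bdry" if p: "\<bar>\<zeta> p / \<zeta>m\<bar> \<le> 1" "0 \<le> V p" "Complex (U p) (V p) \<in> {P (\<zeta> p / \<zeta>m), Q (\<zeta> p / \<zeta>m)}" for p
    proof -
      have t: "\<zeta> p / \<zeta>m \<in> {-1..1}" using p(1) unfolding abs_le_iff by auto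
      have z: "\<zeta> p / \<zeta>m * \<zeta>m = \<zeta> p" using \<zeta>m_pos by simp
      have "p = band (i1 (\<zeta> p / \<zeta>m), 1) \<or> p = band (i0 (\<zeta> p / \<zeta>m), 0)"
        using p(3) i1(2)[OF t] i0(2)[OF t] z level_coordinates_inj[of p "band (i1 (\<zeta> p / \<zeta>m), 1)"]
          level_coordinates_inj[of p "band (i0 (\<zeta> p / \<zeta>m), 0)"] by (auto simp: P_def Q_def f_def)
      then show ?thesis by (metis in_bdry)
    qed
    show "p \<in> bdry" if p: "\<bar>\<zeta> p / \<zeta>m\<bar> \<le> 1" "V p \<le> 0" "Complex (U p) (- V p) \<in> {R0 (\<zeta> p / \<zeta>m), R1 (\<zeta> p / \<zeta>m)}" for p
    proof -
      have t: "\<zeta> p / \<zeta>m \<in> {-1..1}" using p(1) unfolding abs_le_iff by auto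
      have z: "\<zeta> p / \<zeta>m * \<zeta>m = \<zeta> p" using \<zeta>m_pos by simp
      have "p = band (j (\<zeta> p / \<zeta>m), 0) \<or> p = band (j (\<zeta> p / \<zeta>m), 1)"
        using p(3) j(2)[OF t, of 0] j(2)[OF t, of 1] z level_coordinates_inj[of p "band (j (\<zeta> p / \<zeta>m), 0)"]
          level_coordinates_inj[of p "band (j (\<zeta> p / \<zeta>m), 1)"] by (auto simp: R0_def R1_def b_def)
      then show ?thesis by (metis in_bdry)
    qed
    show "Complex (U p) (V p) \<in> {P 0, Q 0}" if p: "p \<in> bdry" "\<zeta> p / \<zeta>m = 0" "0 < V p" for p
    proof -
      obtain s y where sy: "p = band (s, y)" "y \<in> {0, 1}" "\<bar>s\<bar> \<le> smax \<or> smax \<le> s \<and> s \<le> lam - smax"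
        using bdry_strands[OF p(1)] by metis
      have z: "\<zeta> (band (s, y)) = 0" using p(2) \<zeta>m_pos sy by simp
      have "\<not> \<bar>s\<bar> \<le> smax" using c'(2)[of s y] c'(1) sy p(3) z by auto
      then have r: "smax \<le> s" "s \<le> lam - smax" using sy by auto
      show ?thesis using sy i1(3)[OF r] i0(3)[OF r] z by (auto simp: P_def Q_def f_def)
    qed
    show "\<i> * (Q t - P t) \<notin> \<real>\<^sub>\<le>\<^sub>0" if t: "t \<in> {0..1}" for t
    proof -
      have t': "t \<in> {-1..1}" using t by auto
      have "0 \<le> t * \<zeta>m" using t \<zeta>m_pos by auto
      then show ?thesis
        unfolding not_nonpos using crossing[of "i1 t" "i0 t"] i1(2)[OF t'] i0(2)[OF t'] by (simp add: P_def Q_def f_def)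
    qed
    show "- \<i> * (Q t - P t) \<notin> \<real>\<^sub>\<le>\<^sub>0" if t: "t \<in> {-1..0}" for t
    proof -
      have t': "t \<in> {-1..1}" using t by auto
      have n: "0 \<le> - (t * \<zeta>m)" using t \<zeta>m_pos by (simp add: mult_le_0_iff)
      \<comment> \<open>The half-turn reverses heights and exchanges the edges, so below level 0 the
        crossing rule is applied to the mirrored strands.\<close>
      have m: "band (lam - i0 t, 1) = flip (band (i0 t, 0))" "band (lam - i1 t, 0) = flip (band (i1 t, 1))"
        using band_mirror[of "i0 t" 0] band_mirror[of "i1 t" 1] by simp_all
      show ?thesis
        unfolding not_nonpos using crossing[of "lam - i0 t" "lam - i1 t"] i1(2)[OF t'] i0(2)[OF t'] n
        by (simp add: P_def Q_def f_def m U_flip V_flip \<zeta>_flip)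
    qed
    show "0 < Re (Q 0 - P 0)" by (simp add: mid(1,2)[THEN arg_cong[where f = Re]])
    show "\<i> * (R1 t - R0 t) \<notin> \<real>\<^sub>\<le>\<^sub>0" if t: "t \<in> {-1..1}" for t
    proof -
      let ?T = "\<tau> (t * \<zeta>m)"
      have r: "\<bar>j t\<bar> \<le> smax" "\<And>y. \<zeta> (band (j t, y)) = t * \<zeta>m" using j(2)[OF t] by auto
      note e = back_coordinates(1)[OF r(1)] back_coordinates(2)[OF r(1), of 1 0] r(2)
      \<comment> \<open>On the back the difference of the edges is explicitly
        \<open>\<tau> - \<i> * (1 - |\<tau>|)\<close>, one half-turn through the lower
        half-plane.\<close>
      have "Re (R1 t - R0 t) = ?T" "Im (R1 t - R0 t) = - (1 - \<bar>?T\<bar>)"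
        by (simp_all add: R1_def R0_def b_def U_def V_def e algebra_simps)
      then show ?thesis unfolding not_nonpos by simp
    qed
    show "open D" unfolding D_def
      by (intro open_Int open_halfspace_Im_gt open_halfspace_Re_lt open_halfspace_Re_gt)
    have "convex D" unfolding D_def
      by (intro convex_Int convex_halfspace_Im_gt convex_halfspace_Re_lt convex_halfspace_Re_gt)
    moreover have "P 0 \<in> D" "Q 0 \<in> D"
      using mid(3,4) c csep \<delta> by (auto simp: D_def mid(1,2)[THEN arg_cong[where f = Re]])
    ultimately show "closed_segment (P 0) (Q 0) \<subseteq> D" by (intro closed_segment_subset)
    show "c < Im q" if "q \<in> D" for q using that by (simp add: D_def)
    show "continuous_on D plane_point" by (rule continuous_plane_point)
    show "\<zeta> (plane_point q) / \<zeta>m = 0" "U (plane_point q) = Re q" "V (plane_point q) = Im q" if "q \<in> D" for q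
      using that plane_point[of q] by (auto simp: D_def)
  qed
  show ?thesis by (rule not_loops_commute)
qed

lemma multi_twisted_embed: "multi_twisted lam embed"
proof -
  have "\<not> (round_circle C \<and> ambient_isotopic bdry C)" for C
    using bdry_not_loops_commute trivial_knot_loops_commute by blast
  then have "nontrivial_knot bdry" using knot_bdry by (simp add: nontrivial_knot_def)
  then show ?thesis by (simp add: multi_twisted_def paper_moebius_band_embed image_boundary)
qed

end

theorem theorem1p1:
  shows "lambda_star \<le> 3"
proof (rule ereal_le_epsilon2)
  fix e :: real assume e: "0 < e"
  obtain \<Theta> X Z where "uturn \<Theta> X Z" using uturn_exists by blast
  \<comment> \<open>The quotient by 21 matches the bound
    \<open>lam \<le> 3 + 21 * \<delta>\<close>.\<close>
  define \<delta> where "\<delta> = min (1 / 40) (e / 21)"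
  have \<delta>: "0 < \<delta>" "\<delta> \<le> 1 / 40" "21 * \<delta> \<le> e" using e by (auto simp: \<delta>_def)
  interpret C: crisscross \<Theta> X Z \<delta>
    using \<open>uturn \<Theta> X Z\<close> \<delta> by (simp add: crisscross_def crisscross_axioms_def)
  have "lambda_star \<le> ereal C.lam"
    unfolding lambda_star_def using C.lam_pos C.multi_twisted_embed by (intro Inf_lower) blast
  also have "\<dots> \<le> ereal (3 + e)" using C.lam_le \<delta>(3) by simp
  finally show "lambda_star \<le> 3 + ereal e" by simp
qed

end
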